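(* Let $a=(a_1,a_2)$ with $a_1,a_2>0$ and $x=(x_1,x_2)$ with $x_1,x_2>0$. Then $$\mathbf{E}\bigl[M_{(a,x)}^q\bigr]=\frac{\Gamma_2(x_1-q\,|\,a)}{\Gamma_2(x_1\,|\,a)}\frac{\Gamma_2(x_2-q\,|\,a)}{\Gamma_2(x_2\,|\,a)}\frac{\Gamma_2(a_1+a_2-q\,|\,a)}{\Gamma_2(a_1+a_2\,|\,a)}\frac{\Gamma_2(x_1+x_2-q\,|\,a)}{\Gamma_2(x_1+x_2-2q\,|\,a)},\qquad \Re(q)<\min(x_1,x_2,a_1+a_2),$$ is the Mellin transform of a probability distribution $M_{(a,x)}$ on $(0,\infty)$. Let $L=\exp(\mathcal{N}(0,4\log2/(a_1a_2)))$ be lognormal (the normal having mean $0$ and variance $4\log 2/(a_1a_2)$), and let $X_1,X_2,X_3$ have the $\beta_{2,2}^{-1}(a,b)$ distribution with the parameters $$X_1=\beta_{2,2}^{-1}\bigl(a,\ b_0=x_1,\ b_1=b_2=(x_2-x_1)/2\bigr),$$ $$X_2=\beta_{2,2}^{-1}\bigl(a,\ b_0=(x_1+x_2)/2,\ b_1=a_1/2,\ b_2=a_2/2\bigr),$$ $$X_3=\beta_{2,2}^{-1}\bigl(a,\ b_0=a_1+a_2,\ b_1=b_2=(x_1+x_2-a_1-a_2)/2\bigr),$$ with $L,X_1,X_2,X_3$ independent. Then $M_{(a,x)}$ has the factorization $$M_{(a,x)}\overset{\text{in law}}{=}2^{-(2(x_1+x_2)-(a_1+a_2))/(a_1a_2)}\,L\,X_1\,X_2\,X_3.$$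 In particular, $\log M_{(a,x)}$ is absolutely continuous and infinitely divisible.
   Context: Barnes double gamma function: for $a=(a_1,a_2)$, $a_j>0$, $\zeta_2(s,w\,|\,a)=\sum_{k_1,k_2=0}^\infty(w+k_1a_1+k_2a_2)^{-s}$ for $\Re(s)>2$, $\Re(w)>0$, continued meromorphically in $s$; $\Gamma_2(w\,|\,a)=\exp\bigl(\partial_s\zeta_2(s,w\,|\,a)|_{s=0}\bigr)$, which continues to a meromorphic function of $w\in\mathbb{C}$ without zeros. Barnes beta distribution: for $b=(b_0,b_1,b_2)$ with $b_0,b_1,b_2>0$, $\beta_{2,2}(a,b)$ is the probability distribution on $(0,1]$ with Mellin transform $$\mathbf{E}[\beta_{2,2}(a,b)^q]=\frac{\Gamma_2(q+b_0\,|\,a)}{\Gamma_2(b_0\,|\,a)}\frac{\Gamma_2(b_0+b_1\,|\,a)}{\Gamma_2(q+b_0+b_1\,|\,a)}\frac{\Gamma_2(b_0+b_2\,|\,a)}{\Gamma_2(q+b_0+b_2\,|\,a)}\frac{\Gamma_2(q+b_0+b_1+b_2\,|\,a)}{\Gamma_2(b_0+b_1+b_2\,|\,a)},\qquad \Re(q)>-b_0.$$ $\beta_{2,2}^{-1}(a,b)$ denotes the law of the reciprocal random variable.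
   Formalization: The parameters b1=b2 of X1 and X3 may be zero or negative, where the Barnes beta law is not defined above; it is there taken to be the law on (0,1] with the same Mellin formula, valid for Re(q) > -min(b0, b0+b1+b2), which is Re(q) > -b0 when b1,b2 > 0. *)

theory Defs
  imports "HOL-Complex_Analysis.Complex_Analysis" "HOL-Probability.Probability"
begin

section \<open>The Barnes double gamma function\<close>

text \<open>
  The continuation in s is normalised by nicely meromorphic on the whole plane, which makes
  it unique: the value is 0 at poles, and the function is continuous everywhere else.
\<close>

definition barnes_zeta2 :: "real \<Rightarrow> real \<Rightarrow> complex \<Rightarrow> complex \<Rightarrow> complex" where
  "barnes_zeta2 a1 a2 w = (THE f. f nicely_meromorphic_on UNIV \<and>
     (\<forall>s. Re s > 2 \<longrightarrow>
        f s = (\<Sum>\<^sub>\<infinity>(k1, k2) \<in> (UNIV :: (nat \<times> nat) set).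
                 (w + of_nat k1 * of_real a1 + of_nat k2 * of_real a2) powr (- s))))"

text \<open>
  The formula is meant for w in the open right half-plane, where the Dirichlet series is defined.
  The meromorphic continuation to other w is not needed: below, every argument of the double
  gamma function has positive real part.
\<close>

definition barnes_Gamma2 :: "real \<Rightarrow> real \<Rightarrow> complex \<Rightarrow> complex" where
  "barnes_Gamma2 a1 a2 w = exp (deriv (barnes_zeta2 a1 a2 w) 0)"


section \<open>Laws given by their Mellin transforms\<close>

definition mellin_law ::
    "real set \<Rightarrow> complex set \<Rightarrow> (complex \<Rightarrow> complex) \<Rightarrow> real measure \<Rightarrow> bool" where
  "mellin_law A S F \<mu> \<longleftrightarrow>
     prob_space \<mu> \<and> sets \<mu> = sets borel \<and> (AE x in \<mu>. x \<in> A) \<and>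
     (\<forall>q\<in>S. integrable \<mu> (\<lambda>x. complex_of_real x powr q) \<and>
            (LINT x|\<mu>. complex_of_real x powr q) = F q)"

text \<open>
  For positive b1 and b2 the domain is Re q > - b0. Parameters with b1 = b2 \<le> 0 and
  b0 + b1 + b2 > 0 are also used below. The product of gamma factors is invariant under
  (b0, b1, b2) \<mapsto> (b0 + b1 + b2, - b2, - b1), so for negative b1 = b2 it is the Mellin transform
  of the law with these positive parameters; its domain then ends at - (b0 + b1 + b2), where the
  product has a pole. For b1 = b2 = 0 the law is the point mass at 1.
\<close>

definition barnes_beta22 ::
    "real \<Rightarrow> real \<Rightarrow> real \<Rightarrow> real \<Rightarrow> real \<Rightarrow> real measure \<Rightarrow> bool" where
  "barnes_beta22 a1 a2 b0 b1 b2 = 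
     (let G = barnes_Gamma2 a1 a2 in
      mellin_law {0<..1} {q. Re q > - min b0 (b0 + b1 + b2)}
        (\<lambda>q. G (q + of_real b0) / G (of_real b0) *
             (G (of_real (b0 + b1)) / G (q + of_real (b0 + b1))) *
             (G (of_real (b0 + b2)) / G (q + of_real (b0 + b2))) *
             (G (q + of_real (b0 + b1 + b2)) / G (of_real (b0 + b1 + b2)))))"

definition inv_barnes_beta22 ::
    "real \<Rightarrow> real \<Rightarrow> real \<Rightarrow> real \<Rightarrow> real \<Rightarrow> real measure \<Rightarrow> bool" where
  "inv_barnes_beta22 a1 a2 b0 b1 b2 \<nu> \<longleftrightarrow>
     (\<exists>\<mu>. barnes_beta22 a1 a2 b0 b1 b2 \<mu> \<and> \<nu> = distr \<mu> borel (\<lambda>y. 1 / y))"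

definition M_law :: "real \<Rightarrow> real \<Rightarrow> real \<Rightarrow> real \<Rightarrow> real measure \<Rightarrow> bool" where
  "M_law a1 a2 x1 x2 =
     (let G = barnes_Gamma2 a1 a2 in
      mellin_law {0<..} {q. Re q < Min {x1, x2, a1 + a2}}
        (\<lambda>q. G (of_real x1 - q) / G (of_real x1) *
             (G (of_real x2 - q) / G (of_real x2)) *
             (G (of_real (a1 + a2) - q) / G (of_real (a1 + a2))) *
             (G (of_real (x1 + x2) - q) / G (of_real (x1 + x2) - 2 * q))))"


section \<open>Lognormal and infinitely divisible laws\<close>

text \<open>The library's normal density takes the standard deviation, here v is the variance.\<close>

definition lognormal :: "real \<Rightarrow> real \<Rightarrow> real measure" where
  "lognormal m v = distr (density lborel (normal_density m (sqrt v))) borel exp"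

definition infinitely_divisible :: "real measure \<Rightarrow> bool" where
  "infinitely_divisible \<mu> \<longleftrightarrow>
     (\<forall>n::nat. n \<ge> 1 \<longrightarrow>
        (\<exists>\<nu>. prob_space \<nu> \<and> sets \<nu> = sets borel \<and>
             \<mu> = distr (PiM {..<n} (\<lambda>_. \<nu>)) borel (\<lambda>y. \<Sum>i<n. y i)))"

end

theory Submission
  imports Defs
begin

text \<open>
  Write the double zeta function as a Mellin integral of
  $e^{-wt}/((1-e^{-a_1t})(1-e^{-a_2t}))$. In the combination of four logarithms of the double gamma
  function that occurs in a Barnes beta law, normalised at $q = 0$, the integrand vanishes at the
  origin, so the derivative at $s = 0$ is the Levy exponent of a subordinator with density
  $e^{-b_0t}(1-e^{-b_1t})(1-e^{-b_2t})/(t(1-e^{-a_1t})(1-e^{-a_2t}))$. Subordinators are built as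
  infinite sums of compound Poisson variables, which gives the laws and their Mellin transforms.

  The duplication formula $\zeta_2(s,2w) = 2^{-s}\sum_\epsilon \zeta_2(s,w+\epsilon\cdot a/2)$ turns the
  factor with argument $x_1+x_2-2q$ into four factors that combine with the three beta laws. Its
  correction term $\log 2\cdot\zeta_2(0,\cdot)$ is quadratic in $q$ and accounts for the constant and
  for the lognormal factor. The logarithm of $M$ is thus an independent sum of a normal variable
  and a subordinator, hence absolutely continuous and infinitely divisible, and the characteristic
  function of the logarithm identifies the law.
\<close>

text \<open>The double gamma function is a derivative at s = 0 of a continuation, far from the
  half-plane Re s > 2 where the series lives. An expansion valid for Re s > -1 gives both this
  derivative and the value at 0.

  The parameters of the three beta laws come from the duplication formula at w = y - q with y = (x1
  + x2)/2. Up to the shift by -q it produces the points y, y + a1/2, y + a2/2 and y + (a1 + a2)/2.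
  X1 carries x1 and x2 against y twice, X2 carries the four points with signs + - - +, and X3
  carries a1 + a2 and x1 + x2 against y + (a1 + a2)/2 twice. In the sum each of the four points
  keeps the coefficient -1, which is exactly what the denominator at x1 + x2 - 2q requires.

  The half-differences in X1 and X3 may be negative. The laws are therefore built for b1 and b2 of
  equal sign, where the Levy density is still nonnegative; its decay rate is then b0 + min 0 b1 +
  min 0 b2.\<close>

section \<open>Compound Poisson laws and subordinators\<close>

text \<open>The integrand factors through the restriction to \<open>J\<close>, whose image measure
  is the finite product measure, so the finite product formula carries over to infinitely many
  coordinates.\<close>

lemma PiM_prod_integral:
  fixes f :: "'i \<Rightarrow> 'a \<Rightarrow> complex"
  assumes "\<And>i. prob_space (\<nu> i)" "finite J" "\<And>i. i \<in> J \<Longrightarrow> integrable (\<nu> i) (f i)"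
  shows "integrable (PiM UNIV \<nu>) (\<lambda>\<omega>. \<Prod>i\<in>J. f i (\<omega> i))"
    and "(\<integral>\<omega>. (\<Prod>i\<in>J. f i (\<omega> i)) \<partial>PiM UNIV \<nu>) = (\<Prod>i\<in>J. \<integral>x. f i x \<partial>\<nu> i)"
proof -
  interpret prob_space "\<nu> i" for i by (rule assms)
  interpret P: product_prob_space \<nu> UNIV ..
  have D: "PiM J \<nu> = distr (PiM UNIV \<nu>) (PiM J \<nu>) (\<lambda>x. restrict x J)"
    using P.distr_PiM_restrict_finite[of J] assms by simp
  have [measurable]: "(\<lambda>x. restrict x J) \<in> measurable (PiM UNIV \<nu>) (PiM J \<nu>)"
    by (rule measurable_restrict_subset) auto
  have I: "integrable (PiM J \<nu>) (\<lambda>\<omega>. \<Prod>i\<in>J. f i (\<omega> i))"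
    using P.product_integrable_prod[of J f] assms by simp
  have m: "(\<lambda>\<omega>. \<Prod>i\<in>J. f i (\<omega> i)) \<in> borel_measurable (PiM J \<nu>)"
    using I by auto
  show "integrable (PiM UNIV \<nu>) (\<lambda>\<omega>. \<Prod>i\<in>J. f i (\<omega> i))"
    using I by (subst (asm) D, subst (asm) integrable_distr_eq) (use m in auto)
  have "(\<Prod>i\<in>J. \<integral>x. f i x \<partial>\<nu> i) = (\<integral>\<omega>. (\<Prod>i\<in>J. f i (\<omega> i)) \<partial>PiM J \<nu>)"
    using P.product_integral_prod[of J f] assms by simp
  also have "\<dots> = (\<integral>\<omega>. (\<Prod>i\<in>J. f i (\<omega> i)) \<partial>PiM UNIV \<nu>)"
    by (subst D, subst integral_distr) (use m in auto)
  finally show "(\<integral>\<omega>. (\<Prod>i\<in>J. f i (\<omega> i)) \<partial>PiM UNIV \<nu>) = (\<Prod>i\<in>J. \<integral>x. f i x \<partial>\<nu> i)" ..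
qed

lemma integral_poisson_power:
  fixes z :: complex
  assumes "0 < r"
  shows "integrable (measure_pmf (poisson_pmf r)) (\<lambda>n. z ^ n)"
    and "(\<integral>n. z ^ n \<partial>measure_pmf (poisson_pmf r)) = exp (of_real r * (z - 1))"
proof -
  have *: "(\<lambda>n. pmf (poisson_pmf r) n *\<^sub>R z ^ n) = (\<lambda>n. exp (- of_real r) * ((of_real r * z) ^ n /\<^sub>R fact n))"
    using assms by (auto simp: fun_eq_iff pmf_poisson scaleR_conv_of_real power_mult_distrib exp_of_real[symmetric] exp_minus divide_simps)
  have i: "integrable (count_space UNIV) (\<lambda>n. pmf (poisson_pmf r) n *\<^sub>R z ^ n)"
    unfolding integrable_count_space_nat_iff *
    by (simp only: norm_mult) (intro summable_mult summable_norm_exp)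
  show "integrable (measure_pmf (poisson_pmf r)) (\<lambda>n. z ^ n)"
    unfolding measure_pmf_eq_density by (subst integrable_density) (use i in auto)
  have "(\<integral>n. z ^ n \<partial>measure_pmf (poisson_pmf r)) = (\<Sum>n. pmf (poisson_pmf r) n *\<^sub>R z ^ n)"
    unfolding measure_pmf_eq_density by (subst integral_density) (use i in \<open>auto simp: integral_count_space_nat\<close>)
  also have "\<dots> = exp (- of_real r) * exp (of_real r * z)"
    unfolding * by (subst suminf_mult) (auto simp: exp_def intro: summable_exp_generic)
  also have "\<dots> = exp (of_real r * (z - 1))"
    by (simp add: exp_add[symmetric] algebra_simps)
  finally show "(\<integral>n. z ^ n \<partial>measure_pmf (poisson_pmf r)) = exp (of_real r * (z - 1))" .
qed

text \<open>Take a Poisson number of independent jumps with law \<Lambda>/m, where m is the total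
  mass. Given n jumps the exponential moment is \<phi>^n, and the Poisson generating function turns
  this into exp(m(\<phi> - 1)), which is the claimed exponent because m\<phi> is the
  \<Lambda>-integral of the exponential.\<close>

lemma compound_poisson_exists:
  fixes \<Lambda> :: "real measure"
  assumes fin: "finite_measure \<Lambda>" and S: "sets \<Lambda> = sets borel" and nn: "AE t in \<Lambda>. t \<ge> 0"
  shows "\<exists>\<nu>. prob_space \<nu> \<and> sets \<nu> = sets borel \<and> (AE x in \<nu>. x \<ge> 0) \<and>
    (\<forall>q::complex. integrable \<Lambda> (\<lambda>t. exp (q * of_real t)) \<longrightarrow>
       integrable \<nu> (\<lambda>x. exp (q * of_real x)) \<and>
       (\<integral>x. exp (q * of_real x) \<partial>\<nu>) = exp (\<integral>t. (exp (q * of_real t) - 1) \<partial>\<Lambda>))"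
proof -
  interpret L: finite_measure \<Lambda> by (rule fin)
  have sp: "space \<Lambda> = UNIV" using sets_eq_imp_space_eq[OF S] by simp
  define m where "m = measure \<Lambda> UNIV"
  show ?thesis
  proof (cases "m = 0")
    \<comment> \<open>The jump law \<Lambda>/m needs m > 0; for the zero measure the point mass at 0
      serves.\<close>
    case True
    have "emeasure \<Lambda> (space \<Lambda>) = 0"
      using True sp L.emeasure_eq_measure[of UNIV] by (simp add: m_def)
    hence N: "AE t in \<Lambda>. False" by (subst AE_iff_measurable[OF _ refl]) auto
    have 0: "(\<integral>t. (exp (q * of_real t) - 1) \<partial>\<Lambda>) = 0" for q :: complex
      by (rule integral_eq_zero_AE) (use N in auto)
    show ?thesis
      by (rule exI[of _ "return borel 0"])
         (auto simp: 0 prob_space_return AE_return integral_return integrable_iff_bounded nn_integral_return)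
  next
    case False
    hence m: "m > 0" by (simp add: m_def zero_less_measure_iff)
    define \<kappa> where "\<kappa> = density \<Lambda> (\<lambda>_. ennreal (1 / m))"
    have S\<kappa>[measurable_cong, simp]: "sets \<kappa> = sets borel" and [simp]: "space \<kappa> = UNIV"
      by (simp_all add: \<kappa>_def S sp)
    have [measurable_cong]: "sets \<Lambda> = sets borel" by (rule S)
    interpret K: prob_space \<kappa>
    proof
      have "emeasure \<kappa> (space \<kappa>) = ennreal (1/m) * emeasure \<Lambda> UNIV"
        by (simp add: \<kappa>_def emeasure_density S sp nn_integral_cmult)
      also have "\<dots> = 1" using m
        by (simp add: L.emeasure_eq_measure m_def[symmetric] ennreal_mult[symmetric])
      finally show "emeasure \<kappa> (space \<kappa>) = 1" .
    qed
    let ?P = "measure_pmf (poisson_pmf m)" and ?Y = "PiM UNIV (\<lambda>_::nat. \<kappa>)"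
    interpret Y: product_prob_space "\<lambda>_::nat. \<kappa>" UNIV ..
    interpret Z: pair_prob_space ?P ?Y ..
    define X where "X = (\<lambda>z::nat \<times> (nat \<Rightarrow> real). \<Sum>i<fst z. snd z i)"
    have X[measurable]: "X \<in> borel_measurable (?P \<Otimes>\<^sub>M ?Y)"
    proof -
      have "X \<in> borel_measurable (count_space UNIV \<Otimes>\<^sub>M ?Y)"
        by (rule measurable_pair_measure_countable1) (auto simp: X_def)
      thus ?thesis by (simp cong: measurable_cong_sets sets_pair_measure_cong)
    qed
    define \<nu> where "\<nu> = distr (?P \<Otimes>\<^sub>M ?Y) borel X"
    have main: "integrable \<nu> (\<lambda>x. exp (q * of_real x)) \<and>
       (\<integral>x. exp (q * of_real x) \<partial>\<nu>) = exp (\<integral>t. (exp (q * of_real t) - 1) \<partial>\<Lambda>)"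
      if q: "integrable \<Lambda> (\<lambda>t. exp (q * of_real t))" for q :: complex
    proof -
      let ?f = "\<lambda>t::real. exp (q * of_real t)"
      have fm[measurable]: "?f \<in> borel_measurable borel" by measurable
      have i\<kappa>: "integrable \<kappa> ?f" unfolding \<kappa>_def by (subst integrable_density) (use q m in auto)
      have ifn: "integrable \<kappa> (\<lambda>t. complex_of_real (norm (?f t)))"
        using integrable_norm[OF i\<kappa>] by (rule integrable_of_real)
      define \<phi> where "\<phi> = (\<integral>t. ?f t \<partial>\<kappa>)"
      define \<psi> where "\<psi> = (\<integral>t. norm (?f t) \<partial>\<kappa>)"
      have e: "exp (q * of_real (X (n, y))) = (\<Prod>i<n. ?f (y i))" for n y
        by (simp add: X_def sum_distrib_left exp_sum)
      have I1: "integrable ?Y (\<lambda>y. exp (q * of_real (X (n, y))))"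
        and E1: "(\<integral>y. exp (q * of_real (X (n, y))) \<partial>?Y) = \<phi> ^ n" for n
        using PiM_prod_integral[of "\<lambda>_. \<kappa>" "{..<n}" "\<lambda>_. ?f"] i\<kappa> K.prob_space_axioms
        by (simp_all add: e \<phi>_def)
      \<comment> \<open>The product formula for the norms: the absolute moments \<psi>^n are again
        integrable against the Poisson weights, which is what Fubini asks for.\<close>
      have "complex_of_real (\<integral>y. norm (exp (q * of_real (X (n, y)))) \<partial>?Y) = of_real (\<psi> ^ n)" for n
        using PiM_prod_integral(2)[of "\<lambda>_. \<kappa>" "{..<n}" "\<lambda>_ t. of_real (norm (?f t))"] ifn K.prob_space_axioms
        by (simp add: \<psi>_def e prod_norm[symmetric] integral_complex_of_real[symmetric]
              del: norm_exp_eq_Re integral_complex_of_real)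
      hence E2: "(\<integral>y. norm (exp (q * of_real (X (n, y)))) \<partial>?Y) = \<psi> ^ n" for n
        using of_real_eq_iff by blast
      have "integrable ?P (\<lambda>n. complex_of_real \<psi> ^ n)" by (rule integral_poisson_power[OF m])
      hence "integrable ?P (\<lambda>n. Re (complex_of_real \<psi> ^ n))" by (rule integrable_Re)
      hence P\<psi>: "integrable ?P (\<lambda>n. \<psi> ^ n)" by (simp flip: of_real_power)
      have I2: "integrable (?P \<Otimes>\<^sub>M ?Y) (\<lambda>z. exp (q * of_real (X z)))"
        by (rule Z.Fubini_integrable) (use I1 in \<open>simp_all add: E2 P\<psi> del: norm_exp_eq_Re\<close>)
      have "(\<integral>x. ?f x \<partial>\<nu>) = (\<integral>z. exp (q * of_real (X z)) \<partial>(?P \<Otimes>\<^sub>M ?Y))"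
        unfolding \<nu>_def by (subst integral_distr) auto
      also have "\<dots> = (\<integral>n. (\<integral>y. exp (q * of_real (X (n, y))) \<partial>?Y) \<partial>?P)"
        using Z.integral_fst'[OF I2] by simp
      also have "\<dots> = exp (of_real m * (\<phi> - 1))"
        by (simp add: E1 integral_poisson_power[OF m])
      also have "of_real m * (\<phi> - 1) = (\<integral>t. (?f t - 1) \<partial>\<Lambda>)"
      proof -
        have "\<phi> = (\<integral>t. ?f t \<partial>\<Lambda>) / of_real m"
          using m by (simp add: \<phi>_def \<kappa>_def integral_density scaleR_conv_of_real divide_simps)
        moreover have "(\<integral>t. (?f t - 1) \<partial>\<Lambda>) = (\<integral>t. ?f t \<partial>\<Lambda>) - of_real m"
          by (subst Bochner_Integration.integral_diff) (use q sp in \<open>auto simp: m_def scaleR_conv_of_real\<close>)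
        ultimately show ?thesis using m by (simp add: field_simps)
      qed
      finally show ?thesis using I2 unfolding \<nu>_def by (simp add: integrable_distr_eq)
    qed
    have nn2: "AE t in \<kappa>. t \<ge> 0" unfolding \<kappa>_def by (subst AE_density) (use nn in auto)
    have "AE y in ?Y. \<forall>i. y i \<ge> 0"
      unfolding AE_all_countable using nn2 by (intro allI AE_PiM_component) (auto intro: K.prob_space_axioms)
    hence "AE y in ?Y. X (n, y) \<ge> 0" for n
      by eventually_elim (auto simp: X_def intro!: sum_nonneg)
    hence "AE z in ?P \<Otimes>\<^sub>M ?Y. X z \<ge> 0"
      by (intro Z.AE_pair_measure) auto
    hence "AE x in \<nu>. x \<ge> 0" unfolding \<nu>_def by (subst AE_distr_iff) auto
    moreover have "prob_space \<nu>" unfolding \<nu>_def by (rule Z.prob_space_distr) measurable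
    ultimately show ?thesis using main by (intro exI[of _ \<nu>]) (auto simp: \<nu>_def)
  qed
qed

text \<open>\<Lambda> may have infinite mass near 0, so a single compound Poisson variable does not
  suffice. The summands are nonnegative, hence bounded exponential moments of the partial sums
  already force almost sure convergence.\<close>

lemma subordinator_exists:
  fixes \<Lambda> :: "real measure" and B :: real
  assumes S: "sets \<Lambda> = sets borel" and pos: "AE t in \<Lambda>. t > 0" and B: "B > 0"
    and int: "\<And>q::complex. Re q < B \<Longrightarrow> integrable \<Lambda> (\<lambda>t. exp (q * of_real t) - 1)"
  shows "\<exists>\<nu>. prob_space \<nu> \<and> sets \<nu> = sets borel \<and> (AE x in \<nu>. x \<ge> 0) \<and>
    (\<forall>q::complex. Re q < B \<longrightarrow>
       integrable \<nu> (\<lambda>x. exp (q * of_real x)) \<and>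
       (\<integral>x. exp (q * of_real x) \<partial>\<nu>) = exp (\<integral>t. (exp (q * of_real t) - 1) \<partial>\<Lambda>))"
proof -
  have [measurable_cong]: "sets \<Lambda> = sets borel" by (rule S)
  have sp[simp]: "space \<Lambda> = UNIV" using sets_eq_imp_space_eq[OF S] by simp
  \<comment> \<open>Sorting the jumps by the integer part of 1/t gives each class finite total intensity.\<close>
  define A where "A n = {t::real. 0 < t \<and> nat \<lfloor>1 / t\<rfloor> = n}" for n
  have A[measurable]: "A n \<in> sets borel" for n unfolding A_def by measurable
  define \<Lambda>' where "\<Lambda>' n = density \<Lambda> (indicator (A n))" for n
  define g where "g q t = exp (q * complex_of_real t) - 1" for q t
  have g[measurable]: "g q \<in> borel_measurable borel" for q unfolding g_def by measurable
  define c where "c n q = (\<integral>t. indicator (A n) t *\<^sub>R g q t \<partial>\<Lambda>)" for n q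
  have ig: "integrable \<Lambda> (g q)" if "Re q < B" for q
    using int[OF that] unfolding g_def .
  \<comment> \<open>On \<open>A n\<close> one has 1 \<le> (n + 1)t, and t is at most a multiple of
    exp(Bt/2) - 1. The hypothesis at q = B/2 therefore bounds the mass of the slice.\<close>
  have iA: "integrable \<Lambda> (indicator (A n) :: real \<Rightarrow> real)" for n
  proof (rule Bochner_Integration.integrable_bound)
    show "integrable \<Lambda> (\<lambda>t. real (n + 1) / (B / 2) * norm (g (of_real (B / 2)) t))"
      using B by (intro integrable_mult_right integrable_norm ig) auto
    have "indicat_real (A n) t \<le> real (n + 1) / (B / 2) * norm (g (of_real (B / 2)) t)" for t
    proof (cases "t \<in> A n")
      case True
      hence t: "t > 0" and "nat \<lfloor>1 / t\<rfloor> = n" by (auto simp: A_def)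
      hence "1 / t < real n + 1" by linarith
      hence "1 \<le> real (n + 1) * t" using t by (simp add: divide_simps algebra_simps)
      also have "\<dots> = real (n + 1) / (B / 2) * (B / 2 * t)" using B by simp
      also have "\<dots> \<le> real (n + 1) / (B / 2) * norm (g (of_real (B / 2)) t)"
      proof (rule mult_left_mono)
        have "B / 2 * t \<le> exp (B / 2 * t) - 1" using exp_ge_add_one_self[of "B / 2 * t"] by linarith
        also have "g (of_real (B / 2)) t = of_real (exp (B / 2 * t) - 1)"
          unfolding g_def by (simp only: of_real_mult[symmetric] exp_of_real of_real_diff of_real_1)
        hence "exp (B / 2 * t) - 1 \<le> norm (g (of_real (B / 2)) t)" by (simp only: norm_of_real)
        finally show "B / 2 * t \<le> norm (g (of_real (B / 2)) t)" .
      qed (use B in simp)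
      finally show ?thesis using True by simp
    qed (use B in simp)
    thus "AE t in \<Lambda>. norm (indicat_real (A n) t) \<le> norm (real (n + 1) / (B / 2) * norm (g (of_real (B / 2)) t))"
      using B by (intro AE_I2) (simp add: abs_mult)
  qed measurable
  have "\<exists>\<nu>. prob_space \<nu> \<and> sets \<nu> = sets borel \<and> (AE x in \<nu>. x \<ge> 0) \<and>
    (\<forall>q::complex. Re q < B \<longrightarrow>
       integrable \<nu> (\<lambda>x. exp (q * of_real x)) \<and> (\<integral>x. exp (q * of_real x) \<partial>\<nu>) = exp (c n q))" for n
  proof -
    have "emeasure (\<Lambda>' n) UNIV = emeasure \<Lambda> (A n)"
      unfolding \<Lambda>'_def by (subst emeasure_density) auto
    also have "\<dots> < \<infinity>" using iA[of n] by (subst (asm) integrable_indicator_iff) simp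
    finally have fin: "finite_measure (\<Lambda>' n)"
      by (intro finite_measureI) (simp add: \<Lambda>'_def)
    have S': "sets (\<Lambda>' n) = sets borel" by (simp add: \<Lambda>'_def S)
    have "AE t in \<Lambda>. t \<in> A n \<longrightarrow> t \<ge> 0" by (simp add: A_def)
    hence nn: "AE t in \<Lambda>' n. t \<ge> 0" unfolding \<Lambda>'_def
      by (subst AE_density) (auto elim!: eventually_mono split: split_indicator_asm)
    have i: "integrable (\<Lambda>' n) (\<lambda>t. exp (q * of_real t))" if q: "Re q < B" for q
    proof -
      have "integrable \<Lambda> (\<lambda>t. indicator (A n) t *\<^sub>R g q t + of_real (indicator (A n) t))"
        using ig[OF q] iA[of n] by (intro Bochner_Integration.integrable_add integrable_mult_indicator integrable_of_real) auto
      also have "(\<lambda>t. indicator (A n) t *\<^sub>R g q t + of_real (indicator (A n) t)) =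
          (\<lambda>t. indicat_real (A n) t *\<^sub>R exp (q * of_real t))"
        by (auto simp: fun_eq_iff g_def split: split_indicator)
      finally show ?thesis unfolding \<Lambda>'_def ennreal_indicator[symmetric]
        by (subst integrable_density) auto
    qed
    have "(\<integral>t. (exp (q * of_real t) - 1) \<partial>\<Lambda>' n) = c n q" for q
      unfolding \<Lambda>'_def c_def ennreal_indicator[symmetric] by (subst integral_density) (auto simp: g_def)
    with compound_poisson_exists[OF fin S' nn] i show ?thesis by metis
  qed
  then obtain \<nu> where \<nu>: "\<And>n. prob_space (\<nu> n)" and S\<nu>[measurable_cong]: "\<And>n. sets (\<nu> n) = sets borel"
    and nn: "\<And>n. AE x in \<nu> n. x \<ge> 0"
    and i\<nu>: "\<And>n q. Re q < B \<Longrightarrow> integrable (\<nu> n) (\<lambda>x. exp (q * complex_of_real x))"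
    and e\<nu>: "\<And>n q. Re q < B \<Longrightarrow> (\<integral>x. exp (q * complex_of_real x) \<partial>\<nu> n) = exp (c n q)"
    by metis
  interpret prob_space "\<nu> i" for i by (rule \<nu>)
  interpret P: product_prob_space \<nu> UNIV ..
  let ?\<Omega> = "PiM UNIV \<nu>"
  define T where "T n \<omega> = (\<Sum>i<n. \<omega> i)" for n and \<omega> :: "nat \<Rightarrow> real"
  define X where "X \<omega> = (\<Sum>i. \<omega> i)" for \<omega> :: "nat \<Rightarrow> real"
  have [measurable]: "T n \<in> borel_measurable ?\<Omega>" for n unfolding T_def by measurable
  have X[measurable]: "X \<in> borel_measurable ?\<Omega>" unfolding X_def by measurable
  \<comment> \<open>The slices partition the half-line: at each t > 0 the partial sums of indicators
    are eventually 1, and \<open>norm (g q t)\<close> dominates.\<close>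
  have lim: "(\<lambda>n. \<Sum>i<n. c i q) \<longlonglongrightarrow> (\<integral>t. g q t \<partial>\<Lambda>)" if q: "Re q < B" for q
  proof -
    have ind: "(\<Sum>i<n. indicat_real (A i) t) = (if nat \<lfloor>1 / t\<rfloor> < n then 1 else 0)" if "t > 0" for t n
      using that by (simp add: A_def indicator_def sum.delta)
    have "(\<lambda>n. \<integral>t. (\<Sum>i<n. indicat_real (A i) t) *\<^sub>R g q t \<partial>\<Lambda>) \<longlonglongrightarrow> (\<integral>t. g q t \<partial>\<Lambda>)"
    proof (rule integral_dominated_convergence[where w = "\<lambda>t. norm (g q t)"])
      show "AE t in \<Lambda>. (\<lambda>n. (\<Sum>i<n. indicat_real (A i) t) *\<^sub>R g q t) \<longlonglongrightarrow> g q t"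
        using pos
      proof eventually_elim
        case (elim t)
        have "\<forall>\<^sub>F n in sequentially. (\<Sum>i<n. indicat_real (A i) t) *\<^sub>R g q t = g q t"
          using eventually_gt_at_top[of "nat \<lfloor>1 / t\<rfloor>"] by eventually_elim (simp add: ind elim)
        thus ?case by (rule tendsto_eventually)
      qed
      show "AE t in \<Lambda>. norm ((\<Sum>i<n. indicat_real (A i) t) *\<^sub>R g q t) \<le> norm (g q t)" for n
        using pos by eventually_elim (auto simp: ind)
      show "integrable \<Lambda> (\<lambda>t. norm (g q t))" using ig[OF q] by (rule integrable_norm)
    qed measurable
    also have "(\<lambda>n. \<integral>t. (\<Sum>i<n. indicat_real (A i) t) *\<^sub>R g q t \<partial>\<Lambda>) = (\<lambda>n. \<Sum>i<n. c i q)"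
      unfolding c_def scaleR_sum_left
      by (intro ext Bochner_Integration.integral_sum integrable_mult_indicator ig[OF q]) auto
    finally show ?thesis .
  qed
  have eT: "exp (q * of_real (T n \<omega>)) = (\<Prod>i<n. exp (q * of_real (\<omega> i)))" for q :: complex and n \<omega>
    by (simp add: T_def sum_distrib_left exp_sum)
  have iT: "integrable ?\<Omega> (\<lambda>\<omega>. exp (q * of_real (T n \<omega>)))"
    and ET: "(\<integral>\<omega>. exp (q * of_real (T n \<omega>)) \<partial>?\<Omega>) = exp (\<Sum>i<n. c i q)" if "Re q < B" for q n
    using PiM_prod_integral[of \<nu> "{..<n}" "\<lambda>_ x. exp (q * of_real x)"] \<nu> i\<nu>[OF that]
    by (simp_all add: eT e\<nu>[OF that] exp_sum)
  have nn': "AE \<omega> in ?\<Omega>. \<forall>i. \<omega> i \<ge> 0"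
    unfolding AE_all_countable using nn \<nu> by (intro allI AE_PiM_component) auto
  have iTr: "integrable ?\<Omega> (\<lambda>\<omega>. exp (b * T n \<omega>))"
    and limT: "(\<lambda>n. \<integral>\<omega>. exp (b * T n \<omega>) \<partial>?\<Omega>) \<longlonglongrightarrow> Re (exp (\<integral>t. g (of_real b) t \<partial>\<Lambda>))"
    if b: "b < B" for b n
  proof -
    have Re: "exp (b * T n \<omega>) = Re (exp (of_real b * of_real (T n \<omega>)))" for n \<omega>
      by (simp add: Re_exp)
    show "integrable ?\<Omega> (\<lambda>\<omega>. exp (b * T n \<omega>))"
      unfolding Re using b by (intro integrable_Re iT) auto
    have "(\<integral>\<omega>. exp (b * T n \<omega>) \<partial>?\<Omega>) = Re (exp (\<Sum>i<n. c i b))" for n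
      unfolding Re using b by (subst integral_Re) (auto intro!: iT simp: ET)
    thus "(\<lambda>n. \<integral>\<omega>. exp (b * T n \<omega>) \<partial>?\<Omega>) \<longlonglongrightarrow> Re (exp (\<integral>t. g (of_real b) t \<partial>\<Lambda>))"
      using b by (auto intro!: tendsto_intros lim)
  qed
  \<comment> \<open>The partial sums increase, so by monotone convergence the supremum of exp(b T)
    has the limit of the expectations as its mean. This is finite, so the supremum is finite almost
    everywhere.\<close>
  have conv: "AE \<omega> in ?\<Omega>. summable \<omega>"
  proof -
    define b where "b = B / 2"
    have b: "b > 0" "b < B" using B by (auto simp: b_def)
    let ?u = "\<lambda>n \<omega>. ennreal (exp (b * T n \<omega>))"
    have "(\<integral>\<^sup>+\<omega>. (SUP n. ?u n \<omega>) \<partial>?\<Omega>) = (SUP n. \<integral>\<^sup>+\<omega>. ?u n \<omega> \<partial>?\<Omega>)"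
    proof (rule nn_integral_monotone_convergence_SUP_AE)
      show "AE \<omega> in ?\<Omega>. ?u n \<omega> \<le> ?u (Suc n) \<omega>" for n
        using nn' by eventually_elim (use b in \<open>auto simp: T_def ennreal_leI mult_left_mono\<close>)
    qed measurable
    also have "\<dots> < \<infinity>"
    proof -
      obtain K where K: "\<And>n. norm (\<integral>\<omega>. exp (b * T n \<omega>) \<partial>?\<Omega>) \<le> K"
        using Bseq_def convergentI[OF limT[OF b(2)], THEN convergent_imp_Bseq] by (metis)
      have "(\<integral>\<^sup>+\<omega>. ?u n \<omega> \<partial>?\<Omega>) \<le> ennreal K" for n
        using K[of n] by (subst nn_integral_eq_integral) (auto intro!: iTr b ennreal_leI)
      hence "(SUP n. \<integral>\<^sup>+\<omega>. ?u n \<omega> \<partial>?\<Omega>) \<le> ennreal K" by (rule SUP_least)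
      thus ?thesis using le_less_trans by force
    qed
    finally have "AE \<omega> in ?\<Omega>. (SUP n. ?u n \<omega>) \<noteq> \<infinity>"
      by (intro nn_integral_PInf_AE) auto
    thus ?thesis using nn'
    proof eventually_elim
      case (elim \<omega>)
      then obtain r where r: "r \<ge> 0" "(SUP n. ?u n \<omega>) = ennreal r" by (cases "SUP n. ?u n \<omega>") auto
      have "exp (b * T n \<omega>) \<le> r" for n
      proof -
        have "?u n \<omega> \<le> (SUP n. ?u n \<omega>)" by (rule SUP_upper) simp
        thus ?thesis using r by (simp add: ennreal_le_iff)
      qed
      moreover have "1 + b * T n \<omega> \<le> exp (b * T n \<omega>)" for n by (rule exp_ge_add_one_self)
      ultimately have "b * T n \<omega> \<le> r" for n by (smt (verit))
      hence "T n \<omega> \<le> r / b" for n using b by (simp add: field_simps)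
      thus "summable \<omega>" using elim by (intro bounded_imp_summable[where B = "r / b"]) (auto simp: T_def lessThan_Suc_atMost[symmetric] simp del: sum.lessThan_Suc)
    qed
  qed
  have AEX: "AE \<omega> in ?\<Omega>. (\<forall>i. \<omega> i \<ge> 0) \<and> (\<lambda>n. T n \<omega>) \<longlonglongrightarrow> X \<omega> \<and> (\<forall>n. T n \<omega> \<le> X \<omega>) \<and> X \<omega> \<ge> 0"
    using conv nn'
    by eventually_elim (auto simp: T_def X_def summable_LIMSEQ sum_le_suminf suminf_nonneg)
  have iX: "integrable ?\<Omega> (\<lambda>\<omega>. exp (b * X \<omega>))" if b: "0 \<le> b" "b < B" for b
  proof (rule integrable_monotone_convergence[OF iTr[OF b(2)] _ _ limT[OF b(2)]])
    show "AE \<omega> in ?\<Omega>. mono (\<lambda>n. exp (b * T n \<omega>))"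
      using AEX by eventually_elim (use b in \<open>auto simp: T_def intro!: incseq_SucI mult_left_mono\<close>)
    show "AE \<omega> in ?\<Omega>. (\<lambda>n. exp (b * T n \<omega>)) \<longlonglongrightarrow> exp (b * X \<omega>)"
      using AEX by eventually_elim (auto intro!: tendsto_intros)
  qed measurable
  have main: "integrable ?\<Omega> (\<lambda>\<omega>. exp (q * of_real (X \<omega>))) \<and>
      (\<integral>\<omega>. exp (q * of_real (X \<omega>)) \<partial>?\<Omega>) = exp (\<integral>t. g q t \<partial>\<Lambda>)" if q: "Re q < B" for q
  proof -
    \<comment> \<open>Truncation at 0 covers Re q < 0, where the exponentials of the partial sums
      are bounded by 1; \<open>iX\<close> supplies the majorant for nonnegative exponents.\<close>
    define b where "b = max 0 (Re q)"
    have b: "0 \<le> b" "b < B" "Re q \<le> b" using q B by (auto simp: b_def)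
    have bd: "AE \<omega> in ?\<Omega>. norm (exp (q * of_real (T n \<omega>))) \<le> exp (b * X \<omega>)" for n
      using AEX
    proof eventually_elim
      case (elim \<omega>)
      hence "T n \<omega> \<ge> 0" by (auto simp: T_def intro: sum_nonneg)
      hence "Re q * T n \<omega> \<le> b * X \<omega>" using b elim by (intro mult_mono) auto
      thus ?case by simp
    qed
    have li: "AE \<omega> in ?\<Omega>. (\<lambda>n. exp (q * of_real (T n \<omega>))) \<longlonglongrightarrow> exp (q * of_real (X \<omega>))"
      using AEX by eventually_elim (auto intro!: tendsto_intros)
    have 1: "integrable ?\<Omega> (\<lambda>\<omega>. exp (q * of_real (X \<omega>)))"
      by (rule integrable_dominated_convergence[OF _ _ iX[OF b(1,2)] li bd]) measurable
    have "(\<lambda>n. \<integral>\<omega>. exp (q * of_real (T n \<omega>)) \<partial>?\<Omega>) \<longlonglongrightarrow> (\<integral>\<omega>. exp (q * of_real (X \<omega>)) \<partial>?\<Omega>)"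
      by (rule integral_dominated_convergence[OF _ _ iX[OF b(1,2)] li bd]) measurable
    moreover have "(\<lambda>n. \<integral>\<omega>. exp (q * of_real (T n \<omega>)) \<partial>?\<Omega>) \<longlonglongrightarrow> exp (\<integral>t. g q t \<partial>\<Lambda>)"
      unfolding ET[OF q] by (intro tendsto_intros lim q)
    ultimately show ?thesis using 1 LIMSEQ_unique by blast
  qed
  show ?thesis
  proof (intro exI[of _ "distr ?\<Omega> borel X"] conjI allI impI)
    show "prob_space (distr ?\<Omega> borel X)" by (rule P.prob_space_distr) measurable
    show "AE x in distr ?\<Omega> borel X. x \<ge> 0"
      using AEX by (subst AE_distr_iff) (auto elim: eventually_mono)
  next
    fix q :: complex assume q: "Re q < B"
    show "integrable (distr ?\<Omega> borel X) (\<lambda>x. exp (q * of_real x))"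
      using main[OF q] by (simp add: integrable_distr_eq)
    show "(\<integral>x. exp (q * of_real x) \<partial>distr ?\<Omega> borel X) = exp (\<integral>t. (exp (q * of_real t) - 1) \<partial>\<Lambda>)"
      using main[OF q] by (simp add: integral_distr g_def)
  qed simp
qed

section \<open>Normal factors, convolution and infinite divisibility\<close>

text \<open>With p = u + iv, completing the square absorbs u into a translation of the density and
  the factor exp(u^2/2). What is left is the characteristic function of the standard normal law at
  v.\<close>

lemma
  fixes p :: complex
  shows integrable_std_normal_exp:
      "integrable lborel (\<lambda>y. exp (p * of_real y) * of_real (std_normal_density y))"
    and integral_std_normal_exp:
      "(\<integral>y. exp (p * of_real y) * of_real (std_normal_density y) \<partial>lborel) = exp (p\<^sup>2 / 2)"
proof -
  define u v where "u = Re p" and "v = Im p"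
  have p: "p = of_real u + \<i> * of_real v" by (simp add: u_def v_def complex_eq)
  have sq: "- y\<^sup>2 / 2 + u * y = u\<^sup>2 / 2 - (y - u)\<^sup>2 / 2" for y
    by (simp add: power2_eq_square field_simps)
  have *: "exp (u * y) * std_normal_density y = exp (u\<^sup>2 / 2) * std_normal_density (y - u)" for y
    by (simp add: std_normal_density_def exp_add[symmetric] sq[of y, symmetric] algebra_simps flip: exp_diff)
  have **: "exp (p * of_real y) * of_real (std_normal_density y) =
      exp (\<i> * of_real (v * y)) * of_real (exp (u\<^sup>2 / 2) * std_normal_density (y - u))" for y
    unfolding *[symmetric] by (simp add: p algebra_simps exp_add exp_of_real[symmetric])
  have i0: "integrable lborel (\<lambda>y. exp (\<i> * of_real (v * y)) * of_real (std_normal_density y))"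
    by (rule Bochner_Integration.integrable_bound[OF integrable_normal_density[of 1 0]])
       (auto simp: norm_mult simp del: of_real_mult)
  have s: "exp (\<i> * of_real (v * (u + 1 * y))) * complex_of_real (exp (u\<^sup>2 / 2) * std_normal_density ((u + 1 * y) - u))
      = exp (\<i> * of_real (v * u) + of_real (u\<^sup>2 / 2)) * (exp (\<i> * of_real (v * y)) * of_real (std_normal_density y))" for y
    by (simp add: exp_add algebra_simps exp_of_real[symmetric])
  show "integrable lborel (\<lambda>y. exp (p * of_real y) * of_real (std_normal_density y))"
    unfolding ** by (subst lborel_integrable_real_affine_iff[of 1 _ u, symmetric]) (simp, unfold s, intro integrable_mult_right i0)
  have c: "(\<integral>y. exp (\<i> * of_real (v * y)) * of_real (std_normal_density y) \<partial>lborel) = exp (- (of_real v)\<^sup>2 / 2)"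
    using char_std_normal_distribution[THEN fun_cong, of v] unfolding char_def
    by (subst (asm) integral_density) (auto simp: scaleR_conv_of_real mult.commute exp_of_real[symmetric])
  have "(\<integral>y. exp (p * of_real y) * of_real (std_normal_density y) \<partial>lborel) =
      exp (\<i> * of_real (v * u) + of_real (u\<^sup>2 / 2)) * exp (- (of_real v)\<^sup>2 / 2)"
    unfolding ** by (subst lborel_integral_real_affine[of 1 _ u]) (simp, unfold s, simp only: integral_mult_right_zero c, simp)
  also have "\<dots> = exp (p\<^sup>2 / 2)"
    unfolding exp_add[symmetric] p
    by (rule arg_cong[of _ _ exp]) (simp add: complex_eq_iff power2_eq_square field_simps)
  finally show "(\<integral>y. exp (p * of_real y) * of_real (std_normal_density y) \<partial>lborel) = exp (p\<^sup>2 / 2)" .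
qed

lemma normal_exp_integral:
  fixes q :: complex
  assumes \<sigma>: "\<sigma> > 0"
  shows "integrable (density lborel (normal_density m \<sigma>)) (\<lambda>x. exp (q * of_real x))"
    and "(\<integral>x. exp (q * of_real x) \<partial>density lborel (normal_density m \<sigma>)) =
           exp (q * of_real m + of_real (\<sigma>\<^sup>2) * q\<^sup>2 / 2)"
proof -
  have n: "normal_density m \<sigma> (m + \<sigma> * y) = std_normal_density y / \<sigma>" for y
    using \<sigma> by (simp add: normal_density_def real_sqrt_mult power_mult_distrib)
  have s: "normal_density m \<sigma> (m + \<sigma> * y) *\<^sub>R exp (q * of_real (m + \<sigma> * y)) =
      exp (q * of_real m) / of_real \<sigma> * (exp (q * of_real \<sigma> * of_real y) * of_real (std_normal_density y))" for y
    using \<sigma> by (simp add: n scaleR_conv_of_real exp_add algebra_simps)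
  show "integrable (density lborel (normal_density m \<sigma>)) (\<lambda>x. exp (q * of_real x))"
    by (subst integrable_density, simp, simp, simp, subst lborel_integrable_real_affine_iff[of \<sigma> _ m, symmetric])
       (use \<sigma> in simp, unfold s, intro integrable_mult_right integrable_std_normal_exp)
  show "(\<integral>x. exp (q * of_real x) \<partial>density lborel (normal_density m \<sigma>)) =
           exp (q * of_real m + of_real (\<sigma>\<^sup>2) * q\<^sup>2 / 2)"
    by (subst integral_density, simp, simp, simp, subst lborel_integral_real_affine[of \<sigma> _ m])
       (use \<sigma> in simp, unfold s, unfold integral_mult_right_zero integral_std_normal_exp, use \<sigma> in
         \<open>simp add: exp_add scaleR_conv_of_real power_mult_distrib mult.commute\<close>)
qed

lemma convolution_exp_integral:
  fixes q :: complex
  assumes "prob_space M" "prob_space N" and [measurable_cong]: "sets M = sets borel" "sets N = sets borel"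
    and I: "integrable M (\<lambda>x. exp (q * of_real x))" "integrable N (\<lambda>x. exp (q * of_real x))"
  shows "integrable (convolution M N) (\<lambda>x. exp (q * of_real x))"
    and "(\<integral>x. exp (q * of_real x) \<partial>convolution M N) =
      (\<integral>x. exp (q * of_real x) \<partial>M) * (\<integral>x. exp (q * of_real x) \<partial>N)"
proof -
  interpret M: prob_space M by fact
  interpret N: prob_space N by fact
  interpret P: pair_prob_space M N ..
  have i: "integrable (M \<Otimes>\<^sub>M N) (\<lambda>z. exp (q * of_real (fst z)) * exp (q * of_real (snd z)))"
    by (rule P.Fubini_integrable) (use I in \<open>auto simp: norm_mult integrable_norm simp del: norm_exp_eq_Re\<close>)
  show "integrable (convolution M N) (\<lambda>x. exp (q * of_real x))"
    using i unfolding convolution_def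
    by (subst integrable_distr_eq) (auto simp: split_beta algebra_simps exp_add)
  show "(\<integral>x. exp (q * of_real x) \<partial>convolution M N) =
      (\<integral>x. exp (q * of_real x) \<partial>M) * (\<integral>x. exp (q * of_real x) \<partial>N)"
    unfolding convolution_def using P.integral_fst'[OF i]
    by (subst integral_distr) (auto simp: split_beta algebra_simps exp_add)
qed

text \<open>Lebesgue null sets are translation invariant, so for each value of the other summand the
  translated set has measure zero under \<open>N\<close>.\<close>

lemma absolutely_continuous_convolution_density:
  fixes f :: "real \<Rightarrow> ennreal"
  assumes N: "N = density lborel f" and [measurable]: "f \<in> borel_measurable borel"
    and fin: "finite_measure M" "finite_measure N" and S: "sets M = sets borel"
  shows "absolutely_continuous lborel (convolution M N)"
  unfolding absolutely_continuous_def
proof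
  fix A :: "real set" assume "A \<in> null_sets lborel"
  hence A[measurable]: "A \<in> sets borel" and A0: "emeasure lborel A = 0" by auto
  have "emeasure N {a. a + x \<in> A} = 0" for x
  proof -
    have "emeasure lborel {a. a + x \<in> A} = emeasure (distr lborel borel ((+) x)) A"
      by (subst emeasure_distr) (auto simp: vimage_def add.commute)
    also have "\<dots> = 0" by (simp add: lborel_distr_plus A0)
    finally have "{a. a + x \<in> A} \<in> null_sets lborel" by (auto intro!: null_setsI)
    hence "{a. a + x \<in> A} \<in> null_sets N"
      unfolding N using absolutely_continuousI_density[of f lborel] by (auto simp: absolutely_continuous_def)
    thus ?thesis by auto
  qed
  hence "emeasure (convolution M N) A = 0"
    using S sets_eq_imp_space_eq[OF S] by (subst convolution_emeasure) (use fin in \<open>auto simp: N\<close>)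
  thus "A \<in> null_sets (convolution M N)" by (auto intro!: null_setsI)
qed

text \<open>Levy uniqueness, phrased with exponential integrals so that Mellin formulas at the
  imaginary argument q = i\<theta> apply without rewriting.\<close>

lemma real_law_eqI:
  fixes M N :: "real measure"
  assumes "prob_space M" "prob_space N" "sets M = sets borel" "sets N = sets borel"
    and eq: "\<And>\<theta>::real. (\<integral>x. exp (\<i> * of_real \<theta> * of_real x) \<partial>M) = (\<integral>x. exp (\<i> * of_real \<theta> * of_real x) \<partial>N)"
  shows "M = N"
proof (rule Levy_uniqueness)
  show "real_distribution M" "real_distribution N"
    using assms by (auto simp: real_distribution_def real_distribution_axioms_def)
  show "char M = char N"
    using eq by (auto simp: char_def fun_eq_iff mult.assoc)
qed

text \<open>The law is a convolution of a subordinator with a normal law. Absolute continuity comes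
  from the Gaussian part alone, which is nondegenerate because v > 0.\<close>

lemma levy_khintchine_exists:
  fixes \<Lambda> :: "real measure" and B v m :: real
  assumes S: "sets \<Lambda> = sets borel" and pos: "AE t in \<Lambda>. t > 0" and B: "B > 0" and v: "v > 0"
    and int: "\<And>q::complex. Re q < B \<Longrightarrow> integrable \<Lambda> (\<lambda>t. exp (q * of_real t) - 1)"
  shows "\<exists>\<mu>. prob_space \<mu> \<and> sets \<mu> = sets borel \<and> absolutely_continuous lborel \<mu> \<and>
    (\<forall>q::complex. Re q < B \<longrightarrow>
       integrable \<mu> (\<lambda>x. exp (q * of_real x)) \<and>
       (\<integral>x. exp (q * of_real x) \<partial>\<mu>) =
         exp (q * of_real m + of_real v * q\<^sup>2 / 2 + (\<integral>t. (exp (q * of_real t) - 1) \<partial>\<Lambda>)))"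
proof -
  obtain \<nu> where \<nu>: "prob_space \<nu>" "sets \<nu> = sets borel"
    and L: "\<And>q::complex. Re q < B \<Longrightarrow> integrable \<nu> (\<lambda>x. exp (q * of_real x))"
      "\<And>q::complex. Re q < B \<Longrightarrow> (\<integral>x. exp (q * of_real x) \<partial>\<nu>) = exp (\<integral>t. (exp (q * of_real t) - 1) \<partial>\<Lambda>)"
    using subordinator_exists[OF S pos B int] by blast
  let ?N = "density lborel (normal_density m (sqrt v))"
  have N: "prob_space ?N" using v by (intro prob_space_normal_density) auto
  interpret N: prob_space ?N by fact
  interpret \<nu>: prob_space \<nu> by fact
  interpret P: pair_prob_space \<nu> ?N ..
  note [measurable_cong] = \<nu>(2)
  show ?thesis
  proof (intro exI[of _ "convolution \<nu> ?N"] conjI allI impI)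
    show "prob_space (convolution \<nu> ?N)" unfolding convolution_def by (rule P.prob_space_distr) measurable
    show "absolutely_continuous lborel (convolution \<nu> ?N)"
      using \<nu> by (intro absolutely_continuous_convolution_density[OF refl]) (auto intro: \<nu>.finite_measure N.finite_measure)
  next
    fix q :: complex assume q: "Re q < B"
    note * = convolution_exp_integral[OF \<nu>(1) N \<nu>(2) _ L(1)[OF q] normal_exp_integral(1)]
    show "integrable (convolution \<nu> ?N) (\<lambda>x. exp (q * of_real x))" by (rule *) (use v in auto)
    show "(\<integral>x. exp (q * of_real x) \<partial>convolution \<nu> ?N) =
         exp (q * of_real m + of_real v * q\<^sup>2 / 2 + (\<integral>t. (exp (q * of_real t) - 1) \<partial>\<Lambda>))"
      using v by (subst *) (auto simp: L(2)[OF q] normal_exp_integral exp_add)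
  qed simp
qed

text \<open>Dividing drift, variance and Levy measure by n preserves all hypotheses of
  \<open>levy_khintchine_exists\<close>, and the characteristic function of the resulting law is an
  n-th root of the given one.\<close>

lemma levy_khintchine_infinitely_divisible:
  fixes \<Lambda> :: "real measure" and B v m :: real
  assumes S: "sets \<Lambda> = sets borel" and pos: "AE t in \<Lambda>. t > 0" and B: "B > 0" and v: "v > 0"
    and int: "\<And>q::complex. Re q < B \<Longrightarrow> integrable \<Lambda> (\<lambda>t. exp (q * of_real t) - 1)"
    and \<mu>: "prob_space \<mu>" "sets \<mu> = sets borel"
    and E: "\<And>\<theta>::real. (\<integral>x. exp (\<i> * of_real \<theta> * of_real x) \<partial>\<mu>) =
         exp (\<i> * of_real \<theta> * of_real m + of_real v * (\<i> * of_real \<theta>)\<^sup>2 / 2 + (\<integral>t. (exp (\<i> * of_real \<theta> * of_real t) - 1) \<partial>\<Lambda>))"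
  shows "infinitely_divisible \<mu>"
  unfolding infinitely_divisible_def
proof (intro allI impI)
  fix n :: nat assume n: "n \<ge> 1"
  let ?\<Lambda> = "density \<Lambda> (\<lambda>_. ennreal (1 / n))"
  note [measurable_cong] = S
  have gm: "(\<lambda>t. exp (q * complex_of_real t) - 1) \<in> borel_measurable \<Lambda>" for q by measurable
  have "\<exists>\<nu>. prob_space \<nu> \<and> sets \<nu> = sets borel \<and> absolutely_continuous lborel \<nu> \<and>
    (\<forall>q::complex. Re q < B \<longrightarrow>
       integrable \<nu> (\<lambda>x. exp (q * of_real x)) \<and>
       (\<integral>x. exp (q * of_real x) \<partial>\<nu>) =
         exp (q * of_real (m / n) + of_real (v / n) * q\<^sup>2 / 2 + (\<integral>t. (exp (q * of_real t) - 1) \<partial>?\<Lambda>)))"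
  proof (rule levy_khintchine_exists)
    show "AE t in ?\<Lambda>. t > 0" using pos by (subst AE_density) auto
    show "integrable ?\<Lambda> (\<lambda>t. exp (q * complex_of_real t) - 1)" if "Re q < B" for q
      using int[OF that] gm by (subst integrable_density) auto
  qed (use S B v n in auto)
  then obtain \<nu> where \<nu>: "prob_space \<nu>" "sets \<nu> = sets borel"
    and I: "\<And>q::complex. Re q < B \<Longrightarrow> integrable \<nu> (\<lambda>x. exp (q * of_real x))"
    and L: "\<And>q::complex. Re q < B \<Longrightarrow> (\<integral>x. exp (q * of_real x) \<partial>\<nu>) =
         exp (q * of_real (m / n) + of_real (v / n) * q\<^sup>2 / 2 + (\<integral>t. (exp (q * of_real t) - 1) \<partial>?\<Lambda>))"
    by blast
  have L': "(\<integral>x. exp (q * of_real x) \<partial>\<nu>) ^ n =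
      exp (q * of_real m + of_real v * q\<^sup>2 / 2 + (\<integral>t. (exp (q * of_real t) - 1) \<partial>\<Lambda>))" if q: "Re q < B" for q
  proof -
    have "(\<integral>t. (exp (q * complex_of_real t) - 1) \<partial>?\<Lambda>) = (\<integral>t. (exp (q * of_real t) - 1) \<partial>\<Lambda>) / n"
      using gm by (subst integral_density) (auto simp: scaleR_conv_of_real)
    thus ?thesis using n unfolding L[OF q] exp_of_nat_mult[symmetric]
      by (intro arg_cong[of _ _ exp]) (simp add: distrib_left)
  qed
  note [measurable_cong] = \<nu>(2)
  interpret N: prob_space \<nu> by fact
  interpret PN: finite_product_prob_space "\<lambda>_::nat. \<nu>" "{..<n}" by standard auto
  let ?D = "distr (PiM {..<n} (\<lambda>_. \<nu>)) borel (\<lambda>y. \<Sum>i<n. y i)"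
  have "\<mu> = ?D"
  proof (rule real_law_eqI)
    show "prob_space ?D" by (rule PN.prob_space_distr) measurable
    fix \<theta> :: real
    have q: "Re (\<i> * of_real \<theta>) < B" using B by simp
    have "(\<integral>x. exp (\<i> * of_real \<theta> * of_real x) \<partial>?D) =
        (\<integral>y. (\<Prod>i<n. exp (\<i> * of_real \<theta> * of_real (y i))) \<partial>PiM {..<n} (\<lambda>_. \<nu>))"
      by (subst integral_distr) (auto simp: sum_distrib_left exp_sum)
    also have "\<dots> = (\<integral>x. exp (\<i> * of_real \<theta> * of_real x) \<partial>\<nu>) ^ n"
      using I[OF q] by (subst PN.product_integral_prod) auto
    also have "\<dots> = (\<integral>x. exp (\<i> * of_real \<theta> * of_real x) \<partial>\<mu>)"
      unfolding L'[OF q] E ..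
    finally show "(\<integral>x. exp (\<i> * of_real \<theta> * of_real x) \<partial>\<mu>) = (\<integral>x. exp (\<i> * of_real \<theta> * of_real x) \<partial>?D)" ..
  qed (use \<mu> in auto)
  thus "\<exists>\<nu>. prob_space \<nu> \<and> sets \<nu> = sets borel \<and> \<mu> = distr (PiM {..<n} (\<lambda>_. \<nu>)) borel (\<lambda>y. \<Sum>i<n. y i)"
    using \<nu> by blast
qed

section \<open>Laws given by their Mellin transforms\<close>

lemma of_real_powr_exp_ln: "x > 0 \<Longrightarrow> complex_of_real x powr q = exp (q * of_real (ln x))"
  by (simp add: powr_def Ln_of_real)

text \<open>The branch cut of the complex power lies on the negative axis. Splitting by sign leaves
  only real logarithms and the constant i\<pi>.\<close>

lemma borel_measurable_of_real_powr [measurable]: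
  "(\<lambda>x. complex_of_real x powr q) \<in> borel_measurable borel"
proof -
  have "(\<lambda>x. complex_of_real x powr q) = (\<lambda>x. if x = 0 then 0 else if x > 0 then exp (q * of_real (ln x))
      else exp (q * (of_real (ln (- x)) + of_real pi * \<i>)))"
    by (auto simp: fun_eq_iff powr_def Ln_of_real Ln_of_real')
  thus ?thesis by simp
qed

text \<open>Passing to the logarithm turns the Mellin transform into an exponential integral.
  Positivity holds only almost everywhere, which is enough for exp after ln to reproduce the image
  measure.\<close>

lemma
  assumes "mellin_law A S F \<mu>" and A: "A \<subseteq> {0<..}"
  shows mellin_law_prob_space_ln: "prob_space (distr \<mu> borel ln)"
    and mellin_law_eq_distr_exp: "\<mu> = distr (distr \<mu> borel ln) borel exp"
    and mellin_law_integral_ln: "q \<in> S \<Longrightarrow> (\<integral>x. exp (q * of_real x) \<partial>distr \<mu> borel ln) = F q"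
proof -
  from assms have P: "prob_space \<mu>" and S[measurable_cong]: "sets \<mu> = sets borel" and AE: "AE x in \<mu>. x > 0"
    and F: "\<And>q. q \<in> S \<Longrightarrow> (\<integral>x. complex_of_real x powr q \<partial>\<mu>) = F q"
    unfolding mellin_law_def by (auto elim!: eventually_mono)
  show "prob_space (distr \<mu> borel ln)" by (rule prob_space.prob_space_distr[OF P]) measurable
  have "distr (distr \<mu> borel ln) borel exp = distr \<mu> borel (\<lambda>x. exp (ln x))"
    by (subst distr_distr) (auto simp: o_def)
  also have "\<dots> = distr \<mu> \<mu> (\<lambda>x. x)"
    using AE by (intro distr_cong_AE refl) (auto simp: S elim!: eventually_mono)
  also have "\<dots> = \<mu>" by (rule distr_id)
  finally show "\<mu> = distr (distr \<mu> borel ln) borel exp" ..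
  have "(\<integral>x. exp (q * of_real x) \<partial>distr \<mu> borel ln) = (\<integral>x. exp (q * of_real (ln x)) \<partial>\<mu>)"
    by (subst integral_distr) auto
  also have "\<dots> = (\<integral>x. complex_of_real x powr q \<partial>\<mu>)"
    by (rule integral_cong_AE) (use AE borel_measurable_of_real_powr[of q] in \<open>auto simp: of_real_powr_exp_ln elim!: eventually_mono\<close>)
  finally have "(\<integral>x. exp (q * of_real x) \<partial>distr \<mu> borel ln) = (\<integral>x. complex_of_real x powr q \<partial>\<mu>)" .
  thus "(\<integral>x. exp (q * of_real x) \<partial>distr \<mu> borel ln) = F q" if "q \<in> S" using F[OF that] by simp
qed

lemma mellin_law_distr_exp:
  fixes \<kappa> :: "real measure"
  assumes P: "prob_space \<kappa>" and S[measurable_cong]: "sets \<kappa> = sets borel" and AE: "AE x in \<kappa>. exp x \<in> A"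
    and A: "A \<in> sets borel"
    and F: "\<And>q. q \<in> S \<Longrightarrow> integrable \<kappa> (\<lambda>x. exp (q * of_real x))"
      "\<And>q. q \<in> S \<Longrightarrow> (\<integral>x. exp (q * of_real x) \<partial>\<kappa>) = F q"
  shows "mellin_law A S F (distr \<kappa> borel exp)"
  unfolding mellin_law_def
proof (intro conjI ballI)
  show "prob_space (distr \<kappa> borel exp)" by (rule prob_space.prob_space_distr[OF P]) measurable
  show "AE x in distr \<kappa> borel exp. x \<in> A" using AE A by (subst AE_distr_iff) auto
  fix q assume q: "q \<in> S"
  show "integrable (distr \<kappa> borel exp) (\<lambda>x. complex_of_real x powr q)"
    using F(1)[OF q] by (subst integrable_distr_eq) (auto simp: of_real_powr_exp_ln)
  show "(\<integral>x. complex_of_real x powr q \<partial>distr \<kappa> borel exp) = F q"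
    using F(2)[OF q] by (subst integral_distr) (auto simp: of_real_powr_exp_ln)
qed simp

text \<open>The left side is the decay rate that the estimates of the Levy density produce, the
  right side the abscissa in \<open>barnes_beta22\<close>; equal signs make them agree.\<close>

lemma min_add_same_sign:
  fixes b0 b1 b2 :: real
  assumes "0 \<le> b1 \<and> 0 \<le> b2 \<or> b1 \<le> 0 \<and> b2 \<le> 0"
  shows "b0 + min 0 b1 + min 0 b2 = min b0 (b0 + b1 + b2)"
  using assms by (auto simp: min_def)

section \<open>Mellin integrals on the half-line\<close>

text \<open>Cauchy's inequality converts the local majorant h of f into the majorant 2h/r of the
  difference quotients, so dominated convergence lets the derivative pass under the
  integral.\<close>

lemma holomorphic_on_lebesgue_integral:
  fixes f :: "complex \<Rightarrow> 'a \<Rightarrow> complex"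
  assumes S: "open S" and hol: "\<And>t. t \<in> space M \<Longrightarrow> (\<lambda>z. f z t) holomorphic_on S"
    and meas: "\<And>z. z \<in> S \<Longrightarrow> f z \<in> borel_measurable M"
    and dom: "\<And>z. z \<in> S \<Longrightarrow> \<exists>r>0. \<exists>h. cball z r \<subseteq> S \<and> integrable M h \<and>
                 (\<forall>w\<in>cball z r. \<forall>t\<in>space M. norm (f w t) \<le> h t)"
  shows "(\<lambda>z. \<integral>t. f z t \<partial>M) holomorphic_on S"
proof (rule holomorphic_onI)
  fix z assume z: "z \<in> S"
  from dom[OF z] obtain r h where "r > 0" and rh: "cball z r \<subseteq> S \<and> integrable M h \<and>
      (\<forall>w\<in>cball z r. \<forall>t\<in>space M. norm (f w t) \<le> h t)" by (elim exE conjE) (rule that; simp)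
  hence r: "r > 0" "cball z r \<subseteq> S" and h: "integrable M h"
    and le: "\<And>w t. w \<in> cball z r \<Longrightarrow> t \<in> space M \<Longrightarrow> norm (f w t) \<le> h t" by simp_all
  have int: "integrable M (f w)" if w: "w \<in> cball z r" for w
  proof (rule Bochner_Integration.integrable_bound[OF h meas])
    show "w \<in> S" using r(2) w by (rule subsetD)
    have "norm (f w t) \<le> norm (h t)" if "t \<in> space M" for t
      using le[OF w that] by simp
    thus "AE t in M. norm (f w t) \<le> norm (h t)" by (intro AE_I2)
  qed
  define d where "d t = deriv (\<lambda>w. f w t) z" for t
  define Q where "Q w t = (f w t - f z t) / (w - z)" for w t
  have lip: "norm (Q w t) \<le> 2 * h t / r" if w: "w \<in> ball z (r / 2)" and t: "t \<in> space M" for w t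
  proof -
    have "norm (f z t) \<le> h t" using r t by (intro le) auto
    hence h0: "h t \<ge> 0" by (rule order_trans[OF norm_ge_zero])
    have "norm (f w t - f z t) \<le> (h t / (r / 2)) * norm (w - z)"
    proof (rule field_differentiable_bound[where S = "ball z (r / 2)" and f' = "deriv (\<lambda>w. f w t)"])
      fix x assume x: "x \<in> ball z (r / 2)"
      have sub: "cball x (r / 2) \<subseteq> cball z r" using x by (simp add: cball_subset_cball_iff dist_commute)
      hence sub': "cball x (r / 2) \<subseteq> S" using r(2) by (rule order_trans)
      have "x \<in> cball x (r / 2)" using r(1) by simp
      hence "x \<in> S" using sub' by (rule rev_subsetD)
      show "((\<lambda>w. f w t) has_field_derivative deriv (\<lambda>w. f w t) x) (at x within ball z (r / 2))"
        by (rule has_field_derivative_at_within, rule holomorphic_derivI[OF hol[OF t] S \<open>x \<in> S\<close>])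
      have "norm ((deriv ^^ 1) (\<lambda>w. f w t) x) \<le> fact 1 * h t / (r / 2) ^ 1"
      proof (rule Cauchy_inequality)
        show "(\<lambda>w. f w t) holomorphic_on ball x (r / 2)"
          using sub' by (intro holomorphic_on_subset[OF hol[OF t]]) auto
        show "continuous_on (cball x (r / 2)) (\<lambda>w. f w t)"
          using sub' by (intro holomorphic_on_imp_continuous_on holomorphic_on_subset[OF hol[OF t]]) auto
        show "norm (f y t) \<le> h t" if "norm (x - y) = r / 2" for y
          using sub that t by (intro le) (auto simp: dist_norm subset_iff)
      qed (use r in auto)
      thus "norm (deriv (\<lambda>w. f w t) x) \<le> h t / (r / 2)" by simp
    qed (use w r in auto)
    thus ?thesis using h0 r by (cases "w = z") (simp_all add: Q_def norm_divide pos_divide_le_eq mult_ac)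
  qed
  have Qm: "Q w \<in> borel_measurable M" if "w \<in> S" for w
    unfolding Q_def using meas[OF that] meas[OF z] by measurable
  have Qlim: "(\<lambda>n. Q (X n) t) \<longlonglongrightarrow> d t" if X: "X \<longlonglongrightarrow> z" "\<And>n. X n \<noteq> z" and t: "t \<in> space M" for X t
  proof -
    have "((\<lambda>w. f w t) has_field_derivative d t) (at z)"
      unfolding d_def using hol[OF t] S z by (rule holomorphic_derivI)
    hence "((\<lambda>w. Q w t) \<longlongrightarrow> d t) (at z)" by (simp add: has_field_derivative_iff Q_def)
    thus ?thesis using X by (auto simp: tendsto_at_iff_sequentially o_def)
  qed
  have dm: "d \<in> borel_measurable M"
  proof (rule borel_measurable_LIMSEQ_metric)
    \<comment> \<open>The increments r/(n + 2) are nonzero and stay within the disc, so the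
      derivative is a pointwise limit of measurable difference quotients.\<close>
    let ?X = "\<lambda>n. z + of_real (r / real (n + 2))"
    have "norm (of_real (r / real (n + 2)) :: complex) \<le> r" for n
      using r by (subst norm_of_real) (simp add: field_simps)
    hence "?X n \<in> cball z r" for n by (auto simp: dist_norm simp del: norm_of_real of_real_divide)
    thus "Q (?X n) \<in> borel_measurable M" for n using r by (intro Qm) auto
    have "(\<lambda>n. r / real (n + 2)) \<longlonglongrightarrow> 0"
      using lim_const_over_n[of r] by (rule LIMSEQ_ignore_initial_segment)
    hence "(\<lambda>n. z + complex_of_real (r / real (n + 2))) \<longlonglongrightarrow> z + of_real 0" by (intro tendsto_intros)
    moreover have "complex_of_real (r / real (n + 2)) \<noteq> 0" for n
      using r by (subst of_real_eq_0_iff) (simp add: field_simps)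
    ultimately show "(\<lambda>n. Q (?X n) t) \<longlonglongrightarrow> d t" if "t \<in> space M" for t
      using that by (intro Qlim) (auto simp del: of_real_divide)
  qed
  have "((\<lambda>w. ((\<integral>t. f w t \<partial>M) - (\<integral>t. f z t \<partial>M)) / (w - z)) \<longlongrightarrow> (\<integral>t. d t \<partial>M)) (at z)"
    unfolding tendsto_at_iff_sequentially o_def
  proof (intro allI impI)
    fix X assume X: "\<forall>i. X i \<in> UNIV - {z}" "X \<longlonglongrightarrow> z"
    have "\<forall>\<^sub>F n in sequentially. X n \<in> ball z (r / 2)"
      using tendstoD[OF X(2), of "r / 2"] r by (simp add: dist_commute)
    then obtain N where N: "\<And>n. n \<ge> N \<Longrightarrow> X n \<in> ball z (r / 2)" by (auto simp: eventually_sequentially)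
    have N': "X (n + N) \<in> ball z (r / 2)" "X (n + N) \<in> cball z r" "X (n + N) \<in> S" for n
      using N[of "n + N"] r by auto
    have "(\<lambda>n. \<integral>t. Q (X (n + N)) t \<partial>M) \<longlonglongrightarrow> (\<integral>t. d t \<partial>M)"
    proof (rule integral_dominated_convergence[where w = "\<lambda>t. 2 * h t / r"])
      show "integrable M (\<lambda>t. 2 * h t / r)" using h by simp
      show "AE t in M. (\<lambda>n. Q (X (n + N)) t) \<longlonglongrightarrow> d t"
        using X by (intro AE_I2 LIMSEQ_ignore_initial_segment Qlim) auto
      show "AE t in M. norm (Q (X (n + N)) t) \<le> 2 * h t / r" for n
        using N' by (intro AE_I2 lip)
    qed (use N' in \<open>simp_all add: dm Qm\<close>)
    also have "(\<lambda>n. \<integral>t. Q (X (n + N)) t \<partial>M) = (\<lambda>n. ((\<integral>t. f (X (n + N)) t \<partial>M) - (\<integral>t. f z t \<partial>M)) / (X (n + N) - z))"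
      using N' r unfolding Q_def by (intro ext) (simp add: int)
    finally show "(\<lambda>n. ((\<integral>t. f (X n) t \<partial>M) - (\<integral>t. f z t \<partial>M)) / (X n - z)) \<longlonglongrightarrow> (\<integral>t. d t \<partial>M)"
      by (rule LIMSEQ_offset)
  qed
  hence "((\<lambda>w. \<integral>t. f w t \<partial>M) has_field_derivative (\<integral>t. d t \<partial>M)) (at z)"
    by (simp add: has_field_derivative_iff)
  thus "(\<lambda>z. \<integral>t. f z t \<partial>M) field_differentiable at z within S"
    using field_differentiable_at_within field_differentiable_def by blast
qed

section \<open>Lebesgue measure on the positive half-line, Levy measures and Mellin
  transforms\<close>

abbreviation lpos :: "real measure" where
  "lpos \<equiv> restrict_space lborel {0<..}"

lemma space_lpos [simp]: "space lpos = {0<..}"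
  by (simp add: space_restrict_space)

lemma borel_measurable_lposI: "f \<in> borel_measurable borel \<Longrightarrow> f \<in> borel_measurable lpos"
  by (rule measurable_restrict_space1) simp

lemma integrable_gamma_kernel:
  assumes "\<sigma> > 0" "x > 0"
  shows "integrable lpos (\<lambda>t. t powr (\<sigma> - 1) * exp (- x * t))"
proof -
  let ?f = "\<lambda>t::real. complex_of_real t powr (of_real \<sigma> - 1) / of_real (exp (x * t))"
  have "set_integrable lebesgue {0<..} ?f"
    by (rule absolutely_integrable_Gamma_integral) (use assms in auto)
  hence "integrable lebesgue (\<lambda>t. norm (indicat_real {0<..} t *\<^sub>R ?f t))"
    unfolding set_integrable_def by (rule integrable_norm)
  also have "(\<lambda>t. norm (indicat_real {0<..} t *\<^sub>R ?f t)) = (\<lambda>t. indicat_real {0<..} t *\<^sub>R (t powr (\<sigma> - 1) * exp (- x * t)))"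
    by (auto simp: fun_eq_iff norm_mult norm_divide norm_powr_real_powr exp_minus divide_inverse norm_inverse split: split_indicator)
  finally show ?thesis
    by (subst integrable_restrict_space, simp, subst (asm) integrable_completion) auto
qed

text \<open>The substitution of x t for t reduces this to Euler's integral; complex w is reached
  later by analytic continuation.\<close>

lemma Gamma_kernel_real:
  assumes s: "Re s > 0" and x: "x > 0"
  shows "(\<integral>t. exp ((s - 1) * of_real (ln t)) * exp (- (of_real x) * of_real t) \<partial>lpos) = Gamma s * of_real x powr (- s)"
proof -
  let ?f = "\<lambda>t::real. complex_of_real t powr (s - 1) / of_real (exp t)"
  let ?g = "\<lambda>t::real. indicat_real {0<..} t *\<^sub>R ?f t"
  have 0: "set_integrable lebesgue {0<..} ?f"
    using absolutely_integrable_Gamma_integral'[OF s] .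
  have "(LINT t:{0<..}|lebesgue. ?f t) = Gamma s"
    using set_lebesgue_integral_eq_integral(2)[OF 0] Gamma_integral_complex'[OF s] by (simp add: integral_unique)
  hence "integral\<^sup>L lebesgue ?g = Gamma s"
    by (simp add: set_lebesgue_integral_def)
  moreover have gm: "?g \<in> borel_measurable borel"
  proof -
    have "?g = (\<lambda>t. indicat_real {0<..} t *\<^sub>R (exp ((s - 1) * of_real (ln t)) / of_real (exp t)))"
      by (auto simp: fun_eq_iff powr_def Ln_of_real split: split_indicator)
    thus ?thesis by simp
  qed
  ultimately have G: "integral\<^sup>L lborel ?g = Gamma s"
    by (subst (asm) integral_completion) auto
  have "(\<integral>t. exp ((s - 1) * of_real (ln t)) * exp (- (of_real x) * of_real t) \<partial>lpos) =
      (\<integral>t. of_real x powr (1 - s) * ?g (0 + x * t) \<partial>lborel)"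
  proof (subst integral_restrict_space, simp, intro Bochner_Integration.integral_cong refl)
    fix t :: real
    have "exp ((s - 1) * of_real (ln t)) * exp (- (of_real x) * of_real t) = of_real x powr (1 - s) * ?f (x * t)" if "t > 0"
    proof -
      have "of_real x powr (1 - s) * complex_of_real (x * t) powr (s - 1) =
          exp ((1 - s) * of_real (ln x)) * exp ((s - 1) * of_real (ln x + ln t))"
        using x that by (simp add: powr_def Ln_of_real ln_mult del: of_real_mult)
      also have "\<dots> = exp ((s - 1) * of_real (ln t))"
        unfolding exp_add[symmetric] by (rule arg_cong[of _ _ exp]) (simp add: algebra_simps)
      finally show ?thesis by (simp add: exp_of_real[symmetric] exp_minus divide_inverse)
    qed
    thus "indicat_real {0<..} t *\<^sub>R (exp ((s - 1) * of_real (ln t)) * exp (- (of_real x) * of_real t)) =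
        of_real x powr (1 - s) * ?g (0 + x * t)"
      using x by (cases "t > 0") (simp_all add: zero_less_mult_iff)
  qed
  also have "\<dots> = of_real x powr (1 - s) * (\<integral>t. ?g (0 + x * t) \<partial>lborel)"
    by (rule integral_mult_right_zero)
  also have "(\<integral>t. ?g (0 + x * t) \<partial>lborel) = Gamma s / of_real x"
    using lborel_integral_real_affine[of x ?g 0] x unfolding G by (simp add: scaleR_conv_of_real)
  also have "of_real x powr (1 - s) * (Gamma s / of_real x) = Gamma s * of_real x powr (- s)"
    using x by (simp add: powr_diff powr_minus divide_inverse)
  finally show ?thesis .
qed

definition levy_measure :: "(real \<Rightarrow> real) \<Rightarrow> real measure" where
  "levy_measure \<rho> = density lborel (\<lambda>t. ennreal (indicator {0<..} t * \<rho> t))"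

lemma sets_levy_measure [simp]: "sets (levy_measure \<rho>) = sets borel"
  by (simp add: levy_measure_def)

lemma AE_levy_measure_pos:
  assumes [measurable]: "\<rho> \<in> borel_measurable borel"
  shows "AE t in levy_measure \<rho>. t > 0"
  unfolding levy_measure_def by (subst AE_density) (auto intro!: AE_I2 split: split_indicator_asm)

lemma
  fixes f :: "real \<Rightarrow> complex"
  assumes [measurable]: "\<rho> \<in> borel_measurable borel" "f \<in> borel_measurable borel" and nn: "\<And>t. t > 0 \<Longrightarrow> \<rho> t \<ge> 0"
  shows integrable_levy_measure_iff: "integrable (levy_measure \<rho>) f \<longleftrightarrow> integrable lpos (\<lambda>t. \<rho> t *\<^sub>R f t)"
    and integral_levy_measure: "(\<integral>t. f t \<partial>levy_measure \<rho>) = (\<integral>t. \<rho> t *\<^sub>R f t \<partial>lpos)"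
proof -
  have nn': "AE t in lborel. 0 \<le> indicat_real {0<..} t * \<rho> t" using nn by (auto split: split_indicator)
  show "integrable (levy_measure \<rho>) f \<longleftrightarrow> integrable lpos (\<lambda>t. \<rho> t *\<^sub>R f t)"
    unfolding levy_measure_def
    by (subst integrable_density, simp, simp, rule nn', subst integrable_restrict_space) (simp_all add: scaleR_scaleR)
  show "(\<integral>t. f t \<partial>levy_measure \<rho>) = (\<integral>t. \<rho> t *\<^sub>R f t \<partial>lpos)"
    unfolding levy_measure_def
    by (subst integral_density, simp, simp, rule nn', subst integral_restrict_space) (simp_all add: scaleR_scaleR)
qed

lemma norm_exp_ln_mult: "t > 0 \<Longrightarrow> norm (exp (z * complex_of_real (ln t))) = t powr Re z"
  by (simp add: powr_def mult.commute)

text \<open>The bound leaves a Gamma integrand with exponent Re s + a - 1, so faster vanishing of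
  \<open>F\<close> at 0 moves the boundary of convergence to the left.\<close>

lemma
  fixes F :: "real \<Rightarrow> complex"
  assumes F: "F \<in> borel_measurable lpos" and x: "x > 0"
    and bd: "\<And>t. t > 0 \<Longrightarrow> norm (F t) \<le> C * t powr a * exp (- x * t)"
  shows mellin_integrable: "Re s > - a \<Longrightarrow> integrable lpos (\<lambda>t. exp ((s - 1) * of_real (ln t)) * F t)"
    and mellin_holomorphic: "(\<lambda>s. \<integral>t. exp ((s - 1) * of_real (ln t)) * F t \<partial>lpos) holomorphic_on {s. Re s > - a}"
proof -
  have [measurable]: "ln \<in> borel_measurable lpos" by (rule borel_measurable_lposI) simp
  note [measurable] = F
  have C: "C \<ge> 0"
  proof -
    have "0 \<le> C * exp (- x)" using order_trans[OF norm_ge_zero bd[of 1]] by simp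
    thus ?thesis by (simp add: zero_le_mult_iff)
  qed
  have nb: "norm (exp ((s - 1) * of_real (ln t)) * F t) \<le> C * (t powr (Re s + a - 1) * exp (- x * t))" if "t > 0" for s t
  proof -
    have "norm (exp ((s - 1) * of_real (ln t)) * F t) \<le> t powr (Re s - 1) * (C * t powr a * exp (- x * t))"
      unfolding norm_mult norm_exp_ln_mult[OF that] using bd[OF that] by (intro mult_mono) auto
    also have "\<dots> = C * ((t powr (Re s - 1) * t powr a) * exp (- x * t))" by (simp add: mult_ac)
    also have "t powr (Re s - 1) * t powr a = t powr (Re s + a - 1)"
      by (simp add: powr_add[symmetric] algebra_simps)
    finally show ?thesis .
  qed
  have hint: "integrable lpos (\<lambda>t. C * (t powr (\<sigma> + a - 1) * exp (- x * t)))" if "\<sigma> > - a" for \<sigma>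
    using that x by (intro integrable_mult_right integrable_gamma_kernel) auto
  show "integrable lpos (\<lambda>t. exp ((s - 1) * of_real (ln t)) * F t)" if s: "Re s > - a"
  proof (rule Bochner_Integration.integrable_bound[OF hint[OF s]])
    have "norm (exp ((s - 1) * of_real (ln t)) * F t) \<le> norm (C * (t powr (Re s + a - 1) * exp (- x * t)))"
      if "t \<in> space lpos" for t
      using nb[of t s] that abs_ge_self order_trans by fastforce
    thus "AE t in lpos. norm (exp ((s - 1) * of_real (ln t)) * F t) \<le> norm (C * (t powr (Re s + a - 1) * exp (- x * t)))"
      by (intro AE_I2)
  qed measurable
  show "(\<lambda>s. \<integral>t. exp ((s - 1) * of_real (ln t)) * F t \<partial>lpos) holomorphic_on {s. Re s > - a}"
  proof (rule holomorphic_on_lebesgue_integral)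
    fix s assume "s \<in> {s. Re s > - a}"
    hence s: "Re s > - a" by simp
    \<comment> \<open>The radius is half the distance to the boundary. On the disc a power of t is
      at most the sum of its values at the two extreme exponents: the smaller one dominates for t
      \<le> 1, the larger one for t > 1.\<close>
    define r where "r = (Re s + a) / 2"
    have r: "r > 0" using s by (simp add: r_def)
    define h where "h t = C * (t powr ((Re s - r) + a - 1) * exp (- x * t)) + C * (t powr ((Re s + r) + a - 1) * exp (- x * t))" for t
    have Re: "\<bar>Re z - Re s\<bar> \<le> r" if "z \<in> cball s r" for z
      using that abs_Re_le_cmod[of "z - s"] by (simp add: dist_norm norm_minus_commute)
    show "\<exists>r>0. \<exists>h. cball s r \<subseteq> {s. - a < Re s} \<and> integrable lpos h \<and>
            (\<forall>w\<in>cball s r. \<forall>t\<in>space lpos. norm (exp ((w - 1) * of_real (ln t)) * F t) \<le> h t)"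
    proof (intro exI[of _ r] exI[of _ h] conjI ballI)
      show "cball s r \<subseteq> {s. - a < Re s}"
      proof
        fix z assume "z \<in> cball s r"
        from Re[OF this] have "Re s - Re z \<le> r" by linarith
          thus "z \<in> {s. - a < Re s}" using s by (simp add: r_def field_simps)
      qed
      show "integrable lpos h" unfolding h_def using s
        by (intro Bochner_Integration.integrable_add hint) (auto simp: r_def field_simps)
      fix z and t :: real assume z: "z \<in> cball s r" and "t \<in> space lpos"
      hence t: "t > 0" by simp
      have "t powr (Re z + a - 1) \<le> t powr ((Re s - r) + a - 1) + t powr ((Re s + r) + a - 1)"
      proof (cases "t \<le> 1")
        case True
        hence "t powr (Re z + a - 1) \<le> t powr ((Re s - r) + a - 1)"
          using Re[OF z] t by (intro powr_mono') (auto simp: abs_le_iff)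
        thus ?thesis by (smt (verit) powr_ge_zero)
      next
        case False
        hence "t powr (Re z + a - 1) \<le> t powr ((Re s + r) + a - 1)"
          using Re[OF z] t by (intro powr_mono) (auto simp: abs_le_iff)
        thus ?thesis by (smt (verit) powr_ge_zero)
      qed
      hence "C * (t powr (Re z + a - 1) * exp (- x * t)) \<le> C * ((t powr ((Re s - r) + a - 1) + t powr ((Re s + r) + a - 1)) * exp (- x * t))"
        using C by (intro mult_left_mono mult_right_mono) auto
      thus "norm (exp ((z - 1) * of_real (ln t)) * F t) \<le> h t"
        using nb[OF t, of z] unfolding h_def by (simp add: algebra_simps)
    qed (rule r)
  qed (auto intro!: holomorphic_intros simp: open_halfspace_Re_gt)
qed

text \<open>Both sides are holomorphic in w on the right half-plane and agree on the positive reals,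
  which accumulate at 1.\<close>

lemma Gamma_kernel:
  assumes s: "Re s > 0" and w: "Re w > 0"
  shows "(\<integral>t. exp ((s - 1) * of_real (ln t)) * exp (- w * of_real t) \<partial>lpos) = Gamma s * w powr (- s)"
proof -
  let ?G = "\<lambda>w. \<integral>t. exp ((s - 1) * of_real (ln t)) * exp (- w * of_real t) \<partial>lpos"
  let ?S = "{w. Re w > 0}"
  have [measurable]: "ln \<in> borel_measurable lpos" "(\<lambda>t. t) \<in> borel_measurable lpos"
    by (rule borel_measurable_lposI, simp)+
  have G: "?G holomorphic_on ?S"
  proof (rule holomorphic_on_lebesgue_integral)
    fix z assume z: "z \<in> ?S"
    define h where "h t = t powr (Re s - 1) * exp (- (Re z / 2) * t)" for t
    show "\<exists>r>0. \<exists>h. cball z r \<subseteq> ?S \<and> integrable lpos h \<and>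
            (\<forall>w\<in>cball z r. \<forall>t\<in>space lpos. norm (exp ((s - 1) * of_real (ln t)) * exp (- w * of_real t)) \<le> h t)"
    proof (intro exI[of _ "Re z / 2"] exI[of _ h] conjI ballI)
      have Re: "Re w \<ge> Re z / 2" if "w \<in> cball z (Re z / 2)" for w
        using that abs_Re_le_cmod[of "z - w"] by (simp add: dist_norm abs_le_iff)
      show "cball z (Re z / 2) \<subseteq> ?S" using Re z by force
      show "integrable lpos h" unfolding h_def using z s by (intro integrable_gamma_kernel) auto
      fix w and t :: real assume w: "w \<in> cball z (Re z / 2)" and "t \<in> space lpos"
      hence t: "t > 0" by simp
      show "norm (exp ((s - 1) * of_real (ln t)) * exp (- w * of_real t)) \<le> h t"
        unfolding norm_mult norm_exp_ln_mult[OF t] h_def using Re[OF w] t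
        by (intro mult_mono) auto
    qed (use z in auto)
  qed (auto intro!: holomorphic_intros simp: open_halfspace_Re_gt)
  have "?G w - Gamma s * w powr (- s) = 0"
  proof (rule analytic_continuation[where f = "\<lambda>w. ?G w - Gamma s * w powr (- s)" and S = ?S and U = "of_real ` {0<..}" and \<xi> = 1])
    show "(\<lambda>w. ?G w - Gamma s * w powr (- s)) holomorphic_on ?S"
      by (intro holomorphic_intros G) (auto simp: complex_nonpos_Reals_iff)
    show "(1::complex) islimpt of_real ` {0<..}"
      unfolding islimpt_approachable
    proof (intro allI impI)
      fix e :: real assume e: "e > 0"
      have eq: "complex_of_real (1 + e / 2) - 1 = of_real (e / 2)" by simp
      have "complex_of_real (1 + e / 2) \<noteq> 1" using e eq by auto
      moreover have "dist (complex_of_real (1 + e / 2)) 1 < e"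
        unfolding dist_norm eq norm_of_real using e by simp
      moreover have "complex_of_real (1 + e / 2) \<in> of_real ` {0<..}" using e by (intro imageI) simp
      ultimately show "\<exists>x'\<in>of_real ` {0<..}. x' \<noteq> 1 \<and> dist x' (1::complex) < e" by blast
    qed
    show "?G z - Gamma s * z powr (- s) = 0" if "z \<in> of_real ` {0<..}" for z
      using that Gamma_kernel_real[OF s] by auto
    show "connected ?S" by (intro convex_connected convex_halfspace_Re_gt)
  qed (use w in \<open>auto simp: open_halfspace_Re_gt\<close>)
  thus ?thesis by simp
qed

section \<open>Auxiliary facts on complex functions and series\<close>

text \<open>Stated with \<open>infsetsum\<close>, an integral against counting measure, so that
  Fubini can interchange it with the Mellin integral. The type is general because both the series
  and the series of its norms are summed.\<close>

lemma
  fixes x y :: "'a :: {real_normed_field, banach, second_countable_topology}"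
  assumes x: "norm x < 1" and y: "norm y < 1"
  shows abs_summable_double_geometric: "Infinite_Set_Sum.abs_summable_on (\<lambda>k::nat \<times> nat. x ^ fst k * y ^ snd k) UNIV"
    and infsetsum_double_geometric: "infsetsum (\<lambda>k::nat \<times> nat. x ^ fst k * y ^ snd k) UNIV = 1 / ((1 - x) * (1 - y))"
proof -
  have sx: "Infinite_Set_Sum.abs_summable_on (\<lambda>n. z ^ n) UNIV" "infsetsum (\<lambda>n. z ^ n) UNIV = 1 / (1 - z)"
    if "norm z < 1" for z :: "'b :: {real_normed_field, banach, second_countable_topology}"
  proof -
    show 1: "Infinite_Set_Sum.abs_summable_on (\<lambda>n. z ^ n) UNIV"
      unfolding abs_summable_on_nat_iff' norm_power using that by (intro summable_geometric) simp
    show "infsetsum (\<lambda>n. z ^ n) UNIV = 1 / (1 - z)"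
      using 1 that by (simp add: infsetsum_nat' suminf_geometric)
  qed
  have U: "(UNIV :: (nat \<times> nat) set) = UNIV \<times> UNIV" by simp
  have nx: "norm (norm x) < 1" "norm (norm y) < 1" using x y by simp_all
  show S: "Infinite_Set_Sum.abs_summable_on (\<lambda>k::nat \<times> nat. x ^ fst k * y ^ snd k) UNIV"
    unfolding U
  proof (subst abs_summable_on_Sigma_iff, simp, simp, intro conjI ballI)
    show "Infinite_Set_Sum.abs_summable_on (\<lambda>j. x ^ fst (i, j) * y ^ snd (i, j)) UNIV" for i
      using sx(1)[OF y] by (simp add: abs_summable_on_cmult_right)
    have *: "infsetsum (\<lambda>j. norm (x ^ fst (i, j) * y ^ snd (i, j))) UNIV = norm x ^ i * (1 / (1 - norm y))" for i
      using sx[OF nx(2)] by (simp add: norm_mult norm_power infsetsum_cmult_right)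
    show "Infinite_Set_Sum.abs_summable_on (\<lambda>i. infsetsum (\<lambda>j. norm (x ^ fst (i, j) * y ^ snd (i, j))) UNIV) UNIV"
      using sx(1)[OF nx(1)] unfolding * abs_summable_on_def by (rule integrable_mult_left)
  qed
  have "infsetsum (\<lambda>k::nat \<times> nat. x ^ fst k * y ^ snd k) (UNIV \<times> UNIV) = infsetsum (\<lambda>i. infsetsum (\<lambda>j. x ^ i * y ^ j) UNIV) UNIV"
    using S by (subst infsetsum_Times) auto
  also have "\<dots> = infsetsum (\<lambda>i. x ^ i * (1 / (1 - y))) UNIV"
    using sx[OF y] by (intro infsetsum_cong refl) (simp add: infsetsum_cmult_right)
  also have "\<dots> = 1 / ((1 - x) * (1 - y))"
    using sx[OF x] by (subst infsetsum_cmult_left) auto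
  finally show "infsetsum (\<lambda>k::nat \<times> nat. x ^ fst k * y ^ snd k) UNIV = 1 / ((1 - x) * (1 - y))" by simp
qed

text \<open>Lets a quadratic factor be paid for with a part of the exponential decay. The constant 1
  + 4/x^2 comes from squaring exp(xt/2) \<ge> xt/2.\<close>

lemma poly_exp_bound:
  assumes x: "(x::real) > 0"
  obtains K where "\<And>t. t > 0 \<Longrightarrow> 1 + t\<^sup>2 \<le> K * exp (x * t)" "K > 0"
proof
  fix t :: real assume t: "t > 0"
  have e: "exp (x * t / 2) \<ge> x * t / 2" using exp_ge_add_one_self[of "x * t / 2"] by linarith
  have "(x * t / 2)\<^sup>2 \<le> (exp (x * t / 2))\<^sup>2" using e x t by (intro power_mono) auto
  also have "\<dots> = exp (x * t)" by (simp add: power2_eq_square flip: exp_add)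
  finally have "t\<^sup>2 \<le> 4 / x\<^sup>2 * exp (x * t)" using x by (simp add: field_simps power2_eq_square)
  moreover have "1 \<le> exp (x * t)" using x t by simp
  ultimately show "1 + t\<^sup>2 \<le> (1 + 4 / x\<^sup>2) * exp (x * t)"
    unfolding distrib_right mult_1 by linarith
qed (use x in \<open>simp add: add_pos_nonneg\<close>)

lemma holomorphic_one_minus_exp_quotient:
  "(\<lambda>z::complex. if z = 0 then a else (1 - exp (- a * z)) / z) holomorphic_on UNIV"
proof -
  let ?f = "\<lambda>z. 1 - exp (- a * z)"
  have "(?f has_field_derivative a) (at 0)" by (auto intro!: derivative_eq_intros)
  hence d: "deriv ?f 0 = a" by (rule DERIV_imp_deriv)
  have "(\<lambda>z. if z = 0 then deriv ?f 0 else (?f z - ?f 0) / (z - 0)) holomorphic_on UNIV"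
    by (rule pole_lemma_open) (auto intro!: holomorphic_intros)
  also have "(\<lambda>z. if z = 0 then deriv ?f 0 else (?f z - ?f 0) / (z - 0)) = (\<lambda>z. if z = 0 then a else (1 - exp (- a * z)) / z)"
    unfolding d by (auto simp: fun_eq_iff)
  finally show ?thesis .
qed

text \<open>The identity theorem, applied to the difference with its singularities removed, gives
  equality near every point except possibly at the point itself. There niceness fixes the value: 0
  at a pole, the limit otherwise.\<close>

lemma nicely_meromorphic_unique:
  assumes f: "f nicely_meromorphic_on UNIV" and g: "g nicely_meromorphic_on UNIV"
    and eq: "\<And>s. s \<in> S \<Longrightarrow> f s = g s" and S: "open S" "S \<noteq> {}"
  shows "f = g"
proof
  fix z
  obtain z0 where z0: "z0 \<in> S" using S by auto
  let ?h = "\<lambda>s. f s - g s"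
  have h: "?h meromorphic_on UNIV"
    using f g by (auto simp: nicely_meromorphic_on_def intro!: meromorphic_intros)
  have "isolated_singularity_at ?h s" for s
    using h by (rule meromorphic_onE) auto
  hence ev: "\<forall>\<^sub>F t in at s. remove_sings ?h t = ?h t" for s
    by (rule eventually_remove_sings_eq_at)
  have "\<forall>\<^sub>F s in at z0. s \<in> S" using S z0 by (intro eventually_at_in_open') auto
  hence "\<forall>\<^sub>F s in at z0. remove_sings ?h s = 0"
    using ev[of z0] by eventually_elim (use eq in auto)
  hence "frequently (\<lambda>s. remove_sings ?h s = 0) (at z0)" by (intro eventually_frequently) auto
  hence 0: "remove_sings ?h s = 0" for s
    by (rule frequently_eq_meromorphic_imp_constant[OF _ remove_sings_nicely_meromorphic[OF h]]) auto
  have e: "\<forall>\<^sub>F t in at z. f t = g t" using ev[of z] by eventually_elim (use 0 in auto)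
  have pole: "is_pole f z \<longleftrightarrow> is_pole g z" by (rule is_pole_cong[OF e refl])
  have lims: "(f \<longlongrightarrow> c) (at z) \<longleftrightarrow> (g \<longlongrightarrow> c) (at z)" for c by (rule filterlim_cong[OF refl refl e])
  have fz: "is_pole f z \<and> f z = 0 \<or> f \<midarrow>z\<rightarrow> f z" and gz: "is_pole g z \<and> g z = 0 \<or> g \<midarrow>z\<rightarrow> g z"
    using f g by (simp_all add: nicely_meromorphic_on_def)
  show "f z = g z"
  proof (cases "is_pole f z")
    case True
    hence "\<not> (f \<longlongrightarrow> f z) (at z)" "\<not> (g \<longlongrightarrow> g z) (at z)"
      using pole not_tendsto_and_filterlim_at_infinity[of "at z"] by (auto simp: is_pole_def)
    thus ?thesis using fz gz by simp
  next
    case False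
    hence "(f \<longlongrightarrow> f z) (at z)" "(g \<longlongrightarrow> g z) (at z)"
      using fz gz pole by simp_all
    thus ?thesis using lims[of "f z"] tendsto_unique[of "at z" g "f z" "g z"] by simp
  qed
qed

text \<open>The functional equation of \<open>rGamma\<close> cancels the Gamma values up to a
  rational factor. The points 0, 1, 2 are excluded because poles of \<open>Gamma\<close> receive the
  value 0; Re s > -1 keeps s - 2 away from the remaining poles.\<close>

lemma rGamma_mult_Gamma_shift:
  fixes s :: complex
  assumes "Re s > -1" "s \<noteq> 0" "s \<noteq> 1" "s \<noteq> 2"
  shows "rGamma s * Gamma s = 1" "rGamma s * Gamma (s - 1) = 1 / (s - 1)"
    "rGamma s * Gamma (s - 2) = 1 / ((s - 1) * (s - 2))"
proof -
  have r1: "(s - 1) * rGamma s = rGamma (s - 1)" using rGamma_plus1[of "s - 1"] by simp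
  have r2: "(s - 2) * rGamma (s - 1) = rGamma (s - 2)" using rGamma_plus1[of "s - 2"] by (simp add: algebra_simps)
  have "s - 2 \<notin> \<int>\<^sub>\<le>\<^sub>0"
  proof
    assume "s - 2 \<in> \<int>\<^sub>\<le>\<^sub>0"
    then obtain n where n: "s - 2 = - of_nat n" by (auto elim: nonpos_Ints_cases')
    hence "Re (s - 2) = Re (- of_nat n)" by (rule arg_cong)
    hence "Re s = 2 - real n" by simp
    hence "n < 3" using assms(1) by simp
    hence "n = 0 \<or> n = 1 \<or> n = 2" by auto
    thus False using n assms by (auto simp: algebra_simps)
  qed
  hence "rGamma (s - 2) \<noteq> 0" by (simp add: rGamma_eq_zero_iff)
  hence nz: "rGamma s \<noteq> 0" "rGamma (s - 1) \<noteq> 0" "rGamma (s - 2) \<noteq> 0" using r1 r2 by auto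
  have inv: "g * inverse (p * g) = 1 / p" if "g \<noteq> 0" for g p :: complex
    using that by (simp add: divide_inverse)
  show "rGamma s * Gamma s = 1" using nz by (simp add: Gamma_def)
  show "rGamma s * Gamma (s - 1) = 1 / (s - 1)" unfolding Gamma_def r1[symmetric] by (rule inv[OF nz(1)])
  have "rGamma (s - 2) = ((s - 1) * (s - 2)) * rGamma s"
    unfolding r2[symmetric] r1[symmetric] by (simp add: mult_ac)
  thus "rGamma s * Gamma (s - 2) = 1 / ((s - 1) * (s - 2))"
    unfolding Gamma_def by (simp only: inv[OF nz(1)])
qed

text \<open>On the segment from 0 to z the real part stays below \<open>max 0 (Re z)\<close>, which
  bounds the derivative of exp there.\<close>

lemma norm_exp_minus_one_le: "norm (exp z - 1) \<le> exp (max 0 (Re z)) * norm (z::complex)"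
proof -
  have "norm (exp z - exp 0) \<le> exp (max 0 (Re z)) * norm (z - 0)"
  proof (rule field_differentiable_bound[where S = "closed_segment 0 z" and f' = exp])
    fix x assume "x \<in> closed_segment 0 z"
    then obtain u where u: "0 \<le> u" "u \<le> 1" "x = u *\<^sub>R z" by (auto simp: closed_segment_def)
    have "u * Re z \<le> max 0 (Re z)"
      using u mult_left_le_one_le[of "Re z" u] by (cases "Re z \<ge> 0") (auto simp: mult_nonneg_nonpos)
    thus "norm (exp x) \<le> exp (max 0 (Re z))" using u by simp
  qed (auto intro!: derivative_eq_intros)
  thus ?thesis by simp
qed

lemma norm_exp_mult_minus_one_le:
  assumes "t > 0"
  shows "norm (exp (- q * of_real t) - 1) \<le> norm q * t * exp (max 0 (- Re q) * t)"
proof -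
  have "max 0 (Re (- q * of_real t)) = max 0 (- Re q) * t"
    using assms by (auto simp: max_def mult_le_0_iff)
  thus ?thesis using norm_exp_minus_one_le[of "- q * of_real t"] assms by (simp add: norm_mult mult_ac)
qed

text \<open>An exponential cost arises only for negative b. These costs add up to the rate b0 + min
  0 b1 + min 0 b2 of the Levy density.\<close>

lemma abs_one_minus_exp_le:
  fixes b t :: real
  assumes "t > 0"
  shows "\<bar>1 - exp (- b * t)\<bar> \<le> \<bar>b\<bar> * t * exp (- min 0 b * t)"
proof -
  have "exp (- of_real b * of_real t) - 1 = complex_of_real (exp (- b * t) - 1)"
    by (simp add: exp_of_real[symmetric])
  hence "norm (exp (- of_real b * of_real t) - 1 :: complex) = \<bar>exp (- b * t) - 1\<bar>"
    by (simp only: norm_of_real)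
  moreover have "max 0 (- b) = - min 0 b" by (simp add: min_def max_def)
  ultimately show ?thesis
    using norm_exp_mult_minus_one_le[OF assms, of "of_real b"] by (simp add: abs_minus_commute)
qed

section \<open>The Barnes double zeta function\<close>

locale barnes =
  fixes a1 a2 :: real
  assumes a1: "a1 > 0" and a2: "a2 > 0"
begin

definition denom :: "real \<Rightarrow> real" where
  "denom t = (1 - exp (- a1 * t)) * (1 - exp (- a2 * t))"

definition kernel :: "complex \<Rightarrow> real \<Rightarrow> complex" where
  "kernel w t = exp (- w * of_real t) / of_real (denom t)"

lemma denom_pos: "t > 0 \<Longrightarrow> denom t > 0"
  unfolding denom_def using a1 a2 by (intro mult_pos_pos) auto

text \<open>\<open>denom\<close> has a double zero at 0 and tends to 1 at infinity, so its
  reciprocal has order t^(-2) near 0 and is bounded far out.\<close>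

lemma inverse_denom_le:
  obtains c where "c > 0" "\<And>t. t > 0 \<Longrightarrow> 1 / denom t \<le> c * (1 + t\<^sup>2) / t\<^sup>2"
proof
  show "(1 / a1 + 1) * (1 / a2 + 1) * 2 > 0" using a1 a2 by (simp add: add_pos_pos)
  fix t :: real assume t: "t > 0"
  \<comment> \<open>From exp(-u) \<le> 1/(1 + u) with u = at; the same bound serves both factors of
    \<open>denom\<close>.\<close>
  have *: "1 / (1 - exp (- a * t)) \<le> (1 / a + t) / t" if a: "a > 0" for a
  proof -
    have at: "a * t > 0" using a t by simp
    have "1 + a * t \<le> exp (a * t)" by (rule exp_ge_add_one_self)
    hence "exp (- (a * t)) \<le> 1 / (1 + a * t)"
      using at by (simp add: exp_minus field_simps)
    hence "a * t / (1 + a * t) \<le> 1 - exp (- (a * t))" using at by (simp add: field_simps)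
    moreover have "0 < a * t / (1 + a * t)" using at by simp
    ultimately have "1 / (1 - exp (- (a * t))) \<le> 1 / (a * t / (1 + a * t))"
      by (intro frac_le) auto
    also have "\<dots> = (1 / a + t) / t" using a t by (simp add: field_simps)
    finally show ?thesis by simp
  qed
  have "1 / denom t = 1 / (1 - exp (- a1 * t)) * (1 / (1 - exp (- a2 * t)))" by (simp add: denom_def)
  also have "\<dots> \<le> (1 / a1 + t) / t * ((1 / a2 + t) / t)"
    using a1 a2 t by (intro mult_mono *) auto
  also have "\<dots> = (1 / a1 + t) * (1 / a2 + t) / t\<^sup>2" by (simp add: power2_eq_square)
  also have "\<dots> \<le> ((1 / a1 + 1) * (1 + t)) * ((1 / a2 + 1) * (1 + t)) / t\<^sup>2"
    using a1 a2 t by (intro divide_right_mono mult_mono) (auto simp: field_simps)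
  also have "\<dots> = (1 / a1 + 1) * (1 / a2 + 1) * (1 + t)\<^sup>2 / t\<^sup>2" by (simp add: power2_eq_square)
  also have "\<dots> \<le> (1 / a1 + 1) * (1 / a2 + 1) * (2 * (1 + t\<^sup>2)) / t\<^sup>2"
  proof -
    have "(1 + t)\<^sup>2 \<le> 2 * (1 + t\<^sup>2)" using sum_squares_ge_zero[of "1 - t" 0] by (simp add: power2_eq_square algebra_simps)
    thus ?thesis using a1 a2 by (intro divide_right_mono mult_left_mono) auto
  qed
  finally show "1 / denom t \<le> (1 / a1 + 1) * (1 / a2 + 1) * 2 * (1 + t\<^sup>2) / t\<^sup>2" by (simp only: mult.assoc)
qed

lemma borel_measurable_kernel [measurable]: "kernel w \<in> borel_measurable borel"
  unfolding kernel_def denom_def by measurable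

lemma norm_kernel_le:
  assumes w: "Re w > 0"
  obtains C where "\<And>t. t > 0 \<Longrightarrow> norm (kernel w t) \<le> C * t powr (-2) * exp (- (Re w / 2) * t)"
proof -
  obtain K where K: "\<And>t. t > 0 \<Longrightarrow> 1 + t\<^sup>2 \<le> K * exp (Re w / 2 * t)" "K > 0"
    using poly_exp_bound[of "Re w / 2"] w by auto
  obtain c where c: "c > 0" "\<And>t. t > 0 \<Longrightarrow> 1 / denom t \<le> c * (1 + t\<^sup>2) / t\<^sup>2"
    by (rule inverse_denom_le) (rule that)
  have "norm (kernel w t) \<le> (c * K) * t powr (-2) * exp (- (Re w / 2) * t)" if t: "t > 0" for t
  proof -
    have "norm (kernel w t) = exp (- Re w * t) * (1 / denom t)"
      using denom_pos[OF t] by (simp add: kernel_def norm_divide)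
    also have "\<dots> \<le> exp (- Re w * t) * (c * (1 + t\<^sup>2) / t\<^sup>2)"
      by (intro mult_left_mono c t) auto
    also have "\<dots> = c * (exp (- Re w * t) * (1 + t\<^sup>2)) / t\<^sup>2" by simp
    also have "\<dots> \<le> c * (exp (- Re w * t) * (K * exp (Re w / 2 * t))) / t\<^sup>2"
      using c K(1)[OF t] by (intro divide_right_mono mult_left_mono) auto
    also have "exp (- Re w * t) * (K * exp (Re w / 2 * t)) = K * exp (- (Re w / 2) * t)"
      by (simp flip: exp_add)
    also have "t\<^sup>2 = inverse (t powr (-2))" using t powr_realpow[of t 2] by (simp add: powr_minus)
    also have "c * (K * exp (- (Re w / 2) * t)) / inverse (t powr (-2)) = (c * K) * t powr (-2) * exp (- (Re w / 2) * t)"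
      by (simp only: divide_inverse inverse_inverse_eq mult_ac)
    finally show ?thesis .
  qed
  thus ?thesis by (rule that)
qed

text \<open>Each term of the series is a Gamma integral. Summing the geometric series in both
  indices under the integral sign produces \<open>kernel\<close>, and Re s > 2 compensates its
  t^(-2) singularity.\<close>

lemma zeta_series_integral:
  assumes s: "Re s > 2" and w: "Re w > 0"
  shows "(\<Sum>\<^sub>\<infinity>(k1, k2) \<in> (UNIV :: (nat \<times> nat) set).
            (w + of_nat k1 * of_real a1 + of_nat k2 * of_real a2) powr (- s)) =
         rGamma s * (\<integral>t. exp ((s - 1) * of_real (ln t)) * kernel w t \<partial>lpos)"
proof -
  let ?C = "count_space (UNIV :: (nat \<times> nat) set)"
  define W where "W k = w + of_nat (fst k) * of_real a1 + of_nat (snd k) * of_real a2" for k :: "nat \<times> nat"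
  define E where "E t = exp ((s - 1) * complex_of_real (ln t))" for t :: real
  define f where "f p = E (fst p) * exp (- W (snd p) * of_real (fst p))" for p :: "real \<times> (nat \<times> nat)"
  define X1 X2 where "X1 t = complex_of_real (exp (- a1 * t))" and "X2 t = complex_of_real (exp (- a2 * t))" for t :: real
  interpret L: sigma_finite_measure lpos
    by (rule sigma_finite_measure_restrict_space) (auto intro: lborel.sigma_finite_measure_axioms)
  interpret C: sigma_finite_measure ?C by (rule sigma_finite_measure_count_space_countable) auto
  interpret P: pair_sigma_finite lpos ?C ..
  have [measurable]: "ln \<in> borel_measurable lpos" "(\<lambda>t. t) \<in> borel_measurable lpos"
    by (rule borel_measurable_lposI, simp)+
  have Wpos: "Re (W k) > 0" for k
    using w a1 a2 by (simp add: W_def add_pos_nonneg)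
  have geo: "Infinite_Set_Sum.abs_summable_on (\<lambda>k. X1 t ^ fst k * X2 t ^ snd k) UNIV"
    "infsetsum (\<lambda>k. X1 t ^ fst k * X2 t ^ snd k) UNIV = 1 / of_real (denom t)"
    "infsetsum (\<lambda>k. norm (X1 t ^ fst k * X2 t ^ snd k)) UNIV = 1 / denom t" if t: "t > 0" for t
  proof -
    have n: "norm (X1 t) < 1" "norm (X2 t) < 1" using a1 a2 t by (simp_all add: X1_def X2_def)
    show "Infinite_Set_Sum.abs_summable_on (\<lambda>k. X1 t ^ fst k * X2 t ^ snd k) UNIV"
      by (rule abs_summable_double_geometric[OF n])
    show "infsetsum (\<lambda>k. X1 t ^ fst k * X2 t ^ snd k) UNIV = 1 / of_real (denom t)"
      by (subst infsetsum_double_geometric[OF n]) (simp add: X1_def X2_def denom_def)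
    show "infsetsum (\<lambda>k. norm (X1 t ^ fst k * X2 t ^ snd k)) UNIV = 1 / denom t"
      using infsetsum_double_geometric[of "norm (X1 t)" "norm (X2 t)"] n
      by (simp add: norm_mult norm_power denom_def) (simp add: X1_def X2_def)
  qed
  have fE: "f (t, k) = E t * exp (- w * of_real t) * (X1 t ^ fst k * X2 t ^ snd k)" for t k
  proof -
    have X: "X1 t ^ m = exp (of_nat m * of_real (- a1 * t))" "X2 t ^ m = exp (of_nat m * of_real (- a2 * t))" for m
      by (simp_all only: X1_def X2_def exp_of_nat_mult exp_of_real)
    have "exp (- w * of_real t) * (X1 t ^ fst k * X2 t ^ snd k) = exp (- W k * of_real t)"
      unfolding X exp_add[symmetric] by (rule arg_cong[of _ _ exp]) (simp add: W_def algebra_simps)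
    thus ?thesis by (simp add: f_def mult.assoc)
  qed
  \<comment> \<open>The ratios \<open>X1 t\<close> and \<open>X2 t\<close> are positive reals, so
    the norms of the terms sum to the norm of the sum. Fubini thus needs only the integrability of
    the summed function.\<close>
  have Ct: "(\<integral>k. f (t, k) \<partial>?C) = E t * kernel w t"
    and In: "integrable ?C (\<lambda>k. f (t, k))"
    and Cn: "(\<integral>k. norm (f (t, k)) \<partial>?C) = norm (E t * kernel w t)" if t: "t > 0" for t
  proof -
    show "integrable ?C (\<lambda>k. f (t, k))"
      unfolding fE using geo(1)[OF t] unfolding abs_summable_on_def by (rule integrable_mult_right)
    show "(\<integral>k. f (t, k) \<partial>?C) = E t * kernel w t"
      unfolding fE using geo(2)[OF t] by (simp add: kernel_def infsetsum_def)
    show "(\<integral>k. norm (f (t, k)) \<partial>?C) = norm (E t * kernel w t)"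
      unfolding fE using geo(3)[OF t] denom_pos[OF t]
      by (simp add: norm_mult[of "E t * exp (- w * of_real t)"] kernel_def infsetsum_def norm_divide)
         (simp add: norm_mult)
  qed
  obtain C where C: "\<And>t. t > 0 \<Longrightarrow> norm (kernel w t) \<le> C * t powr (-2) * exp (- (Re w / 2) * t)"
    using norm_kernel_le[OF w] by blast
  have IK: "integrable lpos (\<lambda>t. E t * kernel w t)"
    unfolding E_def by (rule mellin_integrable[OF _ _ C]) (use s w in \<open>auto intro: borel_measurable_lposI\<close>)
  have IF: "integrable (lpos \<Otimes>\<^sub>M ?C) f"
  proof (rule P.Fubini_integrable)
    have [measurable]: "E \<in> borel_measurable lpos" unfolding E_def by measurable
    have m1: "(\<lambda>p. E (fst p)) \<in> borel_measurable (lpos \<Otimes>\<^sub>M ?C)"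
      by (rule measurable_compose[OF measurable_fst]) measurable
    have m2: "(\<lambda>p. fst p) \<in> borel_measurable (lpos \<Otimes>\<^sub>M ?C)"
      by (rule measurable_compose[OF measurable_fst]) measurable
    have "(\<lambda>p. E (fst p) * exp (- W k * of_real (fst p))) \<in> borel_measurable (lpos \<Otimes>\<^sub>M ?C)" for k
      using m1 m2 by measurable
    thus "f \<in> borel_measurable (lpos \<Otimes>\<^sub>M ?C)"
      unfolding f_def by (rule measurable_compose_countable[where f = "\<lambda>k p. E (fst p) * exp (- W k * of_real (fst p))", OF _ measurable_snd])
    have "integrable lpos (\<lambda>t. norm (E t * kernel w t))" by (rule integrable_norm[OF IK])
    thus "integrable lpos (\<lambda>t. \<integral>k. norm (f (t, k)) \<partial>?C)"
      by (rule Bochner_Integration.integrable_cong[THEN iffD1, rotated 2]) (simp_all add: Cn)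
    show "AE t in lpos. integrable ?C (\<lambda>k. f (t, k))" by (intro AE_I2 In) simp
  qed
  have Wk: "W k powr (- s) = rGamma s * (\<integral>t. f (t, k) \<partial>lpos)" for k
  proof -
    have "s \<notin> \<int>\<^sub>\<le>\<^sub>0" using s by (auto elim!: nonpos_Ints_cases)
    hence "rGamma s * Gamma s = 1" by (simp add: rGamma_inverse_Gamma Gamma_eq_zero_iff)
    thus ?thesis using Gamma_kernel[of s "W k"] s Wpos[of k] by (simp add: f_def E_def)
  qed
  have "integrable ?C (\<lambda>k. \<integral>t. f (t, k) \<partial>lpos)" by (rule P.integrable_snd) (use IF in simp)
  hence summ: "Infinite_Set_Sum.abs_summable_on (\<lambda>k. rGamma s * (\<integral>t. f (t, k) \<partial>lpos)) UNIV"
    unfolding abs_summable_on_def by (rule integrable_mult_right)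
  have "(\<Sum>\<^sub>\<infinity>k. W k powr (- s)) = infsetsum (\<lambda>k. rGamma s * (\<integral>t. f (t, k) \<partial>lpos)) UNIV"
    using summ by (simp add: Wk infsetsum_infsum)
  also have "\<dots> = rGamma s * (\<integral>k. (\<integral>t. f (t, k) \<partial>lpos) \<partial>?C)"
    by (simp add: infsetsum_def)
  also have "(\<integral>k. (\<integral>t. f (t, k) \<partial>lpos) \<partial>?C) = (\<integral>t. (\<integral>k. f (t, k) \<partial>?C) \<partial>lpos)"
    by (rule P.Fubini_integral) (use IF in simp)
  also have "\<dots> = (\<integral>t. E t * kernel w t \<partial>lpos)"
    by (intro Bochner_Integration.integral_cong refl Ct) simp
  finally show ?thesis by (simp add: W_def E_def case_prod_unfold)
qed

section \<open>Taylor remainders of the kernel and the continuation in s\<close>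

text \<open>
  The n-th Taylor quotient at 0 of $z^2/((1-e^{-a_1z})(1-e^{-a_2z}))$; its value at 0 is the n-th
  Taylor coefficient.
\<close>
primrec Phi :: "nat \<Rightarrow> complex \<Rightarrow> complex" where
  "Phi 0 = (\<lambda>z. if z = 0 then 1 / (of_real a1 * of_real a2) else
     z\<^sup>2 / ((1 - exp (- of_real a1 * z)) * (1 - exp (- of_real a2 * z))))"
| "Phi (Suc n) = (\<lambda>z. if z = 0 then deriv (Phi n) 0 else (Phi n z - Phi n 0) / z)"

text \<open>One radius serves all n. It is chosen for \<open>Phi 0\<close>, so that the two entire
  functions (1 - exp(-az))/z have no zero in the disc; forming a Taylor quotient preserves
  holomorphy there.\<close>

lemma Phi_holomorphic: obtains r where "r > 0" "\<And>n. Phi n holomorphic_on ball 0 r"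
proof -
  define E where "E a z = (if z = 0 then a else (1 - exp (- a * z)) / z)" for a z :: complex
  let ?E = "\<lambda>z. E (of_real a1) z * E (of_real a2) z"
  have E: "?E holomorphic_on UNIV"
    unfolding E_def by (intro holomorphic_on_mult holomorphic_one_minus_exp_quotient)
  hence "isCont ?E 0" using holomorphic_on_imp_continuous_on continuous_on_eq_continuous_at[OF open_UNIV] by blast
  moreover have "?E 0 \<noteq> 0" using a1 a2 by (simp add: E_def)
  ultimately obtain r where r: "r > 0" "\<And>z. dist 0 z < r \<Longrightarrow> ?E z \<noteq> 0"
    using continuous_at_avoid[of 0 ?E 0] by blast
  have "Phi n holomorphic_on ball 0 r" for n
  proof (induction n)
    case 0
    have "(\<lambda>z. 1 / ?E z) holomorphic_on ball 0 r"
      using r by (intro holomorphic_intros holomorphic_on_subset[OF E]) (auto simp: dist_commute)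
    also have "(\<lambda>z. 1 / ?E z) = Phi 0"
      by (auto simp: E_def fun_eq_iff power2_eq_square)
    finally show ?case .
  next
    case (Suc n)
    from pole_lemma_open[OF Suc open_ball, of 0] show ?case unfolding Phi.simps diff_zero .
  qed
  thus ?thesis using r(1) that by blast
qed

lemma borel_measurable_Phi [measurable]: "(\<lambda>t::real. Phi n (of_real t)) \<in> borel_measurable borel"
proof (induction n)
  case 0
  show ?case unfolding Phi.simps by measurable
next
  case (Suc n)
  note [measurable] = Suc
  show ?case unfolding Phi.simps by measurable
qed

text \<open>Near 0 the new quotient is bounded by compactness. Away from 0 the division by t costs
  only a constant, so the growth of \<open>Phi 0\<close> is inherited by every n.\<close>

lemma Phi_bound: obtains C where "\<And>t. t > 0 \<Longrightarrow> norm (Phi n (of_real t)) \<le> C * (1 + t\<^sup>2)"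
proof -
  have "\<exists>C. \<forall>t>0. norm (Phi n (of_real t)) \<le> C * (1 + t\<^sup>2)"
  proof (induction n)
    case 0
    obtain c where c: "c > 0" "\<And>t. t > 0 \<Longrightarrow> 1 / denom t \<le> c * (1 + t\<^sup>2) / t\<^sup>2"
      by (rule inverse_denom_le) (rule that)
    have "norm (Phi 0 (of_real t)) \<le> c * (1 + t\<^sup>2)" if t: "t > 0" for t
    proof -
      have "Phi 0 (of_real t) = of_real (t\<^sup>2 / denom t)"
        using t by (simp add: denom_def exp_of_real[symmetric])
      hence "norm (Phi 0 (of_real t)) = t\<^sup>2 * (1 / denom t)"
        using denom_pos[OF t] by (simp only: norm_of_real) simp
      also have "\<dots> \<le> t\<^sup>2 * (c * (1 + t\<^sup>2) / t\<^sup>2)"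
        by (intro mult_left_mono c t) auto
      also have "\<dots> = c * (1 + t\<^sup>2)" using t by simp
      finally show ?thesis .
    qed
    thus ?case by blast
  next
    case (Suc n)
    then obtain C where C: "\<And>t. t > 0 \<Longrightarrow> norm (Phi n (of_real t)) \<le> C * (1 + t\<^sup>2)" by blast
    obtain r where r: "r > 0" "\<And>n. Phi n holomorphic_on ball 0 r" by (rule Phi_holomorphic) blast
    have "compact (Phi (Suc n) ` cball 0 (r / 2))"
      using r by (intro compact_continuous_image compact_cball holomorphic_on_imp_continuous_on holomorphic_on_subset[OF r(2)]) auto
    from compact_imp_bounded[OF this] obtain B
      where B: "\<And>z. z \<in> cball 0 (r / 2) \<Longrightarrow> norm (Phi (Suc n) z) \<le> B"
      unfolding bounded_iff by blast
    have B0: "B \<ge> 0" using order_trans[OF norm_ge_zero B[of 0]] r by simp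
    have C0: "C \<ge> 0" using order_trans[OF norm_ge_zero C[of 1]] by simp
    define C' where "C' = (C + norm (Phi n 0)) / (r / 2)"
    have C'0: "C' \<ge> 0" using r C0 by (simp add: C'_def)
    have "norm (Phi (Suc n) (of_real t)) \<le> (B + C') * (1 + t\<^sup>2)" if t: "t > 0" for t
    proof (cases "t \<le> r / 2")
      case True
      hence "norm (Phi (Suc n) (of_real t)) \<le> B" using t by (intro B) auto
      also have "\<dots> \<le> (B + C') * 1" using C'0 by simp
      also have "\<dots> \<le> (B + C') * (1 + t\<^sup>2)" using C'0 B0 by (intro mult_left_mono) auto
      finally show ?thesis .
    next
      case False
      have 1: "norm (Phi n 0) \<le> norm (Phi n 0) * (1 + t\<^sup>2)" by (simp add: mult_le_cancel_left1)
      have "norm (Phi (Suc n) (of_real t)) = norm (Phi n (of_real t) - Phi n 0) / t"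
        using t by (simp add: norm_divide)
      also have "\<dots> \<le> (C * (1 + t\<^sup>2) + norm (Phi n 0) * (1 + t\<^sup>2)) / (r / 2)"
      proof (rule frac_le)
        show "norm (Phi n (of_real t) - Phi n 0) \<le> C * (1 + t\<^sup>2) + norm (Phi n 0) * (1 + t\<^sup>2)"
          using C[OF t] 1 norm_triangle_ineq4[of "Phi n (of_real t)" "Phi n 0"] by linarith
        show "0 \<le> C * (1 + t\<^sup>2) + norm (Phi n 0) * (1 + t\<^sup>2)" using C0 by simp
      qed (use False r(1) in auto)
      also have "\<dots> = C' * (1 + t\<^sup>2)" by (simp add: C'_def algebra_simps add_divide_distrib)
      also have "\<dots> \<le> (B + C') * (1 + t\<^sup>2)" using B0 by (intro mult_right_mono) auto
      finally show ?thesis .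
    qed
    thus ?case by blast
  qed
  thus ?thesis using that by blast
qed

text \<open>Since \<open>Phi 0\<close> is t^2/\<open>denom\<close>, the factor t^(N-2)
  \<open>Phi N\<close> is 1/\<open>denom\<close> minus the first N terms \<open>Phi k 0\<close>
  t^(k-2) of its Laurent expansion at 0.\<close>

definition remainder :: "nat \<Rightarrow> complex \<Rightarrow> real \<Rightarrow> complex" where
  "remainder N w t = exp (- w * of_real t) * of_real (t powr (real N - 2)) * Phi N (of_real t)"

definition mellin_remainder :: "nat \<Rightarrow> complex \<Rightarrow> complex \<Rightarrow> complex" where
  "mellin_remainder N w s = (\<integral>t. exp ((s - 1) * of_real (ln t)) * remainder N w t \<partial>lpos)"

lemma remainder_measurable: "remainder N w \<in> borel_measurable lpos"
  unfolding remainder_def by (rule borel_measurable_lposI) measurable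

lemma remainder_bound:
  assumes w: "Re w > 0"
  obtains C where "\<And>t. t > 0 \<Longrightarrow> norm (remainder N w t) \<le> C * t powr (real N - 2) * exp (- (Re w / 2) * t)"
proof -
  obtain K where K: "\<And>t. t > 0 \<Longrightarrow> 1 + t\<^sup>2 \<le> K * exp (Re w / 2 * t)" "K > 0"
    using poly_exp_bound[of "Re w / 2"] w by auto
  obtain C where C: "\<And>t. t > 0 \<Longrightarrow> norm (Phi N (of_real t)) \<le> C * (1 + t\<^sup>2)" using Phi_bound by metis
  have C0: "C \<ge> 0" using order_trans[OF norm_ge_zero C[of 1]] by simp
  have "norm (remainder N w t) \<le> (C * K) * t powr (real N - 2) * exp (- (Re w / 2) * t)" if t: "t > 0" for t
  proof -
    have "norm (remainder N w t) = exp (- Re w * t) * t powr (real N - 2) * norm (Phi N (of_real t))"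
      by (simp add: remainder_def norm_mult)
    also have "\<dots> \<le> exp (- Re w * t) * t powr (real N - 2) * (C * (K * exp (Re w / 2 * t)))"
      using order_trans[OF C[OF t] mult_left_mono[OF K(1)[OF t] C0]] by (intro mult_left_mono) auto
    also have "\<dots> = (C * K) * t powr (real N - 2) * (exp (- Re w * t) * exp (Re w / 2 * t))" by (simp only: mult_ac)
    also have "exp (- Re w * t) * exp (Re w / 2 * t) = exp (- (Re w / 2) * t)"
      by (simp flip: exp_add)
    finally show ?thesis .
  qed
  thus ?thesis by (rule that)
qed

lemma mellin_remainder_holomorphic:
  assumes w: "Re w > 0"
  shows "mellin_remainder N w holomorphic_on {s. Re s > 2 - real N}"
proof -
  obtain C where "\<And>t. t > 0 \<Longrightarrow> norm (remainder N w t) \<le> C * t powr (real N - 2) * exp (- (Re w / 2) * t)"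
    using remainder_bound[OF w] by metis
  from mellin_holomorphic[OF remainder_measurable _ this] w show ?thesis by (simp add: mellin_remainder_def[abs_def])
qed

lemma mellin_remainder_integrable:
  assumes w: "Re w > 0" and s: "Re s > 2 - real N"
  shows "integrable lpos (\<lambda>t. exp ((s - 1) * of_real (ln t)) * remainder N w t)"
proof -
  obtain C where "\<And>t. t > 0 \<Longrightarrow> norm (remainder N w t) \<le> C * t powr (real N - 2) * exp (- (Re w / 2) * t)"
    using remainder_bound[OF w] by metis
  from mellin_integrable[OF remainder_measurable _ this] w s show ?thesis by simp
qed

lemma mellin_remainder_0: "mellin_remainder 0 w s = (\<integral>t. exp ((s - 1) * of_real (ln t)) * kernel w t \<partial>lpos)"
  unfolding mellin_remainder_def
proof (intro Bochner_Integration.integral_cong refl arg_cong2[where f = "(*)"])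
  fix t assume "t \<in> space lpos"
  hence t: "t > 0" by simp
  have "t powr (- 2) = 1 / t\<^sup>2" using t powr_realpow[of t 2] by (simp add: powr_minus divide_inverse)
  thus "remainder 0 w t = kernel w t"
    using t by (simp add: remainder_def kernel_def denom_def exp_of_real[symmetric])
qed

text \<open>One more Laurent term is split off. Multiplied by exp(-wt) it is a Gamma integrand,
  convergent exactly while Re s > 2 - N.\<close>

lemma mellin_remainder_Suc:
  assumes w: "Re w > 0" and s: "Re s > 2 - real N"
  shows "mellin_remainder N w s = Phi N 0 * (Gamma (s - 2 + of_nat N) * w powr (2 - of_nat N - s)) + mellin_remainder (Suc N) w s"
proof -
  let ?g = "\<lambda>t. exp ((s - 2 + of_nat N - 1) * of_real (ln t)) * exp (- w * of_real t)"
  have eq: "exp ((s - 1) * of_real (ln t)) * remainder N w t =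
      Phi N 0 * ?g t + exp ((s - 1) * of_real (ln t)) * remainder (Suc N) w t" if t: "t > 0" for t
  proof -
    have p: "exp ((s - 1) * of_real (ln t)) * complex_of_real (t powr (real N - 2)) = exp ((s - 2 + of_nat N - 1) * of_real (ln t))"
    proof -
      have "complex_of_real (t powr (real N - 2)) = exp ((of_nat N - 2) * of_real (ln t))"
        using t by (simp add: powr_def exp_of_real[symmetric])
      thus ?thesis by (simp only: exp_add[symmetric]) (rule arg_cong[of _ _ exp], simp add: algebra_simps)
    qed
    have t1: "t powr (real (Suc N) - 2) = t powr (real N - 2) * t"
      using t powr_add[of t "real N - 2" 1] by (simp add: algebra_simps)
    have "Phi N (of_real t) = Phi N 0 + of_real t * Phi (Suc N) (of_real t)" using t by simp
    hence "remainder N w t = Phi N 0 * (exp (- w * of_real t) * of_real (t powr (real N - 2))) + remainder (Suc N) w t"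
      unfolding remainder_def t1 by (simp only: of_real_mult distrib_left mult_ac)
    thus ?thesis unfolding p[symmetric] by (simp only: distrib_left mult_ac)
  qed
  have s': "Re (s - 2 + of_nat N) > 0" using s by simp
  have ir: "integrable lpos (\<lambda>t. exp ((s - 1) * of_real (ln t)) * remainder (Suc N) w t)"
    using s by (intro mellin_remainder_integrable w) simp
  have "?g \<in> borel_measurable lpos" by (rule borel_measurable_lposI) measurable
  have ig: "integrable lpos ?g"
    using s' w by (intro mellin_integrable[where a = 0 and C = 1 and x = "Re w"])
      (auto intro!: borel_measurable_lposI)
  have "mellin_remainder N w s = (\<integral>t. (Phi N 0 * ?g t + exp ((s - 1) * of_real (ln t)) * remainder (Suc N) w t) \<partial>lpos)"
    unfolding mellin_remainder_def by (intro Bochner_Integration.integral_cong refl eq) simp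
  also have "\<dots> = Phi N 0 * (\<integral>t. ?g t \<partial>lpos) + mellin_remainder (Suc N) w s"
    unfolding mellin_remainder_def by (subst Bochner_Integration.integral_add) (use ir ig in simp_all)
  also have "(\<integral>t. ?g t \<partial>lpos) = Gamma (s - 2 + of_nat N) * w powr (2 - of_nat N - s)"
    unfolding Gamma_kernel[OF s' w] by (simp add: algebra_simps)
  finally show ?thesis .
qed

text \<open>The Gamma terms are meromorphic on the whole plane, so this continues the Mellin
  integral to Re s > 2 - N.\<close>

definition mellin_partial :: "nat \<Rightarrow> complex \<Rightarrow> complex \<Rightarrow> complex" where
  "mellin_partial N w s = (\<Sum>k<N. Phi k 0 * (Gamma (s - 2 + of_nat k) * w powr (2 - of_nat k - s))) + mellin_remainder N w s"

lemma mellin_partial_mono: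
  assumes w: "Re w > 0" and s: "Re s > 2 - real N" and M: "N \<le> M"
  shows "mellin_partial M w s = mellin_partial N w s"
  using M
proof (induction M rule: dec_induct)
  case (step n)
  hence "Re s > 2 - real n" using s by simp
  hence "mellin_partial (Suc n) w s = mellin_partial n w s" using mellin_remainder_Suc[OF w, of n s] by (simp add: mellin_partial_def)
  thus ?case using step by simp
qed simp

text \<open>
  Every index N with Re s > 2 - N gives the same value, even at the poles of the Gamma factors,
  where Gamma is 0 by convention. Hence no gluing along punctured neighbourhoods is needed.
\<close>
definition mellin_extension :: "complex \<Rightarrow> complex \<Rightarrow> complex" where
  "mellin_extension w s = mellin_partial (nat \<lceil>3 - Re s\<rceil>) w s"

lemma mellin_extension_eq:
  assumes w: "Re w > 0" and s: "Re s > 2 - real N"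
  shows "mellin_extension w s = mellin_partial N w s"
proof -
  define M where "M = nat \<lceil>3 - Re s\<rceil>"
  have "real M \<ge> 3 - Re s" unfolding M_def by linarith
  hence "Re s > 2 - real M" by simp
  hence "mellin_partial (max M N) w s = mellin_partial M w s" "mellin_partial (max M N) w s = mellin_partial N w s"
    using s by (auto intro!: mellin_partial_mono w)
  thus ?thesis by (simp add: mellin_extension_def M_def)
qed

text \<open>The index in \<open>mellin_extension\<close> jumps with Re s, so around each point it is
  replaced by one fixed N that is valid on an open half-plane containing the point.\<close>

lemma mellin_extension_meromorphic:
  assumes w: "Re w > 0"
  shows "mellin_extension w meromorphic_on UNIV"
proof (subst meromorphic_on_meromorphic_at, intro ballI)
  fix z :: complex
  define N where "N = nat \<lceil>3 - Re z\<rceil>"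
  define S where "S = {s. Re s > 2 - real N}"
  have "real N \<ge> 3 - Re z" unfolding N_def by linarith
  hence S: "open S" "z \<in> S" unfolding S_def by (simp_all add: open_halfspace_Re_gt)
  have w0: "w \<noteq> 0" using w by auto
  have hm: "f meromorphic_on S" if "f holomorphic_on S" for f
    using that S(1) by (intro analytic_on_imp_meromorphic_on) (simp add: analytic_on_open)
  have "(\<lambda>s. Phi k 0 * (Gamma (s - 2 + of_nat k) * w powr (2 - of_nat k - s))) meromorphic_on S" for k
  proof -
    have "(\<lambda>s. rGamma (s - 2 + of_nat k)) meromorphic_on S"
      by (intro hm holomorphic_intros)
    moreover have "(\<lambda>s. w powr (2 - of_nat k - s)) meromorphic_on S"
      using w0 by (intro hm holomorphic_intros)
    ultimately show ?thesis unfolding Gamma_def by (intro meromorphic_intros)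
  qed
  moreover have "mellin_remainder N w meromorphic_on S"
    using mellin_remainder_holomorphic[OF w, of N] by (intro hm) (simp add: S_def)
  ultimately have "mellin_partial N w meromorphic_on S"
    unfolding mellin_partial_def[abs_def] by (intro meromorphic_on_add meromorphic_on_sum)
  moreover have "mellin_extension w meromorphic_on S \<longleftrightarrow> mellin_partial N w meromorphic_on S"
  proof (rule meromorphic_on_cong)
    fix s assume "s \<in> S"
    hence "\<forall>\<^sub>F t in at s. t \<in> S" using S(1) by (intro eventually_at_in_open') auto
    thus "\<forall>\<^sub>F t in at s. mellin_extension w t = mellin_partial N w t"
      by eventually_elim (simp add: mellin_extension_eq w S_def)
  qed simp
  ultimately have "mellin_extension w meromorphic_on S" by blast
  thus "mellin_extension w meromorphic_on {z}" by (rule meromorphic_on_subset) (use S in simp)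
qed

text \<open>The expansion multiplied by \<open>rGamma s\<close>, with the Gamma quotients
  simplified: the singularity at 0 is gone and only 1 and 2 are left. Three Laurent terms are the
  fewest whose remainder converges at s = 0.\<close>

definition zeta_near :: "complex \<Rightarrow> complex \<Rightarrow> complex" where
  "zeta_near w s = Phi 0 0 * (w powr (2 - s) / ((s - 1) * (s - 2))) + Phi 1 0 * (w powr (1 - s) / (s - 1))
     + Phi 2 0 * w powr (- s) + rGamma s * mellin_remainder 3 w s"

abbreviation near_domain :: "complex set" where
  "near_domain \<equiv> {s. Re s > -1} - {1, 2}"

lemma open_near_domain: "open near_domain"
  by (intro open_Diff open_halfspace_Re_gt) auto

lemma zeta_near_holomorphic:
  assumes w: "Re w > 0"
  shows "zeta_near w holomorphic_on near_domain"
proof -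
  have w0: "w \<noteq> 0" using w by auto
  have "mellin_remainder 3 w holomorphic_on near_domain"
    using mellin_remainder_holomorphic[OF w, of 3] by (rule holomorphic_on_subset) auto
  thus ?thesis unfolding zeta_near_def[abs_def] using w0
    by (intro holomorphic_intros) auto
qed

lemma mellin_extension_near:
  assumes w: "Re w > 0" and s: "Re s > -1" "s \<noteq> 0" "s \<noteq> 1" "s \<noteq> 2"
  shows "rGamma s * mellin_extension w s = zeta_near w s"
proof -
  have "mellin_extension w s = mellin_partial 3 w s" using s by (intro mellin_extension_eq w) simp
  also have "\<dots> = Phi 0 0 * (Gamma (s - 2) * w powr (2 - s)) + Phi 1 0 * (Gamma (s - 1) * w powr (1 - s))
      + Phi 2 0 * (Gamma s * w powr (- s)) + mellin_remainder 3 w s"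
    by (simp add: mellin_partial_def eval_nat_numeral)
  finally have "rGamma s * mellin_extension w s = Phi 0 0 * ((rGamma s * Gamma (s - 2)) * w powr (2 - s)) +
      Phi 1 0 * ((rGamma s * Gamma (s - 1)) * w powr (1 - s)) +
      Phi 2 0 * ((rGamma s * Gamma s) * w powr (- s)) + rGamma s * mellin_remainder 3 w s"
    by (simp only: distrib_left mult_ac)
  thus ?thesis unfolding rGamma_mult_Gamma_shift[OF s] zeta_near_def by simp
qed

text \<open>\<open>remove_sings\<close> is essential for the value at 0: the plain product is 0
  there because \<open>rGamma\<close> vanishes, while its limit is the value of the zeta
  function.\<close>

lemma barnes_zeta2_eq_remove_sings:
  assumes w: "Re w > 0"
  shows "barnes_zeta2 a1 a2 w = remove_sings (\<lambda>s. rGamma s * mellin_extension w s)"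
  unfolding barnes_zeta2_def
proof (rule the_equality)
  let ?Z = "remove_sings (\<lambda>s. rGamma s * mellin_extension w s)"
  have mero: "(\<lambda>s. rGamma s * mellin_extension w s) meromorphic_on UNIV"
    by (intro meromorphic_on_mult mellin_extension_meromorphic w analytic_on_imp_meromorphic_on)
       (auto simp: analytic_on_open intro: holomorphic_intros)
  have series: "?Z s = (\<Sum>\<^sub>\<infinity>(k1, k2) \<in> (UNIV :: (nat \<times> nat) set).
                 (w + of_nat k1 * of_real a1 + of_nat k2 * of_real a2) powr (- s))" if s: "Re s > 2" for s
  proof -
    let ?S = "{s. Re s > 2}"
    have "mellin_extension w holomorphic_on ?S"
    proof (rule holomorphic_transform)
      show "mellin_remainder 0 w holomorphic_on ?S" using mellin_remainder_holomorphic[OF w, of 0] by simp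
      show "mellin_remainder 0 w z = mellin_extension w z" if "z \<in> ?S" for z
        using mellin_extension_eq[OF w, of 0 z] that by (simp add: mellin_partial_def)
    qed
    hence "(\<lambda>s. rGamma s * mellin_extension w s) holomorphic_on ?S" by (intro holomorphic_intros)
    hence "(\<lambda>s. rGamma s * mellin_extension w s) analytic_on ?S" by (simp add: analytic_on_open open_halfspace_Re_gt)
    hence "(\<lambda>s. rGamma s * mellin_extension w s) analytic_on {s}" using s by (auto intro: analytic_on_subset)
    hence "?Z s = rGamma s * mellin_extension w s" by simp
    also have "mellin_extension w s = mellin_remainder 0 w s" using mellin_extension_eq[OF w, of 0 s] s by (simp add: mellin_partial_def)
    finally show ?thesis by (simp add: mellin_remainder_0 zeta_series_integral[OF s w])
  qed
  show "?Z nicely_meromorphic_on UNIV \<and>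
     (\<forall>s. Re s > 2 \<longrightarrow> ?Z s = (\<Sum>\<^sub>\<infinity>(k1, k2) \<in> (UNIV :: (nat \<times> nat) set).
                 (w + of_nat k1 * of_real a1 + of_nat k2 * of_real a2) powr (- s)))"
    using series remove_sings_nicely_meromorphic[OF mero] by auto
  fix f assume f: "f nicely_meromorphic_on UNIV \<and>
     (\<forall>s. Re s > 2 \<longrightarrow> f s = (\<Sum>\<^sub>\<infinity>(k1, k2) \<in> (UNIV :: (nat \<times> nat) set).
                 (w + of_nat k1 * of_real a1 + of_nat k2 * of_real a2) powr (- s)))"
  have "(3::complex) \<in> {s. Re s > 2}" by simp
  hence "{s. Re s > 2} \<noteq> {}" by blast
  thus "f = ?Z" using f series remove_sings_nicely_meromorphic[OF mero]
    by (intro nicely_meromorphic_unique[where S = "{s. Re s > 2}"]) (auto simp: open_halfspace_Re_gt)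
qed

lemma barnes_zeta2_near:
  assumes w: "Re w > 0" and s: "s \<in> near_domain"
  shows "barnes_zeta2 a1 a2 w s = zeta_near w s"
  unfolding barnes_zeta2_eq_remove_sings[OF w]
proof (rule remove_sings_eqI)
  have "isCont (zeta_near w) s"
    using holomorphic_on_imp_continuous_on[OF zeta_near_holomorphic[OF w]] s open_near_domain
    by (simp only: continuous_on_eq_continuous_at)
  hence "zeta_near w \<midarrow>s\<rightarrow> zeta_near w s" by (rule isContD)
  moreover have "\<forall>\<^sub>F t in at s. zeta_near w t = rGamma t * mellin_extension w t"
  proof (rule eventually_mono)
    show "\<forall>\<^sub>F t in at s. t \<in> near_domain \<and> t \<noteq> 0"
      by (intro eventually_conj eventually_at_in_open'[OF open_near_domain s] eventually_neq_at_within)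
  qed (simp add: mellin_extension_near[OF w])
  ultimately show "(\<lambda>s. rGamma s * mellin_extension w s) \<midarrow>s\<rightarrow> zeta_near w s"
    by (rule Lim_transform_eventually)
qed

lemma barnes_zeta2_holomorphic:
  assumes w: "Re w > 0"
  shows "barnes_zeta2 a1 a2 w holomorphic_on near_domain"
  using zeta_near_holomorphic[OF w] by (rule holomorphic_transform) (simp add: barnes_zeta2_near[OF w])

lemma barnes_zeta2_integral:
  assumes w: "Re w > 0" and s: "Re s > 2"
  shows "barnes_zeta2 a1 a2 w s = rGamma s * (\<integral>t. exp ((s - 1) * of_real (ln t)) * kernel w t \<partial>lpos)"
proof -
  have ne: "s \<noteq> 0" "s \<noteq> 1" "s \<noteq> 2" using s by auto
  have "barnes_zeta2 a1 a2 w s = rGamma s * mellin_extension w s"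
    using s ne by (subst barnes_zeta2_near[OF w]) (auto simp: mellin_extension_near[OF w])
  also have "mellin_extension w s = mellin_remainder 0 w s" using mellin_extension_eq[OF w, of 0 s] s by (simp add: mellin_partial_def)
  finally show ?thesis by (simp add: mellin_remainder_0)
qed

lemma Phi_1_0: "Phi 1 0 = of_real ((a1 + a2) / (2 * a1 * a2))"
proof -
  obtain r where r: "r > 0" "\<And>n. Phi n holomorphic_on ball 0 r" by (rule Phi_holomorphic) blast
  define d where "d = deriv (Phi 0) 0"
  have d: "(Phi 0 has_field_derivative d) (at 0)"
    unfolding d_def using r by (intro holomorphic_derivI[OF r(2)[of 0]]) auto
  \<comment> \<open>Differentiating this reflection formula at 0 yields the first Taylor coefficient.\<close>
  have refl_eq: "Phi 0 (- z) = exp (- of_real (a1 + a2) * z) * Phi 0 z" for z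
  proof (cases "z = 0")
    case False
    have *: "1 - exp (c * z) = - exp (c * z) * (1 - exp (- c * z))" for c
      by (simp add: algebra_simps flip: exp_add)
    have "Phi 0 (- z) = z\<^sup>2 / ((1 - exp (of_real a1 * z)) * (1 - exp (of_real a2 * z)))"
      using False by (simp add: Phi.simps)
    also have "\<dots> = z\<^sup>2 / ((exp (of_real a1 * z) * exp (of_real a2 * z)) *
        ((1 - exp (- of_real a1 * z)) * (1 - exp (- of_real a2 * z))))"
      by (subst (1 2) *) (simp add: mult_ac)
    also have "\<dots> = exp (- of_real (a1 + a2) * z) * Phi 0 z"
    proof -
      have "exp (- of_real (a1 + a2) * z) = inverse (exp (of_real a1 * z) * exp (of_real a2 * z))"
        unfolding exp_add[symmetric] exp_minus[symmetric] by (rule arg_cong[of _ _ exp]) (simp add: algebra_simps)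
      thus ?thesis using False by (simp add: Phi.simps divide_inverse)
    qed
    finally show ?thesis .
  qed (simp add: Phi.simps)
  have "((\<lambda>z. Phi 0 (- z)) has_field_derivative (d * (-1))) (at 0)"
    by (rule DERIV_chain2[where f = "Phi 0" and g = uminus]) (use d in \<open>auto intro!: derivative_eq_intros\<close>)
  moreover have "((\<lambda>z. Phi 0 (- z)) has_field_derivative (- of_real (a1 + a2) * Phi 0 0 + d)) (at 0)"
    unfolding refl_eq using d by (auto intro!: derivative_eq_intros)
  ultimately have "d * (-1) = - of_real (a1 + a2) * Phi 0 0 + d" by (rule DERIV_unique)
  hence "2 * d = of_real (a1 + a2) * Phi 0 0" by algebra
  hence "d = of_real ((a1 + a2) / (2 * a1 * a2))" using a1 a2 by (simp add: Phi.simps field_simps)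
  thus ?thesis by (simp add: d_def Phi.simps)
qed

text \<open>The remainder drops out because \<open>rGamma\<close> vanishes at 0, which leaves the
  contributions of the three Laurent terms. The constant \<open>Phi 2 0\<close> cancels when two
  values are subtracted.\<close>

lemma barnes_zeta2_0:
  assumes w: "Re w > 0"
  shows "barnes_zeta2 a1 a2 w 0 =
    w\<^sup>2 / (2 * of_real (a1 * a2)) - of_real (a1 + a2) / (2 * of_real (a1 * a2)) * w + Phi 2 0"
proof -
  have w0: "w \<noteq> 0" using w by auto
  have "barnes_zeta2 a1 a2 w 0 = zeta_near w 0" by (rule barnes_zeta2_near[OF w]) simp
  also have "\<dots> = Phi 0 0 * (w\<^sup>2 / 2) - Phi 1 0 * w + Phi 2 0"
    using w0 by (simp add: zeta_near_def power2_eq_square powr_nat)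
  also have "Phi 0 0 = 1 / of_real (a1 * a2)" by (simp add: Phi.simps)
  finally show ?thesis unfolding Phi_1_0 by (simp add: divide_simps)
qed

section \<open>The double gamma function\<close>

lemma connected_near_domain: "connected near_domain"
proof -
  have "connected ({s. Re s > -1} - {1, 2})"
    by (rule connected_open_delete_finite)
       (auto simp: open_halfspace_Re_gt intro!: convex_connected convex_halfspace_Re_gt)
  thus ?thesis .
qed

text \<open>Carries identities from the region where the integrals converge to s = 0, where values
  and derivatives are taken.\<close>

lemma near_domain_eqI:
  assumes f: "f holomorphic_on near_domain" and g: "g holomorphic_on near_domain"
    and eq: "\<And>s. Re s > 2 \<Longrightarrow> f s = g s" and s: "s \<in> near_domain"
  shows "f s = g s"
proof (rule analytic_continuation_open[of "{s. Re s > 2}" near_domain f g])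
  have "(3::complex) \<in> {s. Re s > 2}" by simp
  thus "{s. Re s > 2} \<noteq> {}" by blast
qed (use f g eq s open_near_domain connected_near_domain in \<open>auto simp: open_halfspace_Re_gt\<close>)

lemma zero_in_near_domain: "0 \<in> near_domain" by simp

text \<open>rGamma has a simple zero with derivative 1 at 0.\<close>
lemma mellin_deriv_0:
  assumes Z: "Z holomorphic_on near_domain" and F: "F \<in> borel_measurable lpos" and x: "x > 0"
    and bd: "\<And>t. t > 0 \<Longrightarrow> norm (F t) \<le> C * t powr 1 * exp (- x * t)"
    and eq: "\<And>s. Re s > 2 \<Longrightarrow> Z s = rGamma s * (\<integral>t. exp ((s - 1) * of_real (ln t)) * F t \<partial>lpos)"
  shows "deriv Z 0 = (\<integral>t. F t / of_real t \<partial>lpos)"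
proof -
  define J where "J s = (\<integral>t. exp ((s - 1) * of_real (ln t)) * F t \<partial>lpos)" for s
  have J: "J holomorphic_on {s. Re s > -1}"
    unfolding J_def[abs_def] by (rule mellin_holomorphic[OF F x bd])
  hence J': "J holomorphic_on near_domain" by (rule holomorphic_on_subset) auto
  have ZJ: "Z s = rGamma s * J s" if "s \<in> near_domain" for s
  proof (rule near_domain_eqI[OF Z _ _ that])
    show "(\<lambda>s. rGamma s * J s) holomorphic_on near_domain" by (intro holomorphic_intros J')
  qed (simp add: eq J_def)
  have "(J has_field_derivative deriv J 0) (at 0)"
    using J by (rule holomorphic_derivI) (auto simp: open_halfspace_Re_gt)
  moreover have "(rGamma has_field_derivative 1) (at (0::complex))"
    using has_field_derivative_rGamma_nonpos_int[of 0, where 'a = complex and A = UNIV] by simp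
  ultimately have "((\<lambda>s. rGamma s * J s) has_field_derivative J 0) (at 0)"
    by (auto intro!: derivative_eq_intros)
  hence "(Z has_field_derivative J 0) (at 0)"
    by (rule has_field_derivative_transform_within_open[OF _ open_near_domain zero_in_near_domain]) (simp add: ZJ)
  hence "deriv Z 0 = J 0" by (rule DERIV_imp_deriv)
  also have "J 0 = (\<integral>t. F t / of_real t \<partial>lpos)"
    unfolding J_def
    by (intro Bochner_Integration.integral_cong refl) (auto simp: exp_minus exp_of_real divide_inverse mult.commute)
  finally show ?thesis .
qed

text \<open>A logarithm of the double gamma function that comes with its definition: quotients of
  gamma values become differences without any choice of branch.\<close>

definition G_log :: "complex \<Rightarrow> complex" where
  "G_log w = deriv (barnes_zeta2 a1 a2 w) 0"

lemma barnes_Gamma2_eq: "barnes_Gamma2 a1 a2 w = exp (G_log w)"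
  by (simp add: barnes_Gamma2_def G_log_def)

lemma has_derivative_barnes_zeta2:
  assumes "Re w > 0"
  shows "(barnes_zeta2 a1 a2 w has_field_derivative G_log w) (at 0)"
  unfolding G_log_def
  by (rule holomorphic_derivI[OF barnes_zeta2_holomorphic[OF assms] open_near_domain zero_in_near_domain])

lemma kernel_mellin_integrable:
  assumes w: "Re w > 0" and s: "Re s > 2"
  shows "integrable lpos (\<lambda>t. exp ((s - 1) * of_real (ln t)) * kernel w t)"
proof -
  obtain C where C: "\<And>t. t > 0 \<Longrightarrow> norm (kernel w t) \<le> C * t powr (-2) * exp (- (Re w / 2) * t)"
    using norm_kernel_le[OF w] by blast
  show ?thesis
    by (rule mellin_integrable[OF _ _ C]) (use s w in \<open>auto intro: borel_measurable_lposI\<close>)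
qed

text \<open>A single kernel is of order t^(-2) at 0, so its integral against dt/t diverges. Only the
  combination has to vanish at 0, to first order, for \<open>mellin_deriv_0\<close> to
  apply.\<close>

lemma G_log_combination:
  fixes w e :: "nat \<Rightarrow> complex"
  assumes w: "\<And>i. i < n \<Longrightarrow> Re (w i) > 0"
    and x: "x > 0" and bd: "\<And>t. t > 0 \<Longrightarrow> norm (\<Sum>i<n. e i * kernel (w i) t) \<le> C * t * exp (- x * t)"
  shows "(\<Sum>i<n. e i * G_log (w i)) = (\<integral>t. (\<Sum>i<n. e i * kernel (w i) t) / of_real t \<partial>lpos)"
proof -
  define Z where "Z s = (\<Sum>i<n. e i * barnes_zeta2 a1 a2 (w i) s)" for s
  have "(Z has_field_derivative (\<Sum>i<n. e i * G_log (w i))) (at 0)"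
    unfolding Z_def[abs_def]
    by (intro DERIV_sum DERIV_cmult has_derivative_barnes_zeta2 w) auto
  hence "deriv Z 0 = (\<Sum>i<n. e i * G_log (w i))" by (rule DERIV_imp_deriv)
  moreover have "deriv Z 0 = (\<integral>t. (\<Sum>i<n. e i * kernel (w i) t) / of_real t \<partial>lpos)"
  proof (rule mellin_deriv_0[OF _ _ x])
    show "Z holomorphic_on near_domain" unfolding Z_def[abs_def]
      by (intro holomorphic_intros barnes_zeta2_holomorphic w) auto
    show "(\<lambda>t. \<Sum>i<n. e i * kernel (w i) t) \<in> borel_measurable lpos"
      by (rule borel_measurable_lposI) measurable
    show "norm (\<Sum>i<n. e i * kernel (w i) t) \<le> C * t powr 1 * exp (- x * t)" if "t > 0" for t
      using bd[OF that] that by simp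
    fix s :: complex assume s: "Re s > 2"
    have "Z s = (\<Sum>i<n. e i * (rGamma s * (\<integral>t. exp ((s - 1) * of_real (ln t)) * kernel (w i) t \<partial>lpos)))"
      unfolding Z_def using w s by (intro sum.cong refl) (simp add: barnes_zeta2_integral)
    also have "\<dots> = rGamma s * (\<Sum>i<n. (\<integral>t. e i * (exp ((s - 1) * of_real (ln t)) * kernel (w i) t) \<partial>lpos))"
      by (simp add: sum_distrib_left mult.left_commute)
    also have "(\<Sum>i<n. (\<integral>t. e i * (exp ((s - 1) * of_real (ln t)) * kernel (w i) t) \<partial>lpos)) =
        (\<integral>t. (\<Sum>i<n. e i * (exp ((s - 1) * of_real (ln t)) * kernel (w i) t)) \<partial>lpos)"
      using w s by (intro Bochner_Integration.integral_sum[symmetric] integrable_mult_right kernel_mellin_integrable) auto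
    finally show "Z s = rGamma s * (\<integral>t. exp ((s - 1) * of_real (ln t)) * (\<Sum>i<n. e i * kernel (w i) t) \<partial>lpos)"
      by (simp add: sum_distrib_left mult.left_commute)
  qed
  ultimately show ?thesis by simp
qed

text \<open>With x = exp(-a1 t/2) and y = exp(-a2 t/2), 1/((1-x)(1-y)) equals
  (1+x)(1+y)/((1-x^2)(1-y^2)). The four monomials of the numerator are the four shifts of w.\<close>

lemma zeta2_duplication:
  assumes w: "Re w > 0" and s: "s \<in> near_domain"
  shows "barnes_zeta2 a1 a2 (2 * w) s = exp (- s * of_real (ln 2)) *
    (barnes_zeta2 a1 a2 w s + barnes_zeta2 a1 a2 (w + of_real (a1 / 2)) s +
     barnes_zeta2 a1 a2 (w + of_real (a2 / 2)) s + barnes_zeta2 a1 a2 (w + of_real (a1 / 2 + a2 / 2)) s)"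
proof (rule near_domain_eqI[OF _ _ _ s])
  have w': "Re (2 * w) > 0" "Re (w + of_real (a1 / 2)) > 0" "Re (w + of_real (a2 / 2)) > 0"
    "Re (w + of_real (a1 / 2 + a2 / 2)) > 0" using w a1 a2 by simp_all
  show "barnes_zeta2 a1 a2 (2 * w) holomorphic_on near_domain"
    by (rule barnes_zeta2_holomorphic[OF w'(1)])
  show "(\<lambda>s. exp (- s * of_real (ln 2)) *
    (barnes_zeta2 a1 a2 w s + barnes_zeta2 a1 a2 (w + of_real (a1 / 2)) s +
     barnes_zeta2 a1 a2 (w + of_real (a2 / 2)) s + barnes_zeta2 a1 a2 (w + of_real (a1 / 2 + a2 / 2)) s)) holomorphic_on near_domain"
    by (intro holomorphic_intros barnes_zeta2_holomorphic w w')
  fix s :: complex assume s: "Re s > 2"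
  let ?E = "\<lambda>t. exp ((s - 1) * complex_of_real (ln t))"
  let ?K = "\<lambda>t. kernel w t + kernel (w + of_real (a1 / 2)) t + kernel (w + of_real (a2 / 2)) t + kernel (w + of_real (a1 / 2 + a2 / 2)) t"
  have k: "kernel (2 * w) (t / 2) = ?K t" if t: "t > 0" for t
  proof -
    define x y where "x = exp (- a1 * (t / 2))" and "y = exp (- a2 * (t / 2))"
    have xy: "0 < x" "x < 1" "0 < y" "y < 1" using a1 a2 t by (simp_all add: x_def y_def)
    have "exp (- a1 * t) = x * x" "exp (- a2 * t) = y * y" by (simp_all add: x_def y_def flip: exp_add)
    hence D: "denom (t / 2) = (1 - x) * (1 - y)" "denom t = (1 - x * x) * (1 - y * y)"
      unfolding denom_def x_def[symmetric] y_def[symmetric] by simp_all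
    have ex: "exp (- (w + of_real c) * of_real t) = exp (- w * of_real t) * of_real (exp (- c * t))" for c
      by (simp only: exp_of_real[symmetric] exp_add[symmetric]) (rule arg_cong[of _ _ exp], simp add: algebra_simps)
    have "exp (- (a1 / 2 + a2 / 2) * t) = x * y"
      unfolding x_def y_def exp_add[symmetric] by (rule arg_cong[of _ _ exp]) (simp add: field_simps)
    hence e3: "exp (- (a1 / 2 + a2 / 2) * t) = x * y" "exp (- (a1 / 2) * t) = x" "exp (- (a2 / 2) * t) = y"
      by (simp_all add: x_def y_def)
    have "?K t = exp (- w * of_real t) * of_real ((1 + x + y + x * y) / denom t)"
      unfolding kernel_def ex e3 by (simp add: add_divide_distrib distrib_left)
    also have "(1 + x + y + x * y) / denom t = 1 / denom (t / 2)"
    proof -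
      have "denom t = denom (t / 2) * (1 + x + y + x * y)" unfolding D by (simp add: algebra_simps)
      moreover have "1 + x + y + x * y \<noteq> 0" using xy by (smt (verit) mult_pos_pos)
      ultimately show ?thesis by simp
    qed
    finally have "?K t = exp (- w * of_real t) * of_real (1 / denom (t / 2))" .
    moreover have "exp (- (2 * w) * of_real (t / 2)) = exp (- w * of_real t)" by simp
    ultimately show ?thesis unfolding kernel_def by (simp only: of_real_divide of_real_1 times_divide_eq_right mult_1_right)
  qed
  have "(\<integral>t. ?E t * kernel (2 * w) t \<partial>lpos) = (\<integral>t. indicat_real {0<..} t *\<^sub>R (?E t * kernel (2 * w) t) \<partial>lborel)"
    by (subst integral_restrict_space) auto
  also have "\<dots> = (1/2) *\<^sub>R (\<integral>t. indicat_real {0<..} (t / 2) *\<^sub>R (?E (t / 2) * kernel (2 * w) (t / 2)) \<partial>lborel)"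
    by (subst lborel_integral_real_affine[of "1/2" _ 0]) (simp_all add: mult.commute)
  also have "(\<integral>t. indicat_real {0<..} (t / 2) *\<^sub>R (?E (t / 2) * kernel (2 * w) (t / 2)) \<partial>lborel) =
      (\<integral>t. exp (- (s - 1) * of_real (ln 2)) * (indicat_real {0<..} t *\<^sub>R (?E t * ?K t)) \<partial>lborel)"
  proof (intro Bochner_Integration.integral_cong refl)
    fix t :: real
    have "?E (t / 2) = exp (- (s - 1) * of_real (ln 2)) * ?E t" if "t > 0"
      unfolding exp_add[symmetric] using that by (intro arg_cong[of _ _ exp]) (simp add: ln_div algebra_simps)
    thus "indicat_real {0<..} (t / 2) *\<^sub>R (?E (t / 2) * kernel (2 * w) (t / 2)) =
        exp (- (s - 1) * of_real (ln 2)) * (indicat_real {0<..} t *\<^sub>R (?E t * ?K t))"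
      using k[of t] by (cases "t > 0") simp_all
  qed
  also have "\<dots> = exp (- (s - 1) * of_real (ln 2)) * (\<integral>t. ?E t * ?K t \<partial>lpos)"
    by (subst integral_restrict_space, simp) (rule integral_mult_right_zero)
  \<comment> \<open>The Jacobian 1/2 and the factor 2^(1-s) from the halved variable combine to
    2^(-s).\<close>
  also have "(1/2) *\<^sub>R \<dots> = exp (- s * of_real (ln 2)) * (\<integral>t. ?E t * ?K t \<partial>lpos)"
  proof -
    have "exp (- (s - 1) * of_real (ln 2)) = exp (- s * of_real (ln 2)) * exp (of_real (ln 2))"
      unfolding exp_add[symmetric] by (intro arg_cong[of _ _ exp]) (simp add: algebra_simps)
    also have "exp (complex_of_real (ln 2)) = 2" by (simp only: exp_of_real) simp
    finally show ?thesis by (simp add: scaleR_conv_of_real)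
  qed
  also have "(\<integral>t. ?E t * ?K t \<partial>lpos) =
      (\<integral>t. ?E t * kernel w t \<partial>lpos) + (\<integral>t. ?E t * kernel (w + of_real (a1 / 2)) t \<partial>lpos) +
      (\<integral>t. ?E t * kernel (w + of_real (a2 / 2)) t \<partial>lpos) + (\<integral>t. ?E t * kernel (w + of_real (a1 / 2 + a2 / 2)) t \<partial>lpos)"
    unfolding distrib_left using kernel_mellin_integrable[OF w s] w'[THEN kernel_mellin_integrable[OF _ s]]
    by (simp del: of_real_add of_real_divide)
  finally show "barnes_zeta2 a1 a2 (2 * w) s = exp (- s * of_real (ln 2)) *
    (barnes_zeta2 a1 a2 w s + barnes_zeta2 a1 a2 (w + of_real (a1 / 2)) s +
     barnes_zeta2 a1 a2 (w + of_real (a2 / 2)) s + barnes_zeta2 a1 a2 (w + of_real (a1 / 2 + a2 / 2)) s)"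
    unfolding barnes_zeta2_integral[OF w s] w'[THEN barnes_zeta2_integral[OF _ s]]
    by (simp only: distrib_left mult_ac)
qed

text \<open>Differentiating 2^(-s) at 0 contributes -ln 2 times the sum of the four zeta values, and
  the duplication formula at s = 0 identifies that sum with the value at 2w.\<close>

lemma G_log_duplication:
  assumes w: "Re w > 0"
  shows "G_log (2 * w) = G_log w + G_log (w + of_real (a1 / 2)) + G_log (w + of_real (a2 / 2))
    + G_log (w + of_real (a1 / 2 + a2 / 2)) - of_real (ln 2) * barnes_zeta2 a1 a2 (2 * w) 0"
proof -
  have w': "Re (2 * w) > 0" "Re (w + of_real (a1 / 2)) > 0" "Re (w + of_real (a2 / 2)) > 0"
    "Re (w + of_real (a1 / 2 + a2 / 2)) > 0" using w a1 a2 by simp_all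
  define S where "S s = barnes_zeta2 a1 a2 w s + barnes_zeta2 a1 a2 (w + of_real (a1 / 2)) s +
     barnes_zeta2 a1 a2 (w + of_real (a2 / 2)) s + barnes_zeta2 a1 a2 (w + of_real (a1 / 2 + a2 / 2)) s" for s
  define S' where "S' = G_log w + G_log (w + of_real (a1 / 2)) + G_log (w + of_real (a2 / 2))
    + G_log (w + of_real (a1 / 2 + a2 / 2))"
  have S: "(S has_field_derivative S') (at 0)"
    unfolding S_def[abs_def] S'_def by (intro DERIV_add has_derivative_barnes_zeta2 w w')
  have eq: "barnes_zeta2 a1 a2 (2 * w) s = exp (- s * of_real (ln 2)) * S s" if "s \<in> near_domain" for s
    unfolding S_def by (rule zeta2_duplication[OF w that])
  have "((\<lambda>s. exp (- s * of_real (ln 2)) * S s) has_field_derivative S' - of_real (ln 2) * S 0) (at 0)"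
    using S by (auto intro!: derivative_eq_intros)
  hence "(barnes_zeta2 a1 a2 (2 * w) has_field_derivative S' - of_real (ln 2) * S 0) (at 0)"
    by (rule has_field_derivative_transform_within_open[OF _ open_near_domain zero_in_near_domain]) (simp only: eq)
  with has_derivative_barnes_zeta2[OF w'(1)] have "G_log (2 * w) = S' - of_real (ln 2) * S 0"
    by (rule DERIV_unique)
  moreover have "S 0 = barnes_zeta2 a1 a2 (2 * w) 0" using eq[OF zero_in_near_domain] by simp
  ultimately show ?thesis by (simp add: S'_def)
qed

section \<open>Levy densities and existence of the Barnes beta laws\<close>

definition levy_density :: "real \<Rightarrow> real \<Rightarrow> real \<Rightarrow> real \<Rightarrow> real" where
  "levy_density b0 b1 b2 t = exp (- b0 * t) * (1 - exp (- b1 * t)) * (1 - exp (- b2 * t)) / (t * denom t)"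

lemma levy_density_measurable [measurable]: "levy_density b0 b1 b2 \<in> borel_measurable borel"
  unfolding levy_density_def denom_def by measurable

text \<open>Each factor 1 - exp(-bt) has the sign of b, so equal signs give a nonnegative
  product.\<close>

lemma levy_density_nonneg:
  assumes "t > 0" and b: "0 \<le> b1 \<and> 0 \<le> b2 \<or> b1 \<le> 0 \<and> b2 \<le> 0"
  shows "levy_density b0 b1 b2 t \<ge> 0"
proof -
  have "0 \<le> (1 - exp (- b1 * t)) * (1 - exp (- b2 * t))"
    using b
  proof (elim disjE conjE)
    assume "0 \<le> b1" "0 \<le> b2"
    thus ?thesis using \<open>t > 0\<close> by (intro mult_nonneg_nonneg) simp_all
  next
    assume "b1 \<le> 0" "b2 \<le> 0"
    thus ?thesis using \<open>t > 0\<close> by (intro mult_nonpos_nonpos) (simp_all add: mult_nonpos_nonneg)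
  qed
  hence "0 \<le> exp (- b0 * t) * ((1 - exp (- b1 * t)) * (1 - exp (- b2 * t)))" by (rule mult_nonneg_nonneg[OF exp_ge_zero])
  thus ?thesis using assms denom_pos[of t] unfolding levy_density_def mult.assoc by (intro divide_nonneg_nonneg) auto
qed

text \<open>The differences exp(-qt) - 1, 1 - exp(-b1 t) and 1 - exp(-b2 t) contribute a factor t
  each, and 1/\<open>denom\<close> takes back two. The rate y is the smallest among the eight
  exponentials of the expanded product; half of it absorbs the growth of the constant
  factor.\<close>

lemma levy_density_bound:
  assumes q: "Re q > - (b0 + min 0 b1 + min 0 b2)" and B: "b0 + min 0 b1 + min 0 b2 > 0"
  obtains C x where "x > 0" "\<And>t. t > 0 \<Longrightarrow>
    norm ((exp (- q * of_real t) - 1) * of_real (t * levy_density b0 b1 b2 t)) \<le> C * t * exp (- x * t)"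
proof -
  define y where "y = b0 + min 0 b1 + min 0 b2 - max 0 (- Re q)"
  have y: "y > 0" using q B by (simp add: y_def max_def)
  obtain K where K: "\<And>t. t > 0 \<Longrightarrow> 1 + t\<^sup>2 \<le> K * exp (y / 2 * t)" "K > 0"
    using poly_exp_bound[of "y / 2"] y by auto
  obtain C where C: "C > 0" "\<And>t. t > 0 \<Longrightarrow> 1 / denom t \<le> C * (1 + t\<^sup>2) / t\<^sup>2"
    by (rule inverse_denom_le) (rule that)
  have "norm ((exp (- q * of_real t) - 1) * of_real (t * levy_density b0 b1 b2 t)) \<le>
     (norm q * \<bar>b1\<bar> * \<bar>b2\<bar> * (C * K)) * t * exp (- (y / 2) * t)" if t: "t > 0" for t
  proof -
    have "t\<^sup>2 * (1 / denom t) \<le> t\<^sup>2 * (C * (1 + t\<^sup>2) / t\<^sup>2)"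
      by (intro mult_left_mono C t) auto
    also have "\<dots> = C * (1 + t\<^sup>2)" using t by simp
    also have "\<dots> \<le> C * (K * exp (y / 2 * t))" using C(1) K(1)[OF t] by (intro mult_left_mono) auto
    finally have D: "t\<^sup>2 / denom t \<le> C * (K * exp (y / 2 * t))" by simp
    have "norm ((exp (- q * of_real t) - 1) * of_real (t * levy_density b0 b1 b2 t)) =
        norm (exp (- q * of_real t) - 1) * (exp (- b0 * t) * (\<bar>1 - exp (- b1 * t)\<bar> * \<bar>1 - exp (- b2 * t)\<bar>)) * (1 / denom t)"
      using t denom_pos[OF t] unfolding norm_mult norm_of_real levy_density_def by (simp add: abs_mult)
    also have "\<dots> \<le> (norm q * t * exp (max 0 (- Re q) * t)) * (exp (- b0 * t) *
        ((\<bar>b1\<bar> * t * exp (- min 0 b1 * t)) * (\<bar>b2\<bar> * t * exp (- min 0 b2 * t)))) * (1 / denom t)"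
      using t denom_pos[OF t]
      by (intro mult_right_mono mult_mono norm_exp_mult_minus_one_le abs_one_minus_exp_le mult_nonneg_nonneg order_refl) auto
    also have "\<dots> = (norm q * \<bar>b1\<bar> * \<bar>b2\<bar>) * t * (exp (max 0 (- Re q) * t) * exp (- b0 * t) * exp (- min 0 b1 * t) * exp (- min 0 b2 * t)) * (t\<^sup>2 / denom t)"
      by (simp add: power2_eq_square)
    also have "exp (max 0 (- Re q) * t) * exp (- b0 * t) * exp (- min 0 b1 * t) * exp (- min 0 b2 * t) = exp (- y * t)"
      unfolding exp_add[symmetric] by (rule arg_cong[of _ _ exp]) (simp add: y_def algebra_simps)
    also have "(norm q * \<bar>b1\<bar> * \<bar>b2\<bar>) * t * exp (- y * t) * (t\<^sup>2 / denom t) \<le>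
        (norm q * \<bar>b1\<bar> * \<bar>b2\<bar>) * t * exp (- y * t) * (C * (K * exp (y / 2 * t)))"
      using t by (intro mult_left_mono D) auto
    also have "\<dots> = (norm q * \<bar>b1\<bar> * \<bar>b2\<bar> * (C * K)) * t * (exp (- y * t) * exp (y / 2 * t))"
      by (simp only: mult_ac)
    also have "exp (- y * t) * exp (y / 2 * t) = exp (- (y / 2) * t)"
      unfolding exp_add[symmetric] by (rule arg_cong[of _ _ exp]) (simp add: field_simps)
    finally show ?thesis .
  qed
  from that[OF _ this] y show ?thesis by simp
qed

lemma levy_kernel_integrable:
  assumes q: "Re q > - (b0 + min 0 b1 + min 0 b2)" and B: "b0 + min 0 b1 + min 0 b2 > 0"
  shows "integrable lpos (\<lambda>t. levy_density b0 b1 b2 t *\<^sub>R (exp (- q * of_real t) - 1))"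
proof -
  let ?F = "\<lambda>t. (exp (- q * of_real t) - 1) * complex_of_real (t * levy_density b0 b1 b2 t)"
  obtain C x where x: "x > 0" and C: "\<And>t. t > 0 \<Longrightarrow> norm (?F t) \<le> C * t * exp (- x * t)"
    by (rule levy_density_bound[OF assms]) (rule that)
  have C': "norm (?F t) \<le> C * t powr 1 * exp (- x * t)" if "t > 0" for t using C[OF that] that by simp
  have Fm: "?F \<in> borel_measurable lpos" by (rule borel_measurable_lposI) measurable
  have "integrable lpos (\<lambda>t. exp ((0 - 1) * of_real (ln t)) * ?F t)"
    by (rule mellin_integrable[OF Fm x C']) simp_all
  moreover have "exp ((0 - 1) * of_real (ln t)) * ?F t = levy_density b0 b1 b2 t *\<^sub>R (exp (- q * of_real t) - 1)" if "t > 0" for t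
    using that by (simp add: exp_minus exp_of_real scaleR_conv_of_real)
  ultimately show ?thesis
    by (subst (asm) Bochner_Integration.integrable_cong[OF refl]) auto
qed

text \<open>Expanding the product of three differences gives eight kernels with signs, four shifted
  by q and four not. The unshifted ones are the normalisation at q = 0; without it the combination
  would not vanish at t = 0.\<close>

lemma G_log_levy:
  assumes q: "Re q > - (b0 + min 0 b1 + min 0 b2)" and B: "b0 + min 0 b1 + min 0 b2 > 0"
  shows "(G_log (q + of_real b0) - G_log (q + of_real (b0 + b1)) - G_log (q + of_real (b0 + b2)) + G_log (q + of_real (b0 + b1 + b2)))
    - (G_log (of_real b0) - G_log (of_real (b0 + b1)) - G_log (of_real (b0 + b2)) + G_log (of_real (b0 + b1 + b2)))
    = (\<integral>t. levy_density b0 b1 b2 t *\<^sub>R (exp (- q * of_real t) - 1) \<partial>lpos)"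
proof -
  let ?F = "\<lambda>t. (exp (- q * of_real t) - 1) * complex_of_real (t * levy_density b0 b1 b2 t)"
  obtain C x where x: "x > 0" and C: "\<And>t. t > 0 \<Longrightarrow> norm (?F t) \<le> C * t * exp (- x * t)"
    by (rule levy_density_bound[OF assms]) (rule that)
  define ws :: "complex list" where "ws = [q + of_real b0, q + of_real (b0 + b1), q + of_real (b0 + b2), q + of_real (b0 + b1 + b2),
     of_real b0, of_real (b0 + b1), of_real (b0 + b2), of_real (b0 + b1 + b2)]"
  define es :: "complex list" where "es = [1, -1, -1, 1, -1, 1, 1, -1]"
  have "b0 \<ge> b0 + min 0 b1 + min 0 b2" "b0 + b1 \<ge> b0 + min 0 b1 + min 0 b2" "b0 + b2 \<ge> b0 + min 0 b1 + min 0 b2"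
    "b0 + b1 + b2 \<ge> b0 + min 0 b1 + min 0 b2" by (auto simp: min_def)
  hence "\<forall>w\<in>set ws. Re w > 0" using q B unfolding ws_def by auto
  moreover have "ws ! i \<in> set ws" if "i < 8" for i using that by (intro nth_mem) (simp add: ws_def)
  ultimately have w: "Re (ws ! i) > 0" if "i < 8" for i using that by blast
  have F: "(\<Sum>i<8. es ! i * kernel (ws ! i) t) = ?F t" if t: "t > 0" for t
  proof -
    define P where "P = exp (- q * of_real t)"
    have "exp (- (q + of_real b) * of_real t) = P * of_real (exp (- b * t))" for b
      unfolding P_def exp_of_real[symmetric] exp_add[symmetric]
      by (rule arg_cong[of _ _ exp]) (simp add: algebra_simps)
    hence k: "kernel (of_real b) t = of_real (exp (- b * t) / denom t)" "kernel (q + of_real b) t = P * of_real (exp (- b * t) / denom t)" for b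
      by (simp_all add: kernel_def exp_of_real[symmetric])
    have e: "exp (- (b0 + b1) * t) = exp (- b0 * t) * exp (- b1 * t)" "exp (- (b0 + b2) * t) = exp (- b0 * t) * exp (- b2 * t)"
      "exp (- (b0 + b1 + b2) * t) = exp (- b0 * t) * exp (- b1 * t) * exp (- b2 * t)"
      unfolding exp_add[symmetric] by (rule arg_cong[of _ _ exp], simp add: algebra_simps)+
    have "t * levy_density b0 b1 b2 t = (exp (- b0 * t) * (1 - exp (- b1 * t)) * (1 - exp (- b2 * t))) / denom t"
      using t by (simp add: levy_density_def)
    also have "\<dots> = exp (- b0 * t) / denom t - exp (- (b0 + b1) * t) / denom t - exp (- (b0 + b2) * t) / denom t + exp (- (b0 + b1 + b2) * t) / denom t"
      unfolding e by (simp add: algebra_simps add_divide_distrib diff_divide_distrib)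
    finally have l: "t * levy_density b0 b1 b2 t = \<dots>" .
    have "(\<Sum>i<8. es ! i * kernel (ws ! i) t) =
       kernel (q + of_real b0) t - kernel (q + of_real (b0 + b1)) t - kernel (q + of_real (b0 + b2)) t + kernel (q + of_real (b0 + b1 + b2)) t
       - kernel (of_real b0) t + kernel (of_real (b0 + b1)) t + kernel (of_real (b0 + b2)) t - kernel (of_real (b0 + b1 + b2)) t"
      by (simp add: es_def ws_def numeral_eq_Suc del: of_real_add)
    also have "\<dots> = ?F t"
      unfolding k l P_def[symmetric] unfolding of_real_add of_real_diff by algebra
    finally show ?thesis .
  qed
  have "(\<Sum>i<8. es ! i * G_log (ws ! i)) = (\<integral>t. (\<Sum>i<8. es ! i * kernel (ws ! i) t) / of_real t \<partial>lpos)"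
    by (rule G_log_combination[OF w x]) (use C F in auto)
  also have "\<dots> = (\<integral>t. levy_density b0 b1 b2 t *\<^sub>R (exp (- q * of_real t) - 1) \<partial>lpos)"
    by (intro Bochner_Integration.integral_cong refl) (simp add: F scaleR_conv_of_real)
  also have "(\<Sum>i<8. es ! i * G_log (ws ! i)) =
    (G_log (q + of_real b0) - G_log (q + of_real (b0 + b1)) - G_log (q + of_real (b0 + b2)) + G_log (q + of_real (b0 + b1 + b2)))
    - (G_log (of_real b0) - G_log (of_real (b0 + b1)) - G_log (of_real (b0 + b2)) + G_log (of_real (b0 + b1 + b2)))"
    by (simp add: es_def ws_def numeral_eq_Suc del: of_real_add)
  finally show ?thesis .
qed

lemma beta_ratio_eq:
  assumes b: "0 \<le> b1 \<and> 0 \<le> b2 \<or> b1 \<le> 0 \<and> b2 \<le> 0" and B: "min b0 (b0 + b1 + b2) > 0"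
    and q: "Re q > - min b0 (b0 + b1 + b2)"
  shows "(let G = barnes_Gamma2 a1 a2 in
          G (q + of_real b0) / G (of_real b0) *
             (G (of_real (b0 + b1)) / G (q + of_real (b0 + b1))) *
             (G (of_real (b0 + b2)) / G (q + of_real (b0 + b2))) *
             (G (q + of_real (b0 + b1 + b2)) / G (of_real (b0 + b1 + b2)))) =
     exp (\<integral>t. levy_density b0 b1 b2 t *\<^sub>R (exp (- q * of_real t) - 1) \<partial>lpos)"
proof -
  have "exp (\<integral>t. levy_density b0 b1 b2 t *\<^sub>R (exp (- q * of_real t) - 1) \<partial>lpos) =
      exp ((G_log (q + of_real b0) - G_log (q + of_real (b0 + b1)) - G_log (q + of_real (b0 + b2)) + G_log (q + of_real (b0 + b1 + b2)))
    - (G_log (of_real b0) - G_log (of_real (b0 + b1)) - G_log (of_real (b0 + b2)) + G_log (of_real (b0 + b1 + b2))))"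
    using q B by (subst G_log_levy) (simp_all only: min_add_same_sign[OF b])
  thus ?thesis unfolding Let_def barnes_Gamma2_eq
    by (simp only: exp_add exp_diff) (simp add: divide_simps mult_ac del: of_real_add)
qed

lemma levy_measure_levy_density:
  assumes b: "0 \<le> b1 \<and> 0 \<le> b2 \<or> b1 \<le> 0 \<and> b2 \<le> 0" and B: "min b0 (b0 + b1 + b2) > 0"
    and q: "Re q < min b0 (b0 + b1 + b2)"
  shows "integrable lpos (\<lambda>t. levy_density b0 b1 b2 t *\<^sub>R (exp (q * of_real t) - 1))"
  using levy_kernel_integrable[of b0 b1 b2 "- q"] q B min_add_same_sign[OF b] by simp

text \<open>Minus the logarithm of a beta variable is the subordinator with this Levy density, and
  its nonnegativity puts the law on the interval up to 1.\<close>

lemma barnes_beta22_exists: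
  assumes b: "0 \<le> b1 \<and> 0 \<le> b2 \<or> b1 \<le> 0 \<and> b2 \<le> 0" and B: "min b0 (b0 + b1 + b2) > 0"
  shows "\<exists>\<mu>. barnes_beta22 a1 a2 b0 b1 b2 \<mu>"
proof -
  let ?B = "min b0 (b0 + b1 + b2)" and ?\<Lambda> = "levy_measure (levy_density b0 b1 b2)"
  have nn: "\<And>t. t > 0 \<Longrightarrow> levy_density b0 b1 b2 t \<ge> 0" by (rule levy_density_nonneg[OF _ b])
  obtain \<nu> where \<nu>: "prob_space \<nu>" "sets \<nu> = sets borel" "AE x in \<nu>. x \<ge> 0"
    and I: "\<And>q::complex. Re q < ?B \<Longrightarrow> integrable \<nu> (\<lambda>x. exp (q * of_real x))"
    and E: "\<And>q::complex. Re q < ?B \<Longrightarrow> (\<integral>x. exp (q * of_real x) \<partial>\<nu>) = exp (\<integral>t. (exp (q * of_real t) - 1) \<partial>?\<Lambda>)"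
  proof -
    have "\<exists>\<nu>. prob_space \<nu> \<and> sets \<nu> = sets borel \<and> (AE x in \<nu>. x \<ge> 0) \<and>
    (\<forall>q::complex. Re q < ?B \<longrightarrow> integrable \<nu> (\<lambda>x. exp (q * of_real x)) \<and>
       (\<integral>x. exp (q * of_real x) \<partial>\<nu>) = exp (\<integral>t. (exp (q * of_real t) - 1) \<partial>?\<Lambda>))"
    proof (rule subordinator_exists)
      show "AE t in ?\<Lambda>. t > 0" by (rule AE_levy_measure_pos) measurable
      show "integrable ?\<Lambda> (\<lambda>t. exp (q * of_real t) - 1)" if "Re q < ?B" for q
        using levy_measure_levy_density[OF b B that] by (subst integrable_levy_measure_iff) (auto simp: nn)
    qed (use B in auto)
    thus ?thesis using that by blast
  qed
  note [measurable_cong] = \<nu>(2)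
  have "mellin_law {0<..1} {q. Re q > - ?B} (\<lambda>q. (let G = barnes_Gamma2 a1 a2 in
          G (q + of_real b0) / G (of_real b0) *
             (G (of_real (b0 + b1)) / G (q + of_real (b0 + b1))) *
             (G (of_real (b0 + b2)) / G (q + of_real (b0 + b2))) *
             (G (q + of_real (b0 + b1 + b2)) / G (of_real (b0 + b1 + b2))))) (distr (distr \<nu> borel uminus) borel exp)"
  proof (rule mellin_law_distr_exp)
    show "prob_space (distr \<nu> borel uminus)" by (rule prob_space.prob_space_distr[OF \<nu>(1)]) measurable
    show "AE x in distr \<nu> borel uminus. exp x \<in> {0<..1}"
      using \<nu>(3) by (subst AE_distr_iff) (auto elim!: eventually_mono)
    fix q assume "q \<in> {q. Re q > - ?B}"
    hence "Re q > - ?B" by simp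
    moreover from this have "Re (- q) < ?B" unfolding uminus_complex.sel by linarith
    ultimately have q: "Re (- q) < ?B" "Re q > - ?B" by blast+
    show "integrable (distr \<nu> borel uminus) (\<lambda>x. exp (q * of_real x))"
      using I[OF q(1)] by (subst integrable_distr_eq) auto
    have "(\<integral>x. exp (q * of_real x) \<partial>distr \<nu> borel uminus) = (\<integral>x. exp (- q * of_real x) \<partial>\<nu>)"
      by (subst integral_distr) auto
    also have "\<dots> = exp (\<integral>t. levy_density b0 b1 b2 t *\<^sub>R (exp (- q * of_real t) - 1) \<partial>lpos)"
      unfolding E[OF q(1)] by (subst integral_levy_measure) (auto simp: nn)
    finally show "(\<integral>x. exp (q * of_real x) \<partial>distr \<nu> borel uminus) = (let G = barnes_Gamma2 a1 a2 in
          G (q + of_real b0) / G (of_real b0) *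
             (G (of_real (b0 + b1)) / G (q + of_real (b0 + b1))) *
             (G (of_real (b0 + b2)) / G (q + of_real (b0 + b2))) *
             (G (q + of_real (b0 + b1 + b2)) / G (of_real (b0 + b1 + b2))))"
      unfolding beta_ratio_eq[OF b B q(2)] .
  qed auto
  thus ?thesis unfolding barnes_beta22_def Let_def by blast
qed

text \<open>Taking the reciprocal reverses the sign of q, so the logarithm of an inverse beta
  variable has the exponent of the subordinator itself.\<close>

lemma
  assumes b: "0 \<le> b1 \<and> 0 \<le> b2 \<or> b1 \<le> 0 \<and> b2 \<le> 0" and B: "min b0 (b0 + b1 + b2) > 0"
    and \<nu>: "inv_barnes_beta22 a1 a2 b0 b1 b2 \<nu>"
  shows inv_barnes_beta22_pos: "AE x in \<nu>. x > 0"
    and inv_barnes_beta22_char: "(\<integral>x. exp (\<i> * of_real \<theta> * of_real (ln x)) \<partial>\<nu>) =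
      exp (\<integral>t. levy_density b0 b1 b2 t *\<^sub>R (exp (\<i> * of_real \<theta> * of_real t) - 1) \<partial>lpos)"
proof -
  obtain \<mu> where \<mu>: "barnes_beta22 a1 a2 b0 b1 b2 \<mu>" and \<nu>_eq: "\<nu> = distr \<mu> borel (\<lambda>y. 1 / y)"
    using \<nu> by (auto simp: inv_barnes_beta22_def)
  from \<mu> have S[measurable_cong]: "sets \<mu> = sets borel" and AE: "AE x in \<mu>. x \<in> {0<..1}"
    by (auto simp: barnes_beta22_def Let_def mellin_law_def)
  show "AE x in \<nu>. x > 0"
    unfolding \<nu>_eq using AE by (subst AE_distr_iff) (auto elim!: eventually_mono)
  have q: "Re (- (\<i> * of_real \<theta>)) > - min b0 (b0 + b1 + b2)" using B by simp
  have "(\<integral>x. exp (\<i> * of_real \<theta> * of_real (ln x)) \<partial>\<nu>) = (\<integral>x. exp (\<i> * of_real \<theta> * of_real (ln (1 / x))) \<partial>\<mu>)"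
    unfolding \<nu>_eq by (subst integral_distr) auto
  also have "\<dots> = (\<integral>x. exp (- (\<i> * of_real \<theta>) * of_real (ln x)) \<partial>\<mu>)"
    by (rule integral_cong_AE) (use AE in \<open>auto simp: ln_div elim!: eventually_mono\<close>)
  also have "\<dots> = (\<integral>x. exp (- (\<i> * of_real \<theta>) * of_real x) \<partial>distr \<mu> borel ln)"
    by (subst integral_distr) auto
  also have "\<dots> = exp (\<integral>t. levy_density b0 b1 b2 t *\<^sub>R (exp (- (- (\<i> * of_real \<theta>)) * of_real t) - 1) \<partial>lpos)"
    unfolding beta_ratio_eq[OF b B q, symmetric]
    using \<mu> q unfolding barnes_beta22_def Let_def
    by (rule_tac mellin_law_integral_ln) auto
  finally show "(\<integral>x. exp (\<i> * of_real \<theta> * of_real (ln x)) \<partial>\<nu>) =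
      exp (\<integral>t. levy_density b0 b1 b2 t *\<^sub>R (exp (\<i> * of_real \<theta> * of_real t) - 1) \<partial>lpos)" by simp
qed

end

section \<open>The factorization\<close>

locale barnes_factorization = barnes +
  fixes x1 x2 :: real
  assumes x1: "x1 > 0" and x2: "x2 > 0"
begin

text \<open>The coefficient of q in ln 2 times the difference of the zeta values at s = 0 for x1 +
  x2 - 2q and x1 + x2. It is also the logarithm of the constant in the factorization.\<close>

definition drift :: real where
  "drift = - (2 * (x1 + x2) - (a1 + a2)) / (a1 * a2) * ln 2"

definition variance :: real where
  "variance = 4 * ln 2 / (a1 * a2)"

definition total_density :: "real \<Rightarrow> real" where
  "total_density t = levy_density x1 ((x2 - x1) / 2) ((x2 - x1) / 2) t
     + levy_density ((x1 + x2) / 2) (a1 / 2) (a2 / 2) t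
     + levy_density (a1 + a2) ((x1 + x2 - a1 - a2) / 2) ((x1 + x2 - a1 - a2) / 2) t"

abbreviation levy_integral :: "(real \<Rightarrow> real) \<Rightarrow> complex \<Rightarrow> complex" where
  "levy_integral \<rho> q \<equiv> (\<integral>t. \<rho> t *\<^sub>R (exp (q * of_real t) - 1) \<partial>lpos)"

lemma same_sign:
  "0 \<le> (x2 - x1) / 2 \<and> 0 \<le> (x2 - x1) / 2 \<or> (x2 - x1) / 2 \<le> 0 \<and> (x2 - x1) / 2 \<le> 0"
  "0 \<le> a1 / 2 \<and> 0 \<le> a2 / 2 \<or> a1 / 2 \<le> 0 \<and> a2 / 2 \<le> 0"
  "0 \<le> (x1 + x2 - a1 - a2) / 2 \<and> 0 \<le> (x1 + x2 - a1 - a2) / 2 \<or> (x1 + x2 - a1 - a2) / 2 \<le> 0 \<and> (x1 + x2 - a1 - a2) / 2 \<le> 0"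
  using a1 a2 by auto

text \<open>The three right-hand sides are min(x1, x2), (x1 + x2)/2 and min(a1 + a2, x1 + x2), so
  every factor is defined on the whole half-plane of M.\<close>

lemma abscissa_le:
  "Min {x1, x2, a1 + a2} \<le> min x1 (x1 + (x2 - x1) / 2 + (x2 - x1) / 2)"
  "Min {x1, x2, a1 + a2} \<le> min ((x1 + x2) / 2) ((x1 + x2) / 2 + a1 / 2 + a2 / 2)"
  "Min {x1, x2, a1 + a2} \<le> min (a1 + a2) (a1 + a2 + (x1 + x2 - a1 - a2) / 2 + (x1 + x2 - a1 - a2) / 2)"
  using a1 a2 x1 x2 by (auto simp: min_def field_simps)

lemma abscissa_pos: "Min {x1, x2, a1 + a2} > 0"
  using a1 a2 x1 x2 by simp

lemmas parameter_pos = less_le_trans[OF abscissa_pos abscissa_le(1)]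
  less_le_trans[OF abscissa_pos abscissa_le(2)] less_le_trans[OF abscissa_pos abscissa_le(3)]

lemma levy_integrable:
  assumes "Re q < Min {x1, x2, a1 + a2}"
  shows "integrable lpos (\<lambda>t. levy_density x1 ((x2 - x1) / 2) ((x2 - x1) / 2) t *\<^sub>R (exp (q * of_real t) - 1))"
    "integrable lpos (\<lambda>t. levy_density ((x1 + x2) / 2) (a1 / 2) (a2 / 2) t *\<^sub>R (exp (q * of_real t) - 1))"
    "integrable lpos (\<lambda>t. levy_density (a1 + a2) ((x1 + x2 - a1 - a2) / 2) ((x1 + x2 - a1 - a2) / 2) t *\<^sub>R (exp (q * of_real t) - 1))"
  by (rule levy_measure_levy_density[OF same_sign(1) parameter_pos(1) less_le_trans[OF assms abscissa_le(1)]]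
      levy_measure_levy_density[OF same_sign(2) parameter_pos(2) less_le_trans[OF assms abscissa_le(2)]]
      levy_measure_levy_density[OF same_sign(3) parameter_pos(3) less_le_trans[OF assms abscissa_le(3)]])+

lemma total_density_measurable [measurable]: "total_density \<in> borel_measurable borel"
  unfolding total_density_def by measurable

lemma total_density_nonneg: "t > 0 \<Longrightarrow> total_density t \<ge> 0"
  unfolding total_density_def using same_sign by (intro add_nonneg_nonneg levy_density_nonneg)

lemma total_density_integrable:
  assumes "Re q < Min {x1, x2, a1 + a2}"
  shows "integrable (levy_measure total_density) (\<lambda>t. exp (q * of_real t) - 1)"
  using levy_integrable[OF assms]
  by (subst integrable_levy_measure_iff[OF total_density_measurable _ total_density_nonneg])
     (simp_all add: total_density_def scaleR_add_left)

lemma total_density_integral: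
  assumes "Re q < Min {x1, x2, a1 + a2}"
  shows "(\<integral>t. (exp (q * of_real t) - 1) \<partial>levy_measure total_density) =
    levy_integral (levy_density x1 ((x2 - x1) / 2) ((x2 - x1) / 2)) q
    + levy_integral (levy_density ((x1 + x2) / 2) (a1 / 2) (a2 / 2)) q
    + levy_integral (levy_density (a1 + a2) ((x1 + x2 - a1 - a2) / 2) ((x1 + x2 - a1 - a2) / 2)) q"
  using levy_integrable[OF assms]
  by (subst integral_levy_measure[OF total_density_measurable _ total_density_nonneg])
     (simp_all add: total_density_def scaleR_add_left)

lemma M_transform_eq:
  assumes q: "Re q < Min {x1, x2, a1 + a2}"
  shows "(let G = barnes_Gamma2 a1 a2 in
        G (of_real x1 - q) / G (of_real x1) *
             (G (of_real x2 - q) / G (of_real x2)) *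
             (G (of_real (a1 + a2) - q) / G (of_real (a1 + a2))) *
             (G (of_real (x1 + x2) - q) / G (of_real (x1 + x2) - 2 * q))) =
    exp (q * of_real drift + of_real variance * q\<^sup>2 / 2 + (\<integral>t. (exp (q * of_real t) - 1) \<partial>levy_measure total_density))"
proof -
  define g where "g u = G_log (of_real u - q)" for u :: real
  define g0 where "g0 u = G_log (of_real u)" for u :: real
  define y where "y = (x1 + x2) / 2"
  have S: "g b0 - g (b0 + b1) - g (b0 + b2) + g (b0 + b1 + b2) - (g0 b0 - g0 (b0 + b1) - g0 (b0 + b2) + g0 (b0 + b1 + b2))
      = levy_integral (levy_density b0 b1 b2) q"
    if b: "0 \<le> b1 \<and> 0 \<le> b2 \<or> b1 \<le> 0 \<and> b2 \<le> 0" and B: "Min {x1, x2, a1 + a2} \<le> min b0 (b0 + b1 + b2)" for b0 b1 b2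
  proof -
    have "Re (- q) > - (b0 + min 0 b1 + min 0 b2)" "b0 + min 0 b1 + min 0 b2 > 0"
      unfolding min_add_same_sign[OF b] uminus_complex.sel using B q abscissa_pos by linarith+
    from G_log_levy[OF this] show ?thesis unfolding g_def g0_def minus_minus uminus_add_conv_diff .
  qed
  \<comment> \<open>The inner arguments of the first and third beta quotients become duplication
    points, which is what makes the sum of the three quotients collapse.\<close>
  have args: "x1 + (x2 - x1) / 2 = y" "y + (x2 - x1) / 2 = x2" "a1 + a2 + (x1 + x2 - a1 - a2) / 2 = y + a1 / 2 + a2 / 2"
    "y + a1 / 2 + a2 / 2 + (x1 + x2 - a1 - a2) / 2 = x1 + x2" by (simp_all add: y_def field_simps)
  note S1 = S[OF same_sign(1) abscissa_le(1), unfolded args]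
  note S2 = S[OF same_sign(2) abscissa_le(2), folded y_def]
  note S3 = S[OF same_sign(3) abscissa_le(3), unfolded args]
  have w: "Re (of_real y - q) > 0" "Re (of_real y) > 0"
    using q x1 x2 by (auto simp: y_def)
  have dbl: "2 * (of_real y - q) = of_real (x1 + x2) - 2 * q" "2 * complex_of_real y = of_real (x1 + x2)"
    by (simp_all add: y_def)
  have D1: "G_log (of_real (x1 + x2) - 2 * q) = g y + g (y + a1 / 2) + g (y + a2 / 2) + g (y + a1 / 2 + a2 / 2)
      - of_real (ln 2) * barnes_zeta2 a1 a2 (of_real (x1 + x2) - 2 * q) 0"
    using G_log_duplication[OF w(1)] unfolding dbl g_def by (simp add: algebra_simps)
  have D0: "g0 (x1 + x2) = g0 y + g0 (y + a1 / 2) + g0 (y + a2 / 2) + g0 (y + a1 / 2 + a2 / 2)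
      - of_real (ln 2) * barnes_zeta2 a1 a2 (of_real (x1 + x2)) 0"
    using G_log_duplication[OF w(2)] unfolding dbl g0_def by (simp add: algebra_simps)
  have pos: "Re (of_real (x1 + x2) - 2 * q) > 0" "Re (of_real (x1 + x2)) > 0"
    using q x1 x2 by auto
  \<comment> \<open>With S = x1 + x2 the difference of the two quadratic polynomials is (2q^2 - (2S
    - a1 - a2)q)/(a1 a2). Half the variance is the coefficient of q^2, hence the factor 4.\<close>
  have Z: "of_real (ln 2) * (barnes_zeta2 a1 a2 (of_real (x1 + x2) - 2 * q) 0 - barnes_zeta2 a1 a2 (of_real (x1 + x2)) 0)
      = q * of_real drift + of_real variance * q\<^sup>2 / 2"
    using a1 a2 unfolding barnes_zeta2_0[OF pos(1)] barnes_zeta2_0[OF pos(2)] drift_def variance_def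
    by (simp add: divide_simps power2_eq_square) (simp add: algebra_simps)
  have "q * of_real drift + of_real variance * q\<^sup>2 / 2 + (\<integral>t. (exp (q * of_real t) - 1) \<partial>levy_measure total_density) =
    (g x1 - g0 x1) + (g x2 - g0 x2) + (g (a1 + a2) - g0 (a1 + a2)) + (g (x1 + x2) - G_log (of_real (x1 + x2) - 2 * q))"
    unfolding total_density_integral[OF q] y_def[symmetric] S1[symmetric] S2[symmetric] S3[symmetric] Z[symmetric] D1
    using D0 by algebra
  thus ?thesis unfolding Let_def barnes_Gamma2_eq
    by (simp only: exp_add exp_diff g_def g0_def)
qed

section \<open>Existence of M, properties of its logarithm and the identity in law\<close>

lemma log_law_exists:
  obtains \<kappa> where "prob_space \<kappa>" "sets \<kappa> = sets borel" "absolutely_continuous lborel \<kappa>" "infinitely_divisible \<kappa>"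
    "\<And>q. Re q < Min {x1, x2, a1 + a2} \<Longrightarrow> integrable \<kappa> (\<lambda>x. exp (q * of_real x))"
    "\<And>q. Re q < Min {x1, x2, a1 + a2} \<Longrightarrow> (\<integral>x. exp (q * of_real x) \<partial>\<kappa>) =
      exp (q * of_real drift + of_real variance * q\<^sup>2 / 2 + (\<integral>t. (exp (q * of_real t) - 1) \<partial>levy_measure total_density))"
proof -
  have v: "variance > 0" using a1 a2 by (simp add: variance_def)
  note hyps = sets_levy_measure AE_levy_measure_pos[OF total_density_measurable] abscissa_pos v total_density_integrable
  from levy_khintchine_exists[OF hyps, where m = drift] obtain \<kappa> where
    k: "prob_space \<kappa>" "sets \<kappa> = sets borel" "absolutely_continuous lborel \<kappa>"
    and I: "\<And>q. Re q < Min {x1, x2, a1 + a2} \<Longrightarrow> integrable \<kappa> (\<lambda>x. exp (q * of_real x))"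
    and E: "\<And>q. Re q < Min {x1, x2, a1 + a2} \<Longrightarrow> (\<integral>x. exp (q * of_real x) \<partial>\<kappa>) =
      exp (q * of_real drift + of_real variance * q\<^sup>2 / 2 + (\<integral>t. (exp (q * of_real t) - 1) \<partial>levy_measure total_density))"
    by blast
  have "infinitely_divisible \<kappa>"
    by (rule levy_khintchine_infinitely_divisible[OF hyps k(1,2), where m = drift], assumption, rule E)
       (use abscissa_pos in simp)
  thus ?thesis using that k I E by blast
qed

lemma M_law_exists: "\<exists>M. M_law a1 a2 x1 x2 M"
proof -
  obtain \<kappa> where k: "prob_space \<kappa>" "sets \<kappa> = sets borel"
    and I: "\<And>q. Re q < Min {x1, x2, a1 + a2} \<Longrightarrow> integrable \<kappa> (\<lambda>x. exp (q * of_real x))"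
    and E: "\<And>q. Re q < Min {x1, x2, a1 + a2} \<Longrightarrow> (\<integral>x. exp (q * of_real x) \<partial>\<kappa>) =
      exp (q * of_real drift + of_real variance * q\<^sup>2 / 2 + (\<integral>t. (exp (q * of_real t) - 1) \<partial>levy_measure total_density))"
    by (rule log_law_exists) (rule that)
  have "mellin_law {0<..} {q. Re q < Min {x1, x2, a1 + a2}} (\<lambda>q. let G = barnes_Gamma2 a1 a2 in
        G (of_real x1 - q) / G (of_real x1) *
             (G (of_real x2 - q) / G (of_real x2)) *
             (G (of_real (a1 + a2) - q) / G (of_real (a1 + a2))) *
             (G (of_real (x1 + x2) - q) / G (of_real (x1 + x2) - 2 * q))) (distr \<kappa> borel exp)"
  proof (rule mellin_law_distr_exp[OF k])
    fix q assume "q \<in> {q. Re q < Min {x1, x2, a1 + a2}}"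
    hence q: "Re q < Min {x1, x2, a1 + a2}" by blast
    show "integrable \<kappa> (\<lambda>x. exp (q * of_real x))" by (rule I[OF q])
    show "(\<integral>x. exp (q * of_real x) \<partial>\<kappa>) = (let G = barnes_Gamma2 a1 a2 in
        G (of_real x1 - q) / G (of_real x1) *
             (G (of_real x2 - q) / G (of_real x2)) *
             (G (of_real (a1 + a2) - q) / G (of_real (a1 + a2))) *
             (G (of_real (x1 + x2) - q) / G (of_real (x1 + x2) - 2 * q)))"
      unfolding M_transform_eq[OF q] by (rule E[OF q])
  qed auto
  thus ?thesis unfolding M_law_def Let_def by blast
qed

lemma M_law_ln:
  assumes M: "M_law a1 a2 x1 x2 M"
  shows "prob_space (distr M borel ln)" "M = distr (distr M borel ln) borel exp"
    "(\<integral>x. exp (\<i> * of_real \<theta> * of_real x) \<partial>distr M borel ln) =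
      exp (\<i> * of_real \<theta> * of_real drift + of_real variance * (\<i> * of_real \<theta>)\<^sup>2 / 2 +
        (\<integral>t. (exp (\<i> * of_real \<theta> * of_real t) - 1) \<partial>levy_measure total_density))"
proof -
  note M' = M[unfolded M_law_def Let_def]
  show "prob_space (distr M borel ln)" by (rule mellin_law_prob_space_ln[OF M']) simp
  show "M = distr (distr M borel ln) borel exp" by (rule mellin_law_eq_distr_exp[OF M']) simp
  have q: "Re (\<i> * of_real \<theta>) < Min {x1, x2, a1 + a2}" using abscissa_pos by simp
  show "(\<integral>x. exp (\<i> * of_real \<theta> * of_real x) \<partial>distr M borel ln) =
      exp (\<i> * of_real \<theta> * of_real drift + of_real variance * (\<i> * of_real \<theta>)\<^sup>2 / 2 +
        (\<integral>t. (exp (\<i> * of_real \<theta> * of_real t) - 1) \<partial>levy_measure total_density))"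
    unfolding M_transform_eq[OF q, symmetric] Let_def
    by (rule mellin_law_integral_ln[OF M']) (use q in auto)
qed

text \<open>The Mellin transform determines the characteristic function of the logarithm, so every M
  of this kind inherits the properties of the constructed law.\<close>

lemma M_law_log_properties:
  assumes M: "M_law a1 a2 x1 x2 M"
  shows "absolutely_continuous lborel (distr M borel ln)" "infinitely_divisible (distr M borel ln)"
proof -
  obtain \<kappa> where k: "prob_space \<kappa>" "sets \<kappa> = sets borel" "absolutely_continuous lborel \<kappa>" "infinitely_divisible \<kappa>"
    and E: "\<And>q. Re q < Min {x1, x2, a1 + a2} \<Longrightarrow> (\<integral>x. exp (q * of_real x) \<partial>\<kappa>) =
      exp (q * of_real drift + of_real variance * q\<^sup>2 / 2 + (\<integral>t. (exp (q * of_real t) - 1) \<partial>levy_measure total_density))"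
    by (rule log_law_exists) (rule that)
  have q: "Re (\<i> * of_real \<theta>) < Min {x1, x2, a1 + a2}" for \<theta> using abscissa_pos by simp
  have "distr M borel ln = \<kappa>"
    by (rule real_law_eqI[OF M_law_ln(1)[OF M] k(1)]) (simp_all only: sets_distr k(2) M_law_ln(3)[OF M] E[OF q])
  thus "absolutely_continuous lborel (distr M borel ln)" "infinitely_divisible (distr M borel ln)" using k by simp_all
qed

text \<open>Independence is applied only to unimodular functions of the logarithms, so integrability
  is immediate from boundedness and the characteristic functions multiply.\<close>

lemma factorization:
  fixes P :: "'p measure"
  assumes M: "M_law a1 a2 x1 x2 M" and P: "prob_space P"
    and ind: "prob_space.indep_vars P (\<lambda>_. borel) (\<lambda>i. [L, X1, X2, X3] ! i) {..<4}"
    and L: "distr P borel L = lognormal 0 (4 * ln 2 / (a1 * a2))"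
    and X1: "inv_barnes_beta22 a1 a2 x1 ((x2 - x1) / 2) ((x2 - x1) / 2) (distr P borel X1)"
    and X2: "inv_barnes_beta22 a1 a2 ((x1 + x2) / 2) (a1 / 2) (a2 / 2) (distr P borel X2)"
    and X3: "inv_barnes_beta22 a1 a2 (a1 + a2) ((x1 + x2 - a1 - a2) / 2) ((x1 + x2 - a1 - a2) / 2) (distr P borel X3)"
  shows "M = distr P borel
               (\<lambda>\<omega>. 2 powr (- (2 * (x1 + x2) - (a1 + a2)) / (a1 * a2)) * L \<omega> * X1 \<omega> * X2 \<omega> * X3 \<omega>)"
proof -
  interpret P: prob_space P by fact
  let ?c = "2 powr (- (2 * (x1 + x2) - (a1 + a2)) / (a1 * a2)) :: real"
  let ?Y = "\<lambda>\<omega>. ?c * L \<omega> * X1 \<omega> * X2 \<omega> * X3 \<omega>"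
  have rv: "[L, X1, X2, X3] ! i \<in> borel_measurable P" if "i < 4" for i
    using ind that unfolding P.indep_vars_def by blast
  have [measurable]: "L \<in> borel_measurable P" "X1 \<in> borel_measurable P" "X2 \<in> borel_measurable P" "X3 \<in> borel_measurable P"
    using rv[of 0] rv[of 1] rv[of 2] rv[of 3] by (simp_all add: numeral_eq_Suc)
  have v: "variance > 0" using a1 a2 by (simp add: variance_def)
  have Lpos: "AE \<omega> in P. L \<omega> > 0"
  proof -
    have "AE x in distr P borel L. x > 0" unfolding L lognormal_def by (subst AE_distr_iff) auto
    thus ?thesis by (subst (asm) AE_distr_iff) auto
  qed
  have Xpos: "AE \<omega> in P. X1 \<omega> > 0" "AE \<omega> in P. X2 \<omega> > 0" "AE \<omega> in P. X3 \<omega> > 0"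
    using inv_barnes_beta22_pos[OF same_sign(1) parameter_pos(1) X1] inv_barnes_beta22_pos[OF same_sign(2) parameter_pos(2) X2]
      inv_barnes_beta22_pos[OF same_sign(3) parameter_pos(3) X3] by (simp_all add: AE_distr_iff)
  have pos: "AE \<omega> in P. L \<omega> > 0 \<and> X1 \<omega> > 0 \<and> X2 \<omega> > 0 \<and> X3 \<omega> > 0"
    using Lpos Xpos by eventually_elim simp
  have "distr M borel ln = distr P borel (\<lambda>\<omega>. ln (?Y \<omega>))"
  proof (rule real_law_eqI)
    show "prob_space (distr M borel ln)" by (rule M_law_ln[OF M])
    show "prob_space (distr P borel (\<lambda>\<omega>. ln (?Y \<omega>)))" by (rule P.prob_space_distr) measurable
    fix \<theta> :: real
    let ?e = "\<lambda>x. exp (\<i> * of_real \<theta> * complex_of_real (ln x))"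
    have EL: "(\<integral>\<omega>. ?e (L \<omega>) \<partial>P) = exp (of_real variance * (\<i> * of_real \<theta>)\<^sup>2 / 2)"
    proof -
      have "(\<integral>\<omega>. ?e (L \<omega>) \<partial>P) = (\<integral>x. ?e x \<partial>distr P borel L)" by (subst integral_distr) auto
      also have "\<dots> = (\<integral>x. exp (\<i> * of_real \<theta> * of_real x) \<partial>density lborel (normal_density 0 (sqrt variance)))"
        unfolding L lognormal_def variance_def by (subst integral_distr) auto
      also have "\<dots> = exp (of_real variance * (\<i> * of_real \<theta>)\<^sup>2 / 2)"
        using v by (subst normal_exp_integral) auto
      finally show ?thesis .
    qed
    have EX: "(\<integral>\<omega>. ?e (X \<omega>) \<partial>P) = levy_char"
      if "X \<in> borel_measurable P" "(\<integral>x. ?e x \<partial>distr P borel X) = levy_char" for X levy_char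
      using that by (subst (asm) integral_distr) auto
    have "(\<integral>\<omega>. (\<Prod>i<4. ?e (([L, X1, X2, X3] ! i) \<omega>)) \<partial>P) = (\<Prod>i<4. \<integral>\<omega>. ?e (([L, X1, X2, X3] ! i) \<omega>) \<partial>P)"
    proof (rule P.indep_vars_lebesgue_integral)
      show "P.indep_vars (\<lambda>_. borel) (\<lambda>i \<omega>. ?e (([L, X1, X2, X3] ! i) \<omega>)) {..<4}"
        by (rule P.indep_vars_compose2[OF ind]) measurable
      fix i :: nat assume "i \<in> {..<4}"
      hence [measurable]: "[L, X1, X2, X3] ! i \<in> borel_measurable P" using rv by simp
      show "integrable P (\<lambda>\<omega>. ?e (([L, X1, X2, X3] ! i) \<omega>))"
        by (rule P.integrable_const_bound[where B = 1]) auto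
    qed simp
    also have "\<dots> = exp (of_real variance * (\<i> * of_real \<theta>)\<^sup>2 / 2) *
       exp (levy_integral (levy_density x1 ((x2 - x1) / 2) ((x2 - x1) / 2)) (\<i> * of_real \<theta>)) *
       exp (levy_integral (levy_density ((x1 + x2) / 2) (a1 / 2) (a2 / 2)) (\<i> * of_real \<theta>)) *
       exp (levy_integral (levy_density (a1 + a2) ((x1 + x2 - a1 - a2) / 2) ((x1 + x2 - a1 - a2) / 2)) (\<i> * of_real \<theta>))"
      by (simp add: numeral_eq_Suc EL
          EX[OF _ inv_barnes_beta22_char[OF same_sign(1) parameter_pos(1) X1]]
          EX[OF _ inv_barnes_beta22_char[OF same_sign(2) parameter_pos(2) X2]]
          EX[OF _ inv_barnes_beta22_char[OF same_sign(3) parameter_pos(3) X3]])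
    finally have prod: "(\<integral>\<omega>. (\<Prod>i<4. ?e (([L, X1, X2, X3] ! i) \<omega>)) \<partial>P) = \<dots>" .
    have q: "Re (\<i> * of_real \<theta>) < Min {x1, x2, a1 + a2}" using abscissa_pos by simp
    have "(\<integral>x. exp (\<i> * of_real \<theta> * of_real x) \<partial>distr P borel (\<lambda>\<omega>. ln (?Y \<omega>))) = (\<integral>\<omega>. ?e (?Y \<omega>) \<partial>P)"
      by (subst integral_distr) auto
    also have "\<dots> = (\<integral>\<omega>. exp (\<i> * of_real \<theta> * of_real drift) * (\<Prod>i<4. ?e (([L, X1, X2, X3] ! i) \<omega>)) \<partial>P)"
    proof (rule integral_cong_AE)
      show "AE \<omega> in P. ?e (?Y \<omega>) = exp (\<i> * of_real \<theta> * of_real drift) * (\<Prod>i<4. ?e (([L, X1, X2, X3] ! i) \<omega>))"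
        using pos
      proof eventually_elim
        case (elim \<omega>)
        \<comment> \<open>\<open>drift\<close> is the logarithm of the constant power of 2;
          splitting the logarithm relies on the almost sure positivity of all factors.\<close>
        have "ln (?Y \<omega>) = drift + ln (L \<omega>) + ln (X1 \<omega>) + ln (X2 \<omega>) + ln (X3 \<omega>)"
          using elim by (simp add: ln_mult ln_powr drift_def)
        thus ?case by (simp add: numeral_eq_Suc distrib_left exp_add)
      qed
    qed (simp_all add: numeral_eq_Suc)
    also have "\<dots> = exp (\<i> * of_real \<theta> * of_real drift) * (\<integral>\<omega>. (\<Prod>i<4. ?e (([L, X1, X2, X3] ! i) \<omega>)) \<partial>P)"
      by (rule integral_mult_right_zero)
    also have "\<dots> = (\<integral>x. exp (\<i> * of_real \<theta> * of_real x) \<partial>distr M borel ln)"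
      unfolding prod M_law_ln(3)[OF M] total_density_integral[OF q] exp_add by (simp only: mult_ac)
    finally show "(\<integral>x. exp (\<i> * of_real \<theta> * of_real x) \<partial>distr M borel ln) =
        (\<integral>x. exp (\<i> * of_real \<theta> * of_real x) \<partial>distr P borel (\<lambda>\<omega>. ln (?Y \<omega>)))" ..
  qed simp_all
  \<comment> \<open>Both laws are carried by the positive half-line, so exponentiating the common
    law of the logarithms recovers them.\<close>
  hence "M = distr (distr P borel (\<lambda>\<omega>. ln (?Y \<omega>))) borel exp" using M_law_ln(2)[OF M] by simp
  also have "\<dots> = distr P borel (\<lambda>\<omega>. exp (ln (?Y \<omega>)))" by (subst distr_distr) (auto simp: o_def)
  also have "\<dots> = distr P borel ?Y"
  proof (rule distr_cong_AE)
    show "AE \<omega> in P. exp (ln (?Y \<omega>)) = ?Y \<omega>"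
      using pos by eventually_elim (intro exp_ln mult_pos_pos, auto)
  qed simp_all
  finally show ?thesis .
qed

end

theorem theorem5p1:
  fixes a1 a2 x1 x2 :: real
  assumes "a1 > 0" "a2 > 0" "x1 > 0" "x2 > 0"
  shows "(\<exists>M. M_law a1 a2 x1 x2 M) \<and>
    (\<exists>\<nu>. inv_barnes_beta22 a1 a2 x1 ((x2 - x1) / 2) ((x2 - x1) / 2) \<nu>) \<and>
    (\<exists>\<nu>. inv_barnes_beta22 a1 a2 ((x1 + x2) / 2) (a1 / 2) (a2 / 2) \<nu>) \<and>
    (\<exists>\<nu>. inv_barnes_beta22 a1 a2 (a1 + a2) ((x1 + x2 - a1 - a2) / 2) ((x1 + x2 - a1 - a2) / 2) \<nu>) \<and>
    (\<forall>M. M_law a1 a2 x1 x2 M \<longrightarrow>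
      (\<forall>(P :: 'p measure) L X1 X2 X3.
         prob_space P \<longrightarrow>
         prob_space.indep_vars P (\<lambda>_. borel) (\<lambda>i. [L, X1, X2, X3] ! i) {..<4} \<longrightarrow>
         distr P borel L = lognormal 0 (4 * ln 2 / (a1 * a2)) \<longrightarrow>
         inv_barnes_beta22 a1 a2 x1 ((x2 - x1) / 2) ((x2 - x1) / 2) (distr P borel X1) \<longrightarrow>
         inv_barnes_beta22 a1 a2 ((x1 + x2) / 2) (a1 / 2) (a2 / 2) (distr P borel X2) \<longrightarrow>
         inv_barnes_beta22 a1 a2 (a1 + a2) ((x1 + x2 - a1 - a2) / 2) ((x1 + x2 - a1 - a2) / 2)
           (distr P borel X3) \<longrightarrow>
         M = distr P borel
               (\<lambda>\<omega>. 2 powr (- (2 * (x1 + x2) - (a1 + a2)) / (a1 * a2)) * L \<omega> * X1 \<omega> * X2 \<omega> * X3 \<omega>)) \<and>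
      absolutely_continuous lborel (distr M borel ln) \<and>
      infinitely_divisible (distr M borel ln))"
proof -
  interpret barnes_factorization a1 a2 x1 x2 by unfold_locales (use assms in auto)
  have inv: "\<exists>\<nu>. inv_barnes_beta22 a1 a2 b0 b1 b2 \<nu>" if "\<exists>\<mu>. barnes_beta22 a1 a2 b0 b1 b2 \<mu>" for b0 b1 b2
    using that by (auto simp: inv_barnes_beta22_def)
  show ?thesis
    by (intro conjI allI impI M_law_exists inv barnes_beta22_exists same_sign parameter_pos factorization M_law_log_properties)
qed

end
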